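(* Let $G=(V,E)$ be a finite, simple, connected graph which is locally connected. The following are equivalent: (i) $G$ is effective Bonnet Myers sharp, i.e. $K:=\min_{x\sim y}\kappa(x,y)>0$ and $\operatorname{diam}_{\operatorname{eff}}(G)=\frac{\max_v\operatorname{Deg}(v)}{K}$; (ii) $G$ is reflective; (iii) $G$ is distance regular and Lichnerowicz sharp; (iv) $G$ is one of: a cocktail party graph with at least $6$ vertices, a Johnson graph, a halved cube, the Schläfli graph, the Gosset graph.
   Context: Locally connected: for every vertex $v$, the subgraph induced on the neighbors of $v$ is connected. $d$ is the combinatorial distance, $\operatorname{Deg}$ the degree, $\operatorname{diam}_{\operatorname{eff}}(G)=\frac{1}{|V|^2}\sum_{x,y}d(x,y)$. Laplacian $\Delta f(x)=\sum_{y\sim x}(f(y)-f(x))$. Ollivier curvature of an edge: $\kappa(x,y)=\inf\{\Delta f(x)-\Delta f(y): f(y)-f(x)=1,\ \max_{u\sim v}|f(u)-f(v)|=1\}$. Lichnerowicz sharp: the smallest positive eigenvalue $\lambda$ of $-\Delta$ equals $\min_{x\sim y}\kappa(x,y)$. Distance regular: there are numbers $b_n,c_n$ such that for every $x$ and every $z$ with $d(x,z)=n$, $z$ has $b_n$ neighbors at distance $n+1$ from $x$ and $c_n$ neighbors at distance $n-1$ from $x$. For adjacent $x\sim y$ let $V_x^y=\{v: d(v,x)<d(v,y)\}$, $V^{xy}=\{v:d(v,x)=d(v,y)\}$. A reflection from $x$ to $y$ is a graph automorphism $\phi$ with $\phi\circ\phi=\mathrm{id}$, $\phi(x)=y$,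 such that the edges between $V_x^y$ and $V_y^x$ are exactly $\{\{x',\phi(x')\}:x'\in V_x^y\}$ and $\phi$ fixes $V^{xy}$ pointwise. $G$ is reflective if every edge $x\sim y$ admits a reflection from $x$ to $y$. Cocktail party graph: $K_{2k}$ minus a perfect matching. Johnson graph $J(n,k)$: $k$-subsets of an $n$-set, adjacent iff sharing $k-1$ elements. Halved cube: even-weight binary strings of length $n$, adjacent iff differing in exactly two coordinates. Schläfli graph: srg$(27,16,10,8)$. Gosset graph: the 56-vertex 27-regular distance regular graph (1-skeleton of the $3_{21}$ polytope). *)

theory Defs
  imports Complex_Main
begin

definition simple_graph :: "'a set \<Rightarrow> ('a \<Rightarrow> 'a \<Rightarrow> bool) \<Rightarrow> bool" where
  "simple_graph V E \<longleftrightarrow> finite V \<and> (\<forall>u v. E u v \<longrightarrow> u \<in> V \<and> v \<in> V)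
     \<and> (\<forall>u v. E u v \<longrightarrow> E v u) \<and> (\<forall>u. \<not> E u u)"

definition adj :: "'a set \<Rightarrow> ('a \<Rightarrow> 'a \<Rightarrow> bool) \<Rightarrow> 'a \<Rightarrow> 'a \<Rightarrow> bool" where
  "adj V E u v \<longleftrightarrow> u \<in> V \<and> v \<in> V \<and> E u v"

definition nbhd :: "'a set \<Rightarrow> ('a \<Rightarrow> 'a \<Rightarrow> bool) \<Rightarrow> 'a \<Rightarrow> 'a set" where
  "nbhd V E v = {w \<in> V. E v w}"

definition Deg :: "'a set \<Rightarrow> ('a \<Rightarrow> 'a \<Rightarrow> bool) \<Rightarrow> 'a \<Rightarrow> nat" where
  "Deg V E v = card (nbhd V E v)"

definition connected_graph :: "'a set \<Rightarrow> ('a \<Rightarrow> 'a \<Rightarrow> bool) \<Rightarrow> bool" where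
  "connected_graph V E \<longleftrightarrow> (\<forall>x\<in>V. \<forall>y\<in>V. \<exists>n. (adj V E ^^ n) x y)"

definition locally_connected :: "'a set \<Rightarrow> ('a \<Rightarrow> 'a \<Rightarrow> bool) \<Rightarrow> bool" where
  "locally_connected V E \<longleftrightarrow> (\<forall>v\<in>V. connected_graph (nbhd V E v) E)"

definition gdist :: "'a set \<Rightarrow> ('a \<Rightarrow> 'a \<Rightarrow> bool) \<Rightarrow> 'a \<Rightarrow> 'a \<Rightarrow> nat" where
  "gdist V E x y = (LEAST n. (adj V E ^^ n) x y)"

definition diam_eff :: "'a set \<Rightarrow> ('a \<Rightarrow> 'a \<Rightarrow> bool) \<Rightarrow> real" where
  "diam_eff V E = (1 / real (card V) ^ 2) * (\<Sum>x\<in>V. \<Sum>y\<in>V. real (gdist V E x y))"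

definition laplacian :: "'a set \<Rightarrow> ('a \<Rightarrow> 'a \<Rightarrow> bool) \<Rightarrow> ('a \<Rightarrow> real) \<Rightarrow> 'a \<Rightarrow> real" where
  "laplacian V E f x = (\<Sum>y\<in>nbhd V E x. f y - f x)"

text \<open>Ollivier curvature of an edge (Lin--Lu--Yau / Muench--Wojciechowski formulation).\<close>
definition ollivier :: "'a set \<Rightarrow> ('a \<Rightarrow> 'a \<Rightarrow> bool) \<Rightarrow> 'a \<Rightarrow> 'a \<Rightarrow> real" where
  "ollivier V E x y = Inf {laplacian V E f x - laplacian V E f y | f.
      f y - f x = 1 \<and> Max {\<bar>f u - f v\<bar> | u v. u \<in> V \<and> v \<in> V \<and> E u v} = 1}"

definition min_curv :: "'a set \<Rightarrow> ('a \<Rightarrow> 'a \<Rightarrow> bool) \<Rightarrow> real" where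
  "min_curv V E = Min {ollivier V E x y | x y. x \<in> V \<and> y \<in> V \<and> E x y}"

definition max_deg :: "'a set \<Rightarrow> ('a \<Rightarrow> 'a \<Rightarrow> bool) \<Rightarrow> nat" where
  "max_deg V E = Max (Deg V E ` V)"

definition eff_BM_sharp :: "'a set \<Rightarrow> ('a \<Rightarrow> 'a \<Rightarrow> bool) \<Rightarrow> bool" where
  "eff_BM_sharp V E \<longleftrightarrow> min_curv V E > 0 \<and>
     diam_eff V E = real (max_deg V E) / min_curv V E"

definition neg_lap_eigenvalue :: "'a set \<Rightarrow> ('a \<Rightarrow> 'a \<Rightarrow> bool) \<Rightarrow> real \<Rightarrow> bool" where
  "neg_lap_eigenvalue V E lam \<longleftrightarrow> (\<exists>f. (\<exists>x\<in>V. f x \<noteq> 0) \<and>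
      (\<forall>x\<in>V. - laplacian V E f x = lam * f x))"

definition lichnerowicz_sharp :: "'a set \<Rightarrow> ('a \<Rightarrow> 'a \<Rightarrow> bool) \<Rightarrow> bool" where
  "lichnerowicz_sharp V E \<longleftrightarrow> (\<exists>lam. neg_lap_eigenvalue V E lam \<and> lam > 0 \<and>
      (\<forall>mu. neg_lap_eigenvalue V E mu \<and> mu > 0 \<longrightarrow> lam \<le> mu) \<and> lam = min_curv V E)"

definition distance_regular :: "'a set \<Rightarrow> ('a \<Rightarrow> 'a \<Rightarrow> bool) \<Rightarrow> bool" where
  "distance_regular V E \<longleftrightarrow> (\<exists>b c :: nat \<Rightarrow> nat. \<forall>x\<in>V. \<forall>z\<in>V.
      card {w \<in> nbhd V E z. gdist V E x w = gdist V E x z + 1} = b (gdist V E x z) \<and>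
      (gdist V E x z \<ge> 1 \<longrightarrow>
        card {w \<in> nbhd V E z. gdist V E x w + 1 = gdist V E x z} = c (gdist V E x z)))"

definition graph_automorphism :: "'a set \<Rightarrow> ('a \<Rightarrow> 'a \<Rightarrow> bool) \<Rightarrow> ('a \<Rightarrow> 'a) \<Rightarrow> bool" where
  "graph_automorphism V E \<phi> \<longleftrightarrow> bij_betw \<phi> V V \<and>
     (\<forall>u\<in>V. \<forall>v\<in>V. E u v \<longleftrightarrow> E (\<phi> u) (\<phi> v))"

definition closer :: "'a set \<Rightarrow> ('a \<Rightarrow> 'a \<Rightarrow> bool) \<Rightarrow> 'a \<Rightarrow> 'a \<Rightarrow> 'a set" where
  "closer V E x y = {v \<in> V. gdist V E v x < gdist V E v y}"

definition equidistant :: "'a set \<Rightarrow> ('a \<Rightarrow> 'a \<Rightarrow> bool) \<Rightarrow> 'a \<Rightarrow> 'a \<Rightarrow> 'a set" where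
  "equidistant V E x y = {v \<in> V. gdist V E v x = gdist V E v y}"

definition is_reflection :: "'a set \<Rightarrow> ('a \<Rightarrow> 'a \<Rightarrow> bool) \<Rightarrow> 'a \<Rightarrow> 'a \<Rightarrow> ('a \<Rightarrow> 'a) \<Rightarrow> bool" where
  "is_reflection V E x y \<phi> \<longleftrightarrow> graph_automorphism V E \<phi> \<and> (\<forall>v\<in>V. \<phi> (\<phi> v) = v) \<and> \<phi> x = y \<and>
     {{u, w} | u w. u \<in> closer V E x y \<and> w \<in> closer V E y x \<and> E u w}
        = {{u, \<phi> u} | u. u \<in> closer V E x y} \<and>
     (\<forall>v\<in>equidistant V E x y. \<phi> v = v)"

definition reflective :: "'a set \<Rightarrow> ('a \<Rightarrow> 'a \<Rightarrow> bool) \<Rightarrow> bool" where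
  "reflective V E \<longleftrightarrow> (\<forall>x\<in>V. \<forall>y\<in>V. E x y \<longrightarrow> (\<exists>\<phi>. is_reflection V E x y \<phi>))"

definition graph_iso :: "'a set \<Rightarrow> ('a \<Rightarrow> 'a \<Rightarrow> bool) \<Rightarrow> 'b set \<Rightarrow> ('b \<Rightarrow> 'b \<Rightarrow> bool) \<Rightarrow> bool" where
  "graph_iso V E W F \<longleftrightarrow> (\<exists>\<phi>. bij_betw \<phi> V W \<and> (\<forall>u\<in>V. \<forall>v\<in>V. E u v \<longleftrightarrow> F (\<phi> u) (\<phi> v)))"

definition cocktail_V :: "nat \<Rightarrow> nat set" where "cocktail_V k = {..<2*k}"
definition cocktail_E :: "nat \<Rightarrow> nat \<Rightarrow> bool" where
  "cocktail_E i j \<longleftrightarrow> i \<noteq> j \<and> i div 2 \<noteq> j div 2"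

definition johnson_V :: "nat \<Rightarrow> nat \<Rightarrow> nat set set" where
  "johnson_V n k = {A. A \<subseteq> {..<n} \<and> card A = k}"
definition johnson_E :: "nat \<Rightarrow> nat set \<Rightarrow> nat set \<Rightarrow> bool" where
  "johnson_E k A B \<longleftrightarrow> A \<noteq> B \<and> card (A \<inter> B) + 1 = k"

definition halved_cube_V :: "nat \<Rightarrow> bool list set" where
  "halved_cube_V n = {xs. length xs = n \<and> even (length (filter id xs))}"
definition halved_cube_E :: "bool list \<Rightarrow> bool list \<Rightarrow> bool" where
  "halved_cube_E xs ys \<longleftrightarrow> card {i. i < length xs \<and> xs ! i \<noteq> ys ! i} = 2"

definition strongly_regular :: "'a set \<Rightarrow> ('a \<Rightarrow> 'a \<Rightarrow> bool) \<Rightarrow> nat \<Rightarrow> nat \<Rightarrow> nat \<Rightarrow> nat \<Rightarrow> bool" where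
  "strongly_regular V E n k l m \<longleftrightarrow> card V = n \<and> (\<forall>v\<in>V. Deg V E v = k) \<and>
     (\<forall>u\<in>V. \<forall>v\<in>V. E u v \<longrightarrow> card (nbhd V E u \<inter> nbhd V E v) = l) \<and>
     (\<forall>u\<in>V. \<forall>v\<in>V. u \<noteq> v \<and> \<not> E u v \<longrightarrow> card (nbhd V E u \<inter> nbhd V E v) = m)"

text \<open>Schlaefli graph: (the unique) srg(27,16,10,8).\<close>
definition is_schlafli :: "'a set \<Rightarrow> ('a \<Rightarrow> 'a \<Rightarrow> bool) \<Rightarrow> bool" where
  "is_schlafli V E \<longleftrightarrow> strongly_regular V E 27 16 10 8"

text \<open>Gosset graph: vertices \<open>\<pm>(4\<cdot>1_S - 1)\<close> for 2-subsets S of {0..7} (i.e. \<open>(b,S)\<close>),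
  adjacent iff the inner product is 8: same sign and \<open>|S\<inter>T| = 1\<close>, or opposite sign and disjoint.\<close>
definition gosset_V :: "(bool \<times> nat set) set" where
  "gosset_V = {(b, S). S \<subseteq> {..<8} \<and> card S = 2}"
definition gosset_E :: "bool \<times> nat set \<Rightarrow> bool \<times> nat set \<Rightarrow> bool" where
  "gosset_E p q \<longleftrightarrow> (if fst p = fst q then card (snd p \<inter> snd q) = 1 else snd p \<inter> snd q = {})"

end

theory Submission
  imports Defs
begin

text \<open>Everything is compared with one metric property, called \<open>parallelogram\<close> below: a path a, x, y with
  \<open>d a y = 2\<close> can be completed by a vertex b with \<open>d a z + d y z = d x z + d b z\<close> for every z. It says that
  the differences \<open>r x y z = d x z - d y z\<close> behave like the pairings of a minuscule weight z with the root
  y - x of a simply laced root system, and the reflection along an edge becomes the formula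
  \<open>d (\<sigma> v) z = d v z + r x y v * r x y z\<close>.

  A reflective graph has the property by inspection of geodesics. If G is effective Bonnet--Myers sharp, equality
  holds in \<open>\<Delta> d(z,\<cdot>) \<le> D - K d(z,\<cdot>)\<close> for all z; the curvature bound gives Hall's condition for a perfect
  matching between the outer neighbours of an edge, and equality forces the matched quadrangles to be parallelograms.
  If G is distance regular and Lichnerowicz sharp, the vertices are represented by vectors whose Gram matrix is given
  by the standard sequence \<open>u\<close> of the eigenvalue. The difference of two adjacent vectors is an optimal Kantorovich
  potential for every edge, which forces \<open>u\<close> to be linear.

  Conversely, with the parallelogram property \<open>\<Delta> d(z,\<cdot>) = D - K d(z,\<cdot>)\<close>, which gives both kinds of sharpness,
  and distance regularity follows by counting roots. For the classification, the neighbourhood of a vertex is again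
  a graph with the parallelogram property, of diameter at most 2, and it determines the whole graph. By induction on
  the number of vertices, the neighbourhood is a rook graph (if it is not locally connected; then G is a Johnson
  graph) or in the list: complete graphs, cocktail party graphs, J(n,2), the halved 5-cube and the Schlaefli graph
  are the neighbourhoods in complete graphs, cocktail party graphs, halved cubes, the Schlaefli graph and the Gosset
  graph.\<close>

section \<open>Distances and reflections\<close>

text \<open>The property only speaks of distances, so it survives isomorphisms and the passage to a
  connected neighbourhood. The edge relation is constrained only inside \<open>V\<close>; hence a
  neighbourhood, with the unchanged relation, is an instance of the same locale.

  The obstacle in the classification is that local connectedness is not inherited: for 2 \<le> k
  \<le> n - 2 the neighbourhoods in J(n,k) are rook graphs, whose own neighbourhoods are two
  disjoint cliques. So the parallelogram property carries the induction and disconnected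
  neighbourhoods are a separate case. The diameter bound ends the induction: J(n,k) with 3 \<le> k
  \<le> n - 3, halved n-cubes with n \<ge> 6 and the Gosset graph have vertices at distance 3 and
  cannot be neighbourhoods.

  In a distance regular graph, the inequalities for the real-valued potential alone would leave room
  for a defect of the standard sequence at distance 2. Rounding the potential to integers excludes
  small defects, and two adjacent triangles inside a closed neighbourhood exclude large
  ones.\<close>

locale cgraph =
  fixes V :: "'a set" and E :: "'a \<Rightarrow> 'a \<Rightarrow> bool"
  assumes fin: "finite V"
    and sym: "\<And>u v. u \<in> V \<Longrightarrow> v \<in> V \<Longrightarrow> E u v \<Longrightarrow> E v u"
    and irr: "\<And>u. u \<in> V \<Longrightarrow> \<not> E u u"
    and conn: "connected_graph V E"
begin

abbreviation N where "N \<equiv> nbhd V E"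
abbreviation d where "d \<equiv> gdist V E"

lemma N_iff: "w \<in> N v \<longleftrightarrow> w \<in> V \<and> E v w"
  by (simp add: nbhd_def)

lemma N_subset: "N v \<subseteq> V" by (auto simp: nbhd_def)

lemma fin_N [simp]: "finite (N v)"
  using fin N_subset finite_subset by blast

lemma N_V: "w \<in> N v \<Longrightarrow> w \<in> V" by (simp add: N_iff)

lemma N_sym: "v \<in> V \<Longrightarrow> w \<in> N v \<Longrightarrow> v \<in> N w"
  using sym by (auto simp: N_iff)

lemma N_irr: "v \<in> V \<Longrightarrow> v \<notin> N v"
  using irr by (auto simp: N_iff)

lemma adj_sym: "adj V E u v \<Longrightarrow> adj V E v u"
  using sym by (auto simp: adj_def)

lemma walk_sym: "(adj V E ^^ n) x y \<Longrightarrow> (adj V E ^^ n) y x"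
proof (induction n arbitrary: y)
  case (Suc n)
  from Suc.prems obtain w where "(adj V E ^^ n) x w" "adj V E w y" by (auto elim: relpowp_Suc_E)
  then show ?case using Suc.IH adj_sym relpowp_Suc_I2 by metis
qed auto

lemma d_le: "(adj V E ^^ n) x y \<Longrightarrow> d x y \<le> n"
  unfolding gdist_def by (rule Least_le)

lemma d_walk: "x \<in> V \<Longrightarrow> y \<in> V \<Longrightarrow> (adj V E ^^ d x y) x y"
  unfolding gdist_def by (rule LeastI_ex) (use conn in \<open>auto simp: connected_graph_def\<close>)

lemma d_sym: "x \<in> V \<Longrightarrow> y \<in> V \<Longrightarrow> d x y = d y x"
  by (meson antisym d_le d_walk walk_sym)

lemma d_refl [simp]: "d x x = 0"
  using d_le[of 0 x x] by simp

lemma d_eq_0 [simp]: "x \<in> V \<Longrightarrow> y \<in> V \<Longrightarrow> d x y = 0 \<longleftrightarrow> x = y"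
  using d_walk[of x y] by auto

lemma walk_add: "(adj V E ^^ m) x y \<Longrightarrow> (adj V E ^^ n) y z \<Longrightarrow> (adj V E ^^ (m + n)) x z"
  by (auto simp: relpowp_add)

lemma d_triangle: "x \<in> V \<Longrightarrow> y \<in> V \<Longrightarrow> z \<in> V \<Longrightarrow> d x z \<le> d x y + d y z"
  by (meson d_le d_walk walk_add)

lemma d_eq_1: "x \<in> V \<Longrightarrow> y \<in> V \<Longrightarrow> d x y = 1 \<longleftrightarrow> y \<in> N x"
proof
  assume "x \<in> V" "y \<in> V" "d x y = 1"
  with d_walk[of x y] show "y \<in> N x" by (auto simp: adj_def N_iff)
next
  assume a: "x \<in> V" "y \<in> V" "y \<in> N x"
  then have "(adj V E ^^ 1) x y" by (auto simp: adj_def N_iff)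
  then have "d x y \<le> 1" by (rule d_le)
  moreover have "d x y \<noteq> 0" using a N_irr by auto
  ultimately show "d x y = 1" by simp
qed

lemma d_N: "x \<in> V \<Longrightarrow> y \<in> N x \<Longrightarrow> d x y = 1"
  using d_eq_1 N_V by blast

lemma d_N': "x \<in> V \<Longrightarrow> y \<in> N x \<Longrightarrow> d y x = 1"
  using d_N[of x y] d_sym[of x y] N_V[of y x] by simp

lemma d_N_le: "x \<in> V \<Longrightarrow> y \<in> N x \<Longrightarrow> z \<in> V \<Longrightarrow> d z y \<le> d z x + 1"
  using d_triangle[of z x y] d_N[of x y] N_V[of y x] by simp

lemma d_N_le': "x \<in> V \<Longrightarrow> y \<in> N x \<Longrightarrow> z \<in> V \<Longrightarrow> d z x \<le> d z y + 1"
  using d_N_le[of y x z] N_sym[of x y] N_V[of y x] by simp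

lemma d_N_le2: "x \<in> V \<Longrightarrow> y \<in> N x \<Longrightarrow> z \<in> V \<Longrightarrow> d y z \<le> d x z + 1 \<and> d x z \<le> d y z + 1"
  using d_N_le[of x y z] d_N_le'[of x y z] d_sym[of y z] d_sym[of x z] N_V[of y x] by simp

lemma d_two: "x \<in> V \<Longrightarrow> u \<in> N x \<Longrightarrow> v \<in> N x \<Longrightarrow> u \<noteq> v \<Longrightarrow> v \<notin> N u \<Longrightarrow> d u v = 2"
proof -
  assume a: "x \<in> V" "u \<in> N x" "v \<in> N x" "u \<noteq> v" "v \<notin> N u"
  have "d u v \<noteq> 0" "d u v \<noteq> 1" using a d_eq_1[of u v] N_V[of u x] N_V[of v x] by simp_all
  moreover have "d u v \<le> 2" using d_N_le[of x v u] d_N'[of x u] a N_V[of u x] by simp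
  ultimately show "d u v = 2" by simp
qed

lemma d_two_iff: "x \<in> V \<Longrightarrow> u \<in> N x \<Longrightarrow> v \<in> N x \<Longrightarrow> d u v = 2 \<longleftrightarrow> u \<noteq> v \<and> v \<notin> N u"
  using d_two[of x u v] d_N[of u v] N_V[of u x] by (cases "v \<in> N u") auto

lemma step_left: assumes "x \<in> V" "z \<in> V" "d x z = Suc n"
  obtains y where "y \<in> N x" "d y z = n"
proof -
  have "(adj V E ^^ Suc n) x z" using d_walk[OF assms(1,2)] unfolding assms(3) .
  then obtain y where y: "adj V E x y" "(adj V E ^^ n) y z" using relpowp_Suc_D2[of n "adj V E" x z] by blast
  then have yN: "y \<in> N x" by (auto simp: adj_def N_iff)
  have "d y z \<le> n" using d_le y by blast
  moreover have "d x z \<le> d y z + 1" using d_N_le2[of x y z] yN assms(1,2) by blast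
  ultimately have "d y z = n" using assms(3) by linarith
  then show ?thesis using that yN by blast
qed

text \<open>Degrees, local counts and Laplacian identities are spread over the graph this way, the
  passage along an edge being a reflection in most cases.\<close>

lemma connected_induct:
  assumes "x \<in> V" "Q x" "\<And>u v. u \<in> V \<Longrightarrow> v \<in> N u \<Longrightarrow> Q u \<Longrightarrow> Q v" "y \<in> V"
  shows "Q y"
proof -
  have "\<forall>y. y \<in> V \<longrightarrow> d y x = n \<longrightarrow> Q y" for n
  proof (induction n)
    case 0 then show ?case using assms by auto
  next
    case (Suc n)
    show ?case
    proof (intro allI impI)
      fix y assume y: "y \<in> V" "d y x = Suc n"
      obtain w where w: "w \<in> N y" "d w x = n" using step_left[OF y(1) assms(1) y(2)] .
      then have "w \<in> V" "y \<in> N w" using N_V N_sym y(1) by blast+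
      then show "Q y" using Suc.IH assms(3)[of w y] w by blast
    qed
  qed
  then show ?thesis using assms by blast
qed

text \<open>The pairing of the weight z with the root of the arc from x to y.\<close>
definition r where "r x y z = int (d x z) - int (d y z)"

lemma r_cases: "x \<in> V \<Longrightarrow> y \<in> N x \<Longrightarrow> z \<in> V \<Longrightarrow> r x y z = -1 \<or> r x y z = 0 \<or> r x y z = 1"
  using d_N_le2[of x y z] by (auto simp: r_def)

lemma r_self: "x \<in> V \<Longrightarrow> y \<in> N x \<Longrightarrow> r x y x = -1" "x \<in> V \<Longrightarrow> y \<in> N x \<Longrightarrow> r x y y = 1"
  by (simp_all add: r_def d_N d_N')

text \<open>The value at \<open>z = u\<close> already decides. A vertex may therefore be specified
  by its distance function, which is how reflections are introduced.\<close>

lemma d_inj: "u \<in> V \<Longrightarrow> v \<in> V \<Longrightarrow> (\<And>z. z \<in> V \<Longrightarrow> d u z = d v z) \<Longrightarrow> u = v"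
  using d_eq_0 d_refl by metis

end

text \<open>At \<open>z = x\<close>, \<open>a\<close> and \<open>y\<close> the identity gives
  \<open>d b x = 2\<close> and \<open>d b a = d b y = 1\<close>, so it already makes
  \<open>b\<close> the vertex opposite to \<open>x\<close> in a quadrangle.\<close>

definition parallelogram :: "'a set \<Rightarrow> ('a \<Rightarrow> 'a \<Rightarrow> bool) \<Rightarrow> bool" where
  "parallelogram V E \<longleftrightarrow> (\<forall>x\<in>V. \<forall>a\<in>nbhd V E x. \<forall>y\<in>nbhd V E x. gdist V E a y = 2 \<longrightarrow>
     (\<exists>b\<in>V. \<forall>z\<in>V. gdist V E a z + gdist V E y z = gdist V E x z + gdist V E b z))"

locale pgraph = cgraph +
  assumes par: "parallelogram V E"
begin

text \<open>The vertex \<open>w\<close> is v + (y - x), for a \<open>v\<close> that pairs to -1 with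
  this root. Translate the next vertex of a geodesic from \<open>v\<close> to \<open>x\<close>;
  completing one quadrangle at that vertex then translates \<open>v\<close>.\<close>

lemma shift_ex:
  assumes "x \<in> V" "y \<in> N x" "v \<in> V" "d v y = d v x + 1"
  shows "\<exists>w\<in>V. \<forall>z\<in>V. d v z + d y z = d x z + d w z"
  using assms(3,4)
proof (induction "d v x" arbitrary: v)
  case 0
  then have "v = x" using assms by auto
  then show ?case using N_V[OF assms(2)] by auto
next
  case (Suc n)
  have yV: "y \<in> V" using assms N_V by blast
  obtain w where w: "w \<in> N v" "d w x = n" using step_left[OF Suc(3) assms(1) Suc(2)[symmetric]] .
  have wV: "w \<in> V" using w N_V by blast
  \<comment> \<open>The pairing is still -1 at \<open>w\<close>: the lower bound comes from
    \<open>v\<close>, the upper one from \<open>x\<close>.\<close>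
  have dwy: "d w y = n + 1"
    using d_N_le2[of v w y] d_N_le[of x y w] w Suc assms wV yV by auto
  then obtain w' where w': "w' \<in> V" "\<forall>z\<in>V. d w z + d y z = d x z + d w' z"
    using Suc(1)[of w] wV w by auto
  have "d w' w = 1" using w'(2)[rule_format, of w] wV dwy w d_sym[of w x] d_sym[of w y] assms yV by simp
  then have w'N: "w' \<in> N w" using d_eq_1[of w w'] d_sym[of w w'] w' wV by simp
  have "d w' v = 2"
    using w'(2)[rule_format, of v] Suc d_N'[of v w] w wV yV d_sym[of v x] d_sym[of v y] assms by simp
  then have "d v w' = 2" using d_sym[of v w'] w' Suc by simp
  moreover have "v \<in> N w" using N_sym w Suc by blast
  ultimately obtain b where "b \<in> V" "\<forall>z\<in>V. d v z + d w' z = d w z + d b z"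
    using par[unfolded parallelogram_def] wV w'N by meson
  then have "\<forall>z\<in>V. d v z + d y z = d x z + d b z" using w' by fastforce
  then show ?case using \<open>b \<in> V\<close> by blast
qed

definition \<sigma> where "\<sigma> x y v = (THE w. w \<in> V \<and> (\<forall>z\<in>V. int (d w z) = int (d v z) + r x y v * r x y z))"

text \<open>Existence is a case distinction on the pairing: translation by the root for -1, the
  vertex itself for 0, translation along the reversed arc for 1. Uniqueness is
  \<open>d_inj\<close>.\<close>

lemma \<sigma>_prop:
  assumes "x \<in> V" "y \<in> N x" "v \<in> V"
  shows "\<sigma> x y v \<in> V \<and> (\<forall>z\<in>V. int (d (\<sigma> x y v) z) = int (d v z) + r x y v * r x y z)"
  unfolding \<sigma>_def
proof (rule theI')
  have yV: "y \<in> V" using assms N_V by blast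
  have ex: "\<exists>w\<in>V. \<forall>z\<in>V. int (d w z) = int (d v z) + r x y v * r x y z"
    using r_cases[OF assms]
  proof (elim disjE)
    assume r: "r x y v = -1"
    then have "d v y = d v x + 1" using d_sym assms yV by (auto simp: r_def)
    from shift_ex[OF assms this] obtain w where w: "w \<in> V" "\<forall>z\<in>V. d v z + d y z = d x z + d w z" by blast
    have "int (d w z) = int (d v z) + r x y v * r x y z" if "z \<in> V" for z
      using w(2)[rule_format, OF that] unfolding r by (simp add: r_def)
    then show ?thesis using w by blast
  next
    assume r: "r x y v = 0"
    then show ?thesis using assms by (intro bexI[of _ v]) auto
  next
    assume r: "r x y v = 1"
    then have "d v x = d v y + 1" using d_sym[of v x] d_sym[of v y] assms yV by (auto simp: r_def)
    from shift_ex[OF yV N_sym[OF assms(1,2)] assms(3) this] obtain w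
      where w: "w \<in> V" "\<forall>z\<in>V. d v z + d x z = d y z + d w z" by blast
    have "int (d w z) = int (d v z) + r x y v * r x y z" if "z \<in> V" for z
      using w(2)[rule_format, OF that] unfolding r by (simp add: r_def)
    then show ?thesis using w by blast
  qed
  show "\<exists>!w. w \<in> V \<and> (\<forall>z\<in>V. int (d w z) = int (d v z) + r x y v * r x y z)"
  proof (rule ex_ex1I)
    show "\<exists>w. w \<in> V \<and> (\<forall>z\<in>V. int (d w z) = int (d v z) + r x y v * r x y z)" using ex by blast
  next
    fix w w' assume a: "w \<in> V \<and> (\<forall>z\<in>V. int (d w z) = int (d v z) + r x y v * r x y z)"
      "w' \<in> V \<and> (\<forall>z\<in>V. int (d w' z) = int (d v z) + r x y v * r x y z)"
    show "w = w'"
    proof (rule d_inj)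
      fix z assume "z \<in> V"
      then have "int (d w z) = int (d w' z)" using a by simp
      then show "d w z = d w' z" by simp
    qed (use a in auto)
  qed
qed

lemma \<sigma>_V: "x \<in> V \<Longrightarrow> y \<in> N x \<Longrightarrow> v \<in> V \<Longrightarrow> \<sigma> x y v \<in> V"
  using \<sigma>_prop by blast

lemma d_\<sigma>: "x \<in> V \<Longrightarrow> y \<in> N x \<Longrightarrow> v \<in> V \<Longrightarrow> z \<in> V \<Longrightarrow>
    int (d (\<sigma> x y v) z) = int (d v z) + r x y v * r x y z"
  using \<sigma>_prop by blast

lemma r_\<sigma>: "x \<in> V \<Longrightarrow> y \<in> N x \<Longrightarrow> v \<in> V \<Longrightarrow> r x y (\<sigma> x y v) = - r x y v"
  using d_\<sigma>[of x y v x] d_\<sigma>[of x y v y] r_self[of x y] N_V[of y x] \<sigma>_V[of x y v]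
    d_sym[of "\<sigma> x y v" x] d_sym[of "\<sigma> x y v" y] d_sym[of v x] d_sym[of v y]
  by (simp add: r_def)

lemma \<sigma>_invol: "x \<in> V \<Longrightarrow> y \<in> N x \<Longrightarrow> v \<in> V \<Longrightarrow> \<sigma> x y (\<sigma> x y v) = v"
proof (rule d_inj)
  fix z assume "x \<in> V" "y \<in> N x" "v \<in> V" "z \<in> V"
  then have "int (d (\<sigma> x y (\<sigma> x y v)) z) = int (d v z)" by (simp add: d_\<sigma>[of x y] \<sigma>_V[of x y] r_\<sigma>[of x y])
  then show "d (\<sigma> x y (\<sigma> x y v)) z = d v z" by simp
qed (auto intro: \<sigma>_V)

text \<open>Using the distance formula in both arguments adds \<open>r x y v * r x y w\<close>
  twice, with opposite signs.\<close>

lemma \<sigma>_isom: assumes "x \<in> V" "y \<in> N x" "v \<in> V" "w \<in> V"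
  shows "d (\<sigma> x y v) (\<sigma> x y w) = d v w"
proof -
  have "int (d (\<sigma> x y v) (\<sigma> x y w)) = int (d (\<sigma> x y w) v) + r x y v * r x y (\<sigma> x y w)"
    using assms d_\<sigma>[of x y v "\<sigma> x y w"] d_sym[of v "\<sigma> x y w"] \<sigma>_V[of x y w] by simp
  also have "\<dots> = int (d v w)" using assms d_sym[of w v] by (simp add: d_\<sigma>[of x y] r_\<sigma>[of x y])
  finally show ?thesis by simp
qed

lemma \<sigma>_fix: "x \<in> V \<Longrightarrow> y \<in> N x \<Longrightarrow> v \<in> V \<Longrightarrow> r x y v = 0 \<Longrightarrow> \<sigma> x y v = v"
  using d_\<sigma>[of x y v] \<sigma>_V[of x y v] by (intro d_inj) simp_all

lemma \<sigma>_x: "x \<in> V \<Longrightarrow> y \<in> N x \<Longrightarrow> \<sigma> x y x = y"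
proof (rule d_inj)
  fix z assume a: "x \<in> V" "y \<in> N x" "z \<in> V"
  then have "int (d (\<sigma> x y x) z) = int (d y z)" using d_\<sigma>[of x y x z] r_self(1)[of x y] by (simp add: r_def)
  then show "d (\<sigma> x y x) z = d y z" by simp
qed (use \<sigma>_V N_V in blast)+

lemma \<sigma>_N: "x \<in> V \<Longrightarrow> y \<in> N x \<Longrightarrow> v \<in> V \<Longrightarrow> w \<in> V \<Longrightarrow> \<sigma> x y w \<in> N (\<sigma> x y v) \<longleftrightarrow> w \<in> N v"
  using d_eq_1[of v w] d_eq_1[of "\<sigma> x y v" "\<sigma> x y w"] \<sigma>_isom[of x y v w] \<sigma>_V[of x y v] \<sigma>_V[of x y w] by simp

lemma \<sigma>_bij: "x \<in> V \<Longrightarrow> y \<in> N x \<Longrightarrow> bij_betw (\<sigma> x y) V V"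
  by (rule bij_betw_byWitness[where f' = "\<sigma> x y"]) (auto simp: \<sigma>_V[of x y] \<sigma>_invol[of x y])

lemma \<sigma>_image_N: "x \<in> V \<Longrightarrow> y \<in> N x \<Longrightarrow> v \<in> V \<Longrightarrow> \<sigma> x y ` N v = N (\<sigma> x y v)"
proof (intro equalityI subsetI)
  fix w assume a: "x \<in> V" "y \<in> N x" "v \<in> V" "w \<in> N (\<sigma> x y v)"
  have wV: "w \<in> V" using a N_V by blast
  then have "\<sigma> x y w \<in> N v" using \<sigma>_N[of x y v "\<sigma> x y w"] \<sigma>_invol[of x y w] \<sigma>_V[of x y w] a by simp
  moreover have "w = \<sigma> x y (\<sigma> x y w)" using \<sigma>_invol[of x y w] a wV by simp
  ultimately show "w \<in> \<sigma> x y ` N v" by blast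
next
  fix w assume a: "x \<in> V" "y \<in> N x" "v \<in> V" "w \<in> \<sigma> x y ` N v"
  then obtain u where "u \<in> N v" "w = \<sigma> x y u" by blast
  then show "w \<in> N (\<sigma> x y v)" using \<sigma>_N[of x y v u] a N_V by blast
qed

text \<open>The three parts of the vertex set are the level sets -1, 1 and 0 of
  \<open>r x y\<close>. For adjacent \<open>u\<close> and \<open>w\<close> on the two sides the
  formula gives \<open>d (\<sigma> x y u) w = 1 - 1 = 0\<close>, so every crossing edge joins a
  vertex to its image.\<close>

lemma is_reflection_\<sigma>: assumes xy: "x \<in> V" "y \<in> N x"
  shows "is_reflection V E x y (\<sigma> x y)"
proof -
  have yV: "y \<in> V" using xy N_V by blast
  have c1: "u \<in> closer V E x y \<longleftrightarrow> u \<in> V \<and> r x y u = -1" for u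
    using r_cases[OF xy, of u] d_sym[of u x] d_sym[of u y] xy yV by (auto simp: closer_def r_def)
  have c2: "u \<in> closer V E y x \<longleftrightarrow> u \<in> V \<and> r x y u = 1" for u
    using r_cases[OF xy, of u] d_sym[of u x] d_sym[of u y] xy yV by (auto simp: closer_def r_def)
  have c3: "u \<in> equidistant V E x y \<longleftrightarrow> u \<in> V \<and> r x y u = 0" for u
    using d_sym[of u x] d_sym[of u y] xy yV by (auto simp: equidistant_def r_def)
  have "E u v \<longleftrightarrow> E (\<sigma> x y u) (\<sigma> x y v)" if "u \<in> V" "v \<in> V" for u v
    using \<sigma>_N[of x y u v] xy that \<sigma>_V[of x y] by (simp add: N_iff)
  then have auto: "graph_automorphism V E (\<sigma> x y)"
    using \<sigma>_bij xy by (simp add: graph_automorphism_def)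
  have cross: "w = \<sigma> x y u" if "u \<in> V" "r x y u = -1" "w \<in> V" "r x y w = 1" "E u w" for u w
  proof -
    have "d u w = 1" using d_eq_1 that by (simp add: N_iff)
    then have "int (d (\<sigma> x y u) w) = 0" using that xy by (simp add: d_\<sigma>)
    then show ?thesis using that xy \<sigma>_V[of x y u] by simp
  qed
  have cross2: "E u (\<sigma> x y u)" if "u \<in> V" "r x y u = -1" for u
  proof -
    have "int (d (\<sigma> x y u) u) = 1" using that xy by (simp add: d_\<sigma>)
    then show ?thesis using d_eq_1[of u "\<sigma> x y u"] d_sym[of u "\<sigma> x y u"] that xy \<sigma>_V[of x y u] by (simp add: N_iff)
  qed
  have "{{u, w} | u w. u \<in> closer V E x y \<and> w \<in> closer V E y x \<and> E u w}
        = {{u, \<sigma> x y u} | u. u \<in> closer V E x y}"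
    unfolding c1 c2
    apply (intro equalityI subsetI; clarsimp)
     apply (metis cross)
    using cross2 \<sigma>_V[OF xy] r_\<sigma>[OF xy] apply fastforce
    done
  then show ?thesis
    unfolding is_reflection_def using auto c3 \<sigma>_invol \<sigma>_x \<sigma>_fix xy by auto
qed

lemma reflective_pgraph: "reflective V E"
  unfolding reflective_def using is_reflection_\<sigma> by (metis N_iff)

end

section \<open>Neighbourhoods as graphs of the same kind\<close>

context cgraph begin

lemma d_eq_2:
  assumes "u \<in> V" "v \<in> V"
  shows "d u v = 2 \<longleftrightarrow> u \<noteq> v \<and> v \<notin> N u \<and> (\<exists>w\<in>N u. v \<in> N w)"
proof
  assume d2: "d u v = 2"
  then have "d u v = Suc 1" by simp
  then obtain w where "w \<in> N u" "d w v = 1" using step_left[OF assms] by metis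
  then have "v \<in> N w" using d_eq_1[of w v] N_V[of w u] assms by simp
  then show "u \<noteq> v \<and> v \<notin> N u \<and> (\<exists>w\<in>N u. v \<in> N w)"
    using d2 \<open>w \<in> N u\<close> d_eq_1[OF assms] by auto
next
  assume a: "u \<noteq> v \<and> v \<notin> N u \<and> (\<exists>w\<in>N u. v \<in> N w)"
  then obtain w where w: "w \<in> N u" "v \<in> N w" by blast
  then have "w \<in> V" "u \<in> N w" using N_V N_sym assms by blast+
  then show "d u v = 2" using d_two[of w u v] w a by simp
qed

lemma nbhd_local: "nbhd (N x) E y = N x \<inter> N y"
  by (auto simp: nbhd_def)

lemma local_cgraph: "x \<in> V \<Longrightarrow> connected_graph (N x) E \<Longrightarrow> cgraph (N x) E"
  using fin_N N_V sym irr by (intro cgraph.intro) blast+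

end

context pgraph begin

text \<open>Walks inside \<open>N x\<close> shorten to length at most 2. For u, w1, w, v without
  shortcuts, let \<open>b\<close> be opposite to \<open>w\<close> in the quadrangle on w1, w, v. The
  distance identity at \<open>x\<close>, \<open>v\<close> and \<open>u\<close> makes
  \<open>b\<close> a common neighbour of \<open>u\<close> and \<open>v\<close> inside
  \<open>N x\<close>.\<close>

lemma local_walk:
  assumes "x \<in> V" "u \<in> N x" "(adj (N x) E ^^ n) u v"
  shows "v \<in> N x \<and> (u = v \<or> v \<in> N u \<or> (\<exists>w\<in>N x. w \<in> N u \<and> v \<in> N w))"
  using assms(3)
proof (induction n arbitrary: v)
  case 0 then show ?case using assms by auto
next
  case (Suc n)
  then obtain w where w: "(adj (N x) E ^^ n) u w" "adj (N x) E w v" by (auto elim: relpowp_Suc_E)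
  then have wv: "w \<in> N x" "v \<in> N x" "v \<in> N w" by (auto simp: adj_def N_iff)
  have V: "u \<in> V" "v \<in> V" "w \<in> V" using wv assms N_V by blast+
  consider "u = w" | "w \<in> N u" | w1 where "w1 \<in> N x" "w1 \<in> N u" "w \<in> N w1" "u \<noteq> w" "w \<notin> N u"
    using Suc.IH[OF w(1)] by blast
  then show ?case
  proof cases
    case (3 w1)
    have V1: "w1 \<in> V" using 3 N_V by blast
    show ?thesis
    proof (cases "u = v \<or> v \<in> N u \<or> v \<in> N w1")
      case False
      then have ne: "u \<noteq> v" "v \<notin> N u" "v \<notin> N w1" by auto
      have "w1 \<noteq> v" using ne 3 by blast
      then have d1: "d w1 v = 2" using d_two[of w w1 v] N_sym[OF V1 3(3)] V wv ne by simp
      have d2: "d u v = 2" "d u w = 2" using d_two[of x u v] d_two[of x u w] ne assms wv 3 by simp_all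
      obtain b where b: "b \<in> V" "\<forall>z\<in>V. d w1 z + d v z = d w z + d b z"
        using par[unfolded parallelogram_def, rule_format, OF V(3) N_sym[OF V1 3(3)] wv(3) d1] by blast
      have "d b x = 1" using b(2)[rule_format, OF assms(1)] d_N'[OF assms(1)] 3 wv by simp
      then have "b \<in> N x" using d_eq_1[of x b] d_sym[of x b] b assms by simp
      moreover have "d b v = 1" using b(2)[rule_format, OF V(2)] d1 d_N[OF V(3) wv(3)] by simp
      then have "v \<in> N b" using d_eq_1[of b v] b V by simp
      moreover have "d b u = 1"
        using b(2)[rule_format, OF V(1)] d2 d_sym[of w u] d_sym[of v u] d_N'[OF V(1) 3(2)] V by simp
      then have "b \<in> N u" using d_eq_1[of u b] d_sym[of u b] b V by simp
      ultimately show ?thesis using wv by blast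
    qed (use 3 wv in blast)
  qed (use wv in blast)+
qed

lemma local_common:
  assumes "x \<in> V" "connected_graph (N x) E" "u \<in> N x" "v \<in> N x" "u \<noteq> v" "v \<notin> N u"
  shows "\<exists>w\<in>N x. w \<in> N u \<and> v \<in> N w"
  using local_walk[OF assms(1,3)] assms(2-) unfolding connected_graph_def by blast

lemma local_dist:
  assumes "x \<in> V" "connected_graph (N x) E" "u \<in> N x" "v \<in> N x"
  shows "gdist (N x) E u v = d u v"
proof -
  interpret L: cgraph "N x" E using local_cgraph[OF assms(1,2)] .
  have V: "u \<in> V" "v \<in> V" using assms N_V by blast+
  show ?thesis
  proof (cases "u = v \<or> v \<in> N u")
    case True
    then show ?thesis using L.d_eq_1[of u v] d_eq_1[of u v] assms V by (auto simp: nbhd_local)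
  next
    case False
    then obtain w where "w \<in> N x" "w \<in> N u" "v \<in> N w" using local_common[OF assms] by blast
    then have "gdist (N x) E u v = 2"
      using L.d_eq_2[OF assms(3,4)] False assms unfolding nbhd_local by blast
    then show ?thesis using d_two[of x u v] assms False by simp
  qed
qed

text \<open>Distances in a connected neighbourhood are those of the whole graph, so only membership
  is at stake: at \<open>z = x\<close> the identity reads \<open>1 + 1 = 1 + d b x\<close>, and the
  fourth vertex lies in \<open>N x\<close>.\<close>

lemma local_pgraph:
  assumes "x \<in> V" "connected_graph (N x) E"
  shows "pgraph (N x) E"
proof -
  interpret L: cgraph "N x" E using local_cgraph[OF assms(1,2)] .
  have "parallelogram (N x) E" unfolding parallelogram_def nbhd_local
  proof (intro ballI impI)
    fix y a c assume h: "y \<in> N x" "a \<in> N x \<inter> N y" "c \<in> N x \<inter> N y" "gdist (N x) E a c = 2"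
    have V: "y \<in> V" using h N_V by blast
    have "d a c = 2" using h local_dist[OF assms, of a c] by simp
    then obtain b where b: "b \<in> V" "\<forall>z\<in>V. d a z + d c z = d y z + d b z"
      using par[unfolded parallelogram_def] h V by (meson IntD2)
    have "d b x = 1" using b(2)[rule_format, OF assms(1)] d_N'[OF assms(1)] h by simp
    then have bN: "b \<in> N x" using d_eq_1[of x b] d_sym[of x b] b assms by simp
    have "\<forall>z\<in>N x. gdist (N x) E a z + gdist (N x) E c z = gdist (N x) E y z + gdist (N x) E b z"
      using b(2) bN h by (simp add: local_dist[OF assms] N_V[of _ x])
    then show "\<exists>b\<in>N x. \<forall>z\<in>N x. gdist (N x) E a z + gdist (N x) E c z = gdist (N x) E y z + gdist (N x) E b z"
      using bN by blast
  qed
  then show ?thesis by unfold_locales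
qed

text \<open>The inner product of the roots of the arcs from x to its neighbours y and y' is \<open>2 - d y y'\<close>.\<close>
lemma r_act:
  assumes "x \<in> V" "y \<in> N x" "y' \<in> N x" "z \<in> V"
  shows "r x y' (\<sigma> x y z) = r x y' z - r x y z * (2 - int (d y y'))"
proof -
  have V: "y \<in> V" "y' \<in> V" "\<sigma> x y z \<in> V" using assms N_V \<sigma>_V by blast+
  have "int (d x (\<sigma> x y z)) = int (d x z) - r x y z"
    using d_\<sigma>[of x y z x] assms V d_sym[of x "\<sigma> x y z"] d_sym[of x z] r_self(1)[of x y] by simp
  moreover have "int (d y' (\<sigma> x y z)) = int (d y' z) + r x y z * (1 - int (d y y'))"
    using d_\<sigma>[of x y z y'] assms V d_sym[of y' "\<sigma> x y z"] d_sym[of y' z] d_N[of x y'] 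
    by (simp add: r_def)
  ultimately have "r x y' (\<sigma> x y z) = int (d x z) - r x y z - (int (d y' z) + r x y z * (1 - int (d y y')))"
    unfolding r_def[of x y'] by simp
  also have "\<dots> = r x y' z - r x y z * (2 - int (d y y'))" unfolding r_def[of x y'] by algebra
  finally show ?thesis .
qed

lemma d_x_\<sigma>: "x \<in> V \<Longrightarrow> y \<in> N x \<Longrightarrow> z \<in> V \<Longrightarrow> int (d x (\<sigma> x y z)) = int (d x z) - r x y z"
  using d_\<sigma>[of x y z x] d_sym[of x "\<sigma> x y z"] d_sym[of x z] r_self(1)[of x y] \<sigma>_V[of x y z] by simp

text \<open>A geodesic step seen from a fixed \<open>x\<close>: reflecting along the arc to a
  neighbour closer to \<open>z\<close> moves \<open>z\<close>, instead of \<open>x\<close>, one step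
  closer.\<close>

lemma r_ex: assumes "x \<in> V" "z \<in> V" "d x z = Suc n" 
  obtains y where "y \<in> N x" "r x y z = 1" "d x (\<sigma> x y z) = n"
proof -
  obtain y where y: "y \<in> N x" "d y z = n" using step_left[OF assms] .
  then have "r x y z = 1" using assms by (simp add: r_def)
  moreover have "d x (\<sigma> x y z) = n" using d_x_\<sigma>[OF assms(1) y(1) assms(2)] calculation assms by simp
  ultimately show ?thesis using that y by blast
qed

text \<open>By \<open>r_act\<close> a reflection at \<open>x\<close> changes the coordinates in a
  way that depends on the coordinates only, so both vertices descend together until the first one is
  \<open>x\<close>. Any other vertex has a coordinate 1, whereas those of \<open>x\<close> are all
  -1.\<close>

lemma coords_inj:
  assumes "x \<in> V"
  shows "z \<in> V \<Longrightarrow> w \<in> V \<Longrightarrow> (\<And>y. y \<in> N x \<Longrightarrow> r x y z = r x y w) \<Longrightarrow> z = w"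
proof (induction "d x z" arbitrary: z w)
  case 0
  then have zx: "z = x" using assms by simp
  show ?case
  proof (rule ccontr)
    assume "z \<noteq> w"
    then have "d x w \<noteq> 0" using zx assms 0 by simp
    then obtain n where "d x w = Suc n" using not0_implies_Suc by blast
    then obtain y where "y \<in> N x" "r x y w = 1" using r_ex assms 0 by metis
    then show False using 0(4)[of y] zx r_self(1)[of x y] assms by simp
  qed
next
  case (Suc n)
  obtain y where y: "y \<in> N x" "r x y z = 1" "d x (\<sigma> x y z) = n"
    using r_ex[OF assms Suc(3) Suc(2)[symmetric]] .
  have "\<sigma> x y z = \<sigma> x y w"
  proof (rule Suc(1))
    fix y' assume "y' \<in> N x"
    then show "r x y' (\<sigma> x y z) = r x y' (\<sigma> x y w)"
      using r_act[OF assms y(1) _ Suc(3)] r_act[OF assms y(1) _ Suc(4)] Suc(5) y(1) by simp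
  qed (use y Suc \<sigma>_V assms in auto)
  then have "\<sigma> x y (\<sigma> x y z) = \<sigma> x y (\<sigma> x y w)" by simp
  then show ?case using \<sigma>_invol[OF assms y(1)] Suc by simp
qed

end

section \<open>A graph is determined by the neighbourhood of a vertex\<close>

locale pgraph_pair = G: pgraph V E + H: pgraph W F
  for V :: "'a set" and E and W :: "'b set" and F +
  fixes x x' \<psi>
  assumes xV: "x \<in> V" and x'W: "x' \<in> W"
    and bij: "bij_betw \<psi> (G.N x) (H.N x')"
    and adj: "\<And>u v. u \<in> G.N x \<Longrightarrow> v \<in> G.N x \<Longrightarrow> v \<in> G.N u \<longleftrightarrow> \<psi> v \<in> H.N (\<psi> u)"
begin

lemma \<psi>_N: "y \<in> G.N x \<Longrightarrow> \<psi> y \<in> H.N x'"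
  using bij by (auto simp: bij_betw_def)

lemma \<psi>_ex: "y' \<in> H.N x' \<Longrightarrow> \<exists>y\<in>G.N x. y' = \<psi> y"
  using bij by (auto simp: bij_betw_def)

text \<open>Two neighbours of a vertex are at distance 0, 1 or 2, so an isomorphism of
  neighbourhoods preserves distances taken in the whole graph, hence all inner products of
  roots.\<close>

lemma d_\<psi>: assumes "y \<in> G.N x" "y' \<in> G.N x"
  shows "H.d (\<psi> y) (\<psi> y') = G.d y y'"
proof -
  have V: "y \<in> V" "y' \<in> V" "\<psi> y \<in> W" "\<psi> y' \<in> W"
    using assms G.N_V H.N_V \<psi>_N by blast+
  have inj: "y = y' \<longleftrightarrow> \<psi> y = \<psi> y'" using bij assms by (auto simp: bij_betw_def inj_on_def)
  show ?thesis
  proof (cases "y = y' \<or> y' \<in> G.N y")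
    case True
    then show ?thesis
      using adj[OF assms] G.d_eq_1[OF V(1,2)] H.d_eq_1[OF V(3,4)] by auto
  next
    case False
    then show ?thesis using G.d_two[OF xV assms] H.d_two[OF x'W \<psi>_N[OF assms(1)] \<psi>_N[OF assms(2)]]
      adj[OF assms] inj by simp
  qed
qed

text \<open>Every vertex is reached from x by reflections along arcs at x, and the numbers \<open>r x y z\<close> determine z; how they
  change under these reflections only depends on the neighbourhood of x.\<close>
inductive T where
  base: "T x x'"
| step: "T z z' \<Longrightarrow> y \<in> G.N x \<Longrightarrow> T (G.\<sigma> x y z) (H.\<sigma> x' (\<psi> y) z')"

lemma T_V: "T z z' \<Longrightarrow> z \<in> V \<and> z' \<in> W \<and> (\<forall>y\<in>G.N x. H.r x' (\<psi> y) z' = G.r x y z)"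
proof (induction rule: T.induct)
  case base
  then show ?case using xV x'W \<psi>_N by (simp add: G.r_self H.r_self)
next
  case (step z z' y)
  then show ?case
    using G.r_act[OF xV step(2)] H.r_act[OF x'W \<psi>_N[OF step(2)]] \<psi>_N d_\<psi>[OF step(2)]
      G.\<sigma>_V[OF xV step(2)] H.\<sigma>_V[OF x'W \<psi>_N[OF step(2)]] by simp
qed

lemma T_total: "z \<in> V \<Longrightarrow> \<exists>z'. T z z'"
proof (induction "G.d x z" arbitrary: z)
  case 0
  then show ?case using xV T.base by auto
next
  case (Suc n)
  obtain y where y: "y \<in> G.N x" "G.r x y z = 1" "G.d x (G.\<sigma> x y z) = n"
    using G.r_ex[OF xV Suc(3) Suc(2)[symmetric]] .
  then obtain z' where "T (G.\<sigma> x y z) z'" using Suc(1) G.\<sigma>_V[OF xV y(1) Suc(3)] by blast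
  then show ?case using T.step[OF _ y(1)] G.\<sigma>_invol[OF xV y(1) Suc(3)] by metis
qed

lemma T_total': "z' \<in> W \<Longrightarrow> \<exists>z. T z z'"
proof (induction "H.d x' z'" arbitrary: z')
  case 0
  then show ?case using x'W T.base by auto
next
  case (Suc n)
  obtain y' where y': "y' \<in> H.N x'" "H.r x' y' z' = 1" "H.d x' (H.\<sigma> x' y' z') = n"
    using H.r_ex[OF x'W Suc(3) Suc(2)[symmetric]] .
  then obtain z where z: "T z (H.\<sigma> x' y' z')" using Suc(1) H.\<sigma>_V[OF x'W y'(1) Suc(3)] by blast
  obtain y where "y \<in> G.N x" "y' = \<psi> y" using \<psi>_ex y' by blast
  then show ?case using T.step[OF z] H.\<sigma>_invol[OF x'W y'(1) Suc(3)] by metis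
qed

lemma T_fun: "T z z' \<Longrightarrow> T z w' \<Longrightarrow> z' = w'"
  using T_V[of z z'] T_V[of z w'] H.coords_inj[OF x'W, of z' w'] \<psi>_ex by metis

lemma T_inj: "T z z' \<Longrightarrow> T w z' \<Longrightarrow> z = w"
  using T_V[of z z'] T_V[of w z'] G.coords_inj[OF xV, of z w] by metis

lemma T_\<psi>: "y \<in> G.N x \<Longrightarrow> T y (\<psi> y)"
  using T.step[OF T.base] G.\<sigma>_x[OF xV] H.\<sigma>_x[OF x'W \<psi>_N] by metis

text \<open>Reflections preserve adjacency, so \<open>z\<close> and \<open>z'\<close> are moved
  simultaneously to \<open>x\<close> and \<open>x'\<close>. There adjacency means lying in the
  neighbourhood, where \<open>T\<close> is the given \<open>\<psi>\<close>.\<close>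

lemma T_adj: "T z z' \<Longrightarrow> T w w' \<Longrightarrow> w \<in> G.N z \<longleftrightarrow> w' \<in> H.N z'"
proof (induction "G.d x z" arbitrary: z z' w w')
  case 0
  then have "z = x" using T_V[of z z'] xV by simp
  moreover have "z' = x'" using T_fun 0 T.base calculation by blast
  ultimately show ?case using T_\<psi> T_fun T_inj \<psi>_N \<psi>_ex 0(3) by metis
next
  case (Suc n)
  have V: "z \<in> V" "z' \<in> W" "w \<in> V" "w' \<in> W" using Suc T_V by blast+
  obtain y where y: "y \<in> G.N x" "G.r x y z = 1" "G.d x (G.\<sigma> x y z) = n"
    using G.r_ex[OF xV V(1) Suc(2)[symmetric]] .
  have "G.\<sigma> x y w \<in> G.N (G.\<sigma> x y z) \<longleftrightarrow> H.\<sigma> x' (\<psi> y) w' \<in> H.N (H.\<sigma> x' (\<psi> y) z')"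
    using Suc(1)[OF y(3)[symmetric] T.step[OF Suc(3) y(1)] T.step[OF Suc(4) y(1)]] .
  then show ?case using G.\<sigma>_N[OF xV y(1) V(1,3)] H.\<sigma>_N[OF x'W \<psi>_N[OF y(1)] V(2,4)] by simp
qed

lemma iso: "graph_iso V E W F"
proof -
  define \<phi> where "\<phi> z = (SOME z'. T z z')" for z
  have \<phi>: "T z (\<phi> z)" if "z \<in> V" for z using T_total[OF that] unfolding \<phi>_def by (rule someI_ex)
  have "bij_betw \<phi> V W"
  proof (rule bij_betw_imageI)
    show "inj_on \<phi> V" using \<phi> T_inj unfolding inj_on_def by metis
    show "\<phi> ` V = W"
    proof
      show "\<phi> ` V \<subseteq> W" using \<phi> T_V by blast
      show "W \<subseteq> \<phi> ` V"
      proof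
        fix w assume "w \<in> W"
        then obtain z where "T z w" using T_total' by blast
        then have "z \<in> V" "\<phi> z = w" using T_V \<phi> T_fun by blast+
        then show "w \<in> \<phi> ` V" by blast
      qed
    qed
  qed
  moreover have "E u v \<longleftrightarrow> F (\<phi> u) (\<phi> v)" if "u \<in> V" "v \<in> V" for u v
    using T_adj[OF \<phi>[OF that(1)] \<phi>[OF that(2)]] that T_V[OF \<phi>[OF that(2)]]
    by (simp add: G.N_iff H.N_iff)
  ultimately show ?thesis unfolding graph_iso_def by blast
qed

end

lemma graph_iso_trans: "graph_iso V E W F \<Longrightarrow> graph_iso W F X H \<Longrightarrow> graph_iso V E X H"
  unfolding graph_iso_def
proof (elim exE conjE)
  fix f g assume "bij_betw f V W" "\<forall>u\<in>V. \<forall>v\<in>V. E u v = F (f u) (f v)"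
    "bij_betw g W X" "\<forall>u\<in>W. \<forall>v\<in>W. F u v = H (g u) (g v)"
  then show "\<exists>\<phi>. bij_betw \<phi> V X \<and> (\<forall>u\<in>V. \<forall>v\<in>V. E u v = H (\<phi> u) (\<phi> v))"
    by (intro exI[of _ "g \<circ> f"]) (auto simp: bij_betw_trans bij_betwE)
qed

lemma graph_iso_sym: "graph_iso V E W F \<Longrightarrow> graph_iso W F V E"
  unfolding graph_iso_def
proof (elim exE conjE)
  fix f assume f: "bij_betw f V W" "\<forall>u\<in>V. \<forall>v\<in>V. E u v = F (f u) (f v)"
  have "bij_betw (inv_into V f) W V" using f bij_betw_inv_into by blast
  moreover have "F u v = E (inv_into V f u) (inv_into V f v)" if "u \<in> W" "v \<in> W" for u v
    using f that bij_betw_inv_into_right[OF f(1)] bij_betwE[OF calculation] by metis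
  ultimately show "\<exists>\<phi>. bij_betw \<phi> W V \<and> (\<forall>u\<in>W. \<forall>v\<in>W. F u v = E (\<phi> u) (\<phi> v))" by blast
qed

theorem local_determines:
  assumes "pgraph V E" "pgraph W F" "x \<in> V" "x' \<in> W"
    and "graph_iso (nbhd V E x) E (nbhd W F x') F"
  shows "graph_iso V E W F"
proof -
  interpret G: pgraph V E by fact
  interpret H: pgraph W F by fact
  obtain \<psi> where \<psi>: "bij_betw \<psi> (G.N x) (H.N x')"
    "\<forall>u\<in>G.N x. \<forall>v\<in>G.N x. E u v \<longleftrightarrow> F (\<psi> u) (\<psi> v)"
    using assms(5) unfolding graph_iso_def by blast
  interpret pgraph_pair V E W F x x' \<psi>
  proof
    fix u v assume "u \<in> G.N x" "v \<in> G.N x"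
    moreover have "\<psi> v \<in> W" "v \<in> V" using bij_betwE[OF \<psi>(1)] calculation G.N_V H.N_V by blast+
    ultimately show "v \<in> G.N u \<longleftrightarrow> \<psi> v \<in> H.N (\<psi> u)" using \<psi>(2) by (simp add: G.N_iff H.N_iff)
  qed (use assms \<psi> in auto)
  show ?thesis by (rule iso)
qed

section \<open>The graphs of the list have the parallelogram property\<close>

text \<open>The Lipschitz condition bounds \<open>h\<close> by the length of every walk, and the
  descent condition builds a walk of length \<open>h\<close>. A guessed formula thus yields
  connectedness and all distances at once.\<close>

lemma gdist_characterization:
  assumes zero: "\<And>x y. x \<in> V \<Longrightarrow> y \<in> V \<Longrightarrow> h x y = (0::nat) \<longleftrightarrow> x = y"
    and lip: "\<And>x w y. x \<in> V \<Longrightarrow> y \<in> V \<Longrightarrow> w \<in> V \<Longrightarrow> E x w \<Longrightarrow> h x y \<le> h w y + 1"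
    and step: "\<And>x y n. x \<in> V \<Longrightarrow> y \<in> V \<Longrightarrow> h x y = Suc n \<Longrightarrow> \<exists>w\<in>V. E x w \<and> h w y = n"
  shows "connected_graph V E" and "\<And>x y. x \<in> V \<Longrightarrow> y \<in> V \<Longrightarrow> gdist V E x y = h x y"
proof -
  have walk: "(adj V E ^^ n) x y" if "x \<in> V" "y \<in> V" "h x y = n" for n x y
    using that
  proof (induction n arbitrary: x)
    case 0 then show ?case using zero by auto
  next
    case (Suc n)
    then obtain w where "w \<in> V" "E x w" "h w y = n" using step by blast
    then show ?case using Suc by (intro relpowp_Suc_I2[of _ _ w]) (auto simp: adj_def)
  qed
  have le: "h x y \<le> n" if "(adj V E ^^ n) x y" "x \<in> V" "y \<in> V" for n x y
    using that
  proof (induction n arbitrary: x)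
    case 0 then show ?case using zero by auto
  next
    case (Suc n)
    then obtain w where w: "adj V E x w" "(adj V E ^^ n) w y" using relpowp_Suc_D2[of n "adj V E" x y] by blast
    then have "w \<in> V" "E x w" by (auto simp: adj_def)
    then show ?case using Suc.IH[OF w(2)] lip[of x y w] Suc.prems by simp
  qed
  show "connected_graph V E" unfolding connected_graph_def using walk by blast
  show "gdist V E x y = h x y" if "x \<in> V" "y \<in> V" for x y
    unfolding gdist_def by (rule Least_equality) (use walk le that in auto)
qed

lemma pgraph_iso:
  assumes "pgraph W F" "graph_iso V E W F"
  shows "pgraph V E"
proof -
  interpret H: pgraph W F by fact
  obtain \<phi> where \<phi>: "bij_betw \<phi> V W" "\<forall>u\<in>V. \<forall>v\<in>V. E u v \<longleftrightarrow> F (\<phi> u) (\<phi> v)"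
    using assms(2) unfolding graph_iso_def by blast
  have W: "\<phi> u \<in> W" if "u \<in> V" for u using \<phi> that bij_betwE by blast
  have inj: "\<phi> u = \<phi> v \<longleftrightarrow> u = v" if "u \<in> V" "v \<in> V" for u v
    using \<phi> that by (auto simp: bij_betw_def inj_on_def)
  have surj: "\<exists>u\<in>V. w = \<phi> u" if "w \<in> W" for w using \<phi> that by (auto simp: bij_betw_def)
  have E: "E u v \<longleftrightarrow> F (\<phi> u) (\<phi> v)" if "u \<in> V" "v \<in> V" for u v using \<phi> that by blast
  define h where "h u v = H.d (\<phi> u) (\<phi> v)" for u v
  have lip: "h x y \<le> h w y + 1" if "x \<in> V" "y \<in> V" "w \<in> V" "E x w" for x y w
    using H.d_N_le2[OF W[OF that(1)], of "\<phi> w" "\<phi> y"] W that E unfolding h_def by (simp add: H.N_iff)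
  have step: "\<exists>w\<in>V. E x w \<and> h w y = n" if xy: "x \<in> V" "y \<in> V" "h x y = Suc n" for x y n
  proof -
    obtain w' where w': "w' \<in> H.N (\<phi> x)" "H.d w' (\<phi> y) = n"
      using H.step_left[OF W[OF xy(1)] W[OF xy(2)]] xy(3) unfolding h_def by blast
    then obtain w where "w \<in> V" "w' = \<phi> w" using surj H.N_V by blast
    then show ?thesis using w' E xy h_def by (auto simp: H.N_iff)
  qed
  have zero: "h x y = 0 \<longleftrightarrow> x = y" if "x \<in> V" "y \<in> V" for x y
    using W that inj by (simp add: h_def)
  note gd = gdist_characterization[of V h E, OF zero lip step]
  show ?thesis
  proof
    show "finite V" using \<phi> H.fin bij_betw_finite by blast
    show "E v u" if "u \<in> V" "v \<in> V" "E u v" for u v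
      using that E[of u v] E[of v u] H.sym[of "\<phi> u" "\<phi> v"] W by simp
    show "\<not> E u u" if "u \<in> V" for u using that E H.irr W by simp
    show "connected_graph V E" by (rule gd(1))
    show "parallelogram V E" unfolding parallelogram_def
    proof (intro ballI impI)
      fix x a y assume a: "x \<in> V" "a \<in> nbhd V E x" "y \<in> nbhd V E x" "gdist V E a y = 2"
      then have V: "a \<in> V" "y \<in> V" "E x a" "E x y" by (auto simp: nbhd_def)
      then have "H.d (\<phi> a) (\<phi> y) = 2" using gd(2) a by (simp add: h_def)
      moreover have "\<phi> a \<in> H.N (\<phi> x)" "\<phi> y \<in> H.N (\<phi> x)" using V W E a by (simp_all add: H.N_iff)
      ultimately obtain b' where b': "b' \<in> W"
        "\<forall>z\<in>W. H.d (\<phi> a) z + H.d (\<phi> y) z = H.d (\<phi> x) z + H.d b' z"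
        using H.par[unfolded parallelogram_def, rule_format, OF W[OF a(1)]] by blast
      then obtain b where b: "b \<in> V" "b' = \<phi> b" using surj by blast
      then have "\<forall>z\<in>V. gdist V E a z + gdist V E y z = gdist V E x z + gdist V E b z"
        using b' W V a(1) by (simp add: gd(2)) (simp add: h_def)
      then show "\<exists>b\<in>V. \<forall>z\<in>V. gdist V E a z + gdist V E y z = gdist V E x z + gdist V E b z"
        using b by blast
    qed
  qed
qed

section \<open>Johnson graphs and halved cubes as families of sets\<close>

definition sd :: "'a set \<Rightarrow> 'a set \<Rightarrow> 'a set" where "sd A B = (A - B) \<union> (B - A)"

definition sd_adj :: "'a set \<Rightarrow> 'a set \<Rightarrow> bool" where "sd_adj A B \<longleftrightarrow> card (sd A B) = 2"

lemma finite_sd [simp]: "finite A \<Longrightarrow> finite B \<Longrightarrow> finite (sd A B)"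
  by (simp add: sd_def)

lemma sd_commute: "sd A B = sd B A" by (auto simp: sd_def)

lemma sd_self [simp]: "sd A A = {}" by (auto simp: sd_def)

lemma sd_empty_iff: "sd A B = {} \<longleftrightarrow> A = B" by (auto simp: sd_def)

lemma card_sd: 
  assumes "finite A" "finite B"
  shows "int (card (sd A B)) = int (card A) + int (card B) - 2 * int (card (A \<inter> B))"
proof -
  have "card (sd A B) = card (A - B) + card (B - A)" using assms unfolding sd_def by (intro card_Un_disjoint) auto
  moreover have "card A = card (A - B) + card (A \<inter> B)" using assms by (metis Int_Diff_disjoint Int_Diff_Un add.commute card_Un_disjoint finite_Diff finite_Int)
  moreover have "card B = card (B - A) + card (A \<inter> B)" using assms by (metis Int_Diff_disjoint Int_Diff_Un add.commute card_Un_disjoint finite_Diff finite_Int Int_commute)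
  ultimately show ?thesis by simp
qed

lemma card_sd_triangle:
  assumes "finite A" "finite B" "finite C"
  shows "card (sd A C) + 2 * card (sd A B \<inter> sd B C) = card (sd A B) + card (sd B C)"
proof -
  have "sd A C = sd (sd A B) (sd B C)" by (auto simp: sd_def)
  then show ?thesis using card_sd[of "sd A B" "sd B C"] assms by simp
qed

text \<open>Johnson graphs and halved cubes are families of sets closed under completing lattice squares.\<close>
lemma set_family_pgraph:
  assumes fin: "finite V" "\<And>A. A \<in> V \<Longrightarrow> finite A"
    and ev: "\<And>A B. A \<in> V \<Longrightarrow> B \<in> V \<Longrightarrow> even (card (sd A B))"
    and closed: "\<And>A B C D. A \<in> V \<Longrightarrow> B \<in> V \<Longrightarrow> C \<in> V \<Longrightarrow> A \<inter> C = B \<inter> D \<Longrightarrow> A \<union> C = B \<union> D \<Longrightarrow> D \<in> V"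
    and step: "\<And>A B. A \<in> V \<Longrightarrow> B \<in> V \<Longrightarrow> A \<noteq> B \<Longrightarrow> \<exists>C\<in>V. sd_adj A C \<and> card (sd A B) = card (sd C B) + 2"
  shows "pgraph V sd_adj" and "\<And>A B. A \<in> V \<Longrightarrow> B \<in> V \<Longrightarrow> 2 * gdist V sd_adj A B = card (sd A B)"
proof -
  define h :: "'a set \<Rightarrow> 'a set \<Rightarrow> nat" where "h A B = card (sd A B) div 2" for A B
  have h2: "card (sd A B) = 2 * h A B" if "A \<in> V" "B \<in> V" for A B using ev that by (simp add: h_def)
  have zero: "h x y = 0 \<longleftrightarrow> x = y" if "x \<in> V" "y \<in> V" for x y
  proof -
    have "h x y = 0 \<longleftrightarrow> card (sd x y) = 0" using h2 that by simp
    also have "\<dots> \<longleftrightarrow> x = y" using fin that by (simp add: sd_empty_iff)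
    finally show ?thesis .
  qed
  have lip: "h x y \<le> h w y + 1" if "x \<in> V" "y \<in> V" "w \<in> V" "sd_adj x w" for x y w
    using card_sd_triangle[of x w y] h2[of x y] h2[of w y] fin that unfolding sd_adj_def by simp
  have stp: "\<exists>w\<in>V. sd_adj x w \<and> h w y = n" if xy: "x \<in> V" "y \<in> V" "h x y = Suc n" for x y n
  proof -
    have "x \<noteq> y" using zero[of x y] xy by auto
    then obtain C where "C \<in> V" "sd_adj x C" "card (sd x y) = card (sd C y) + 2" using step[OF xy(1,2)] by blast
    then show ?thesis using h2[of x y] h2[of C y] that by (intro bexI[of _ C]) auto
  qed
  note gd = gdist_characterization[of V h sd_adj, OF zero lip stp]
  have gd2: "gdist V sd_adj A B = h A B" if "A \<in> V" "B \<in> V" for A B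
    using gd(2) that by blast
  show "2 * gdist V sd_adj A B = card (sd A B)" if "A \<in> V" "B \<in> V" for A B
    using gd2[OF that] h2[OF that] by simp
  show "pgraph V sd_adj"
  proof
    show "finite V" by fact
    show "sd_adj v u" if "sd_adj u v" for u v :: "'a set" using that by (simp add: sd_adj_def sd_commute)
    show "\<not> sd_adj u u" for u :: "'a set" by (simp add: sd_adj_def)
    show "connected_graph V sd_adj" by (rule gd(1))
    show "parallelogram V sd_adj" unfolding parallelogram_def
    proof (intro ballI impI)
      fix B A C assume a: "B \<in> V" "A \<in> nbhd V sd_adj B" "C \<in> nbhd V sd_adj B" "gdist V sd_adj A C = 2"
      then have V: "A \<in> V" "C \<in> V" "card (sd A B) = 2" "card (sd B C) = 2"
        by (auto simp: nbhd_def sd_adj_def sd_commute)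
      have F: "finite A" "finite B" "finite C" using fin V a by auto
      have "card (sd A C) = 4" using gd2[OF V(1,2)] a h2[OF V(1,2)] by simp
      then have "card (sd A B \<inter> sd B C) = 0" using card_sd_triangle[OF F] V by simp
      then have e: "sd A B \<inter> sd B C = {}" using F by simp
      \<comment> \<open>Distance 2 means that the exchanges from \<open>A\<close> to
        \<open>B\<close> and from \<open>B\<close> to \<open>C\<close> are disjoint. Then
        \<open>B\<close> lies in the lattice interval from \<open>A \<inter> C\<close> to
        \<open>A \<union> C\<close>, and \<open>D\<close> is its complement in this
        interval.\<close>
      define D where "D = (A \<inter> C) \<union> (A \<union> C - B)"
      have AC: "A \<inter> C \<subseteq> B" "B \<subseteq> A \<union> C" using e by (auto simp: sd_def)
      have D: "A \<inter> C = B \<inter> D" "A \<union> C = B \<union> D" using AC unfolding D_def by auto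
      have DV: "D \<in> V" using closed[OF V(1) a(1) V(2) D] .
      have fD: "finite D" using fin DV by blast
      have "gdist V sd_adj A Z + gdist V sd_adj C Z = gdist V sd_adj B Z + gdist V sd_adj D Z" if Z: "Z \<in> V" for Z
      proof -
        have fZ: "finite Z" using fin Z by blast
        \<comment> \<open>The size of a set and of its intersection with \<open>Z\<close> are
          modular, and \<open>card (sd A Z)\<close> is affine in both.\<close>
        have 1: "card A + card C = card B + card D"
          using card_Un_Int[OF F(1,3)] card_Un_Int[OF F(2) fD] D by simp
        have "(A \<inter> Z) \<union> (C \<inter> Z) = (B \<inter> Z) \<union> (D \<inter> Z)" "(A \<inter> Z) \<inter> (C \<inter> Z) = (B \<inter> Z) \<inter> (D \<inter> Z)"
          using D by auto
        then have 2: "card (A \<inter> Z) + card (C \<inter> Z) = card (B \<inter> Z) + card (D \<inter> Z)"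
          using card_Un_Int[of "A \<inter> Z" "C \<inter> Z"] card_Un_Int[of "B \<inter> Z" "D \<inter> Z"] F fD by simp
        have "int (card (sd A Z)) + int (card (sd C Z)) = int (card (sd B Z)) + int (card (sd D Z))"
          unfolding card_sd[OF F(1) fZ] card_sd[OF F(2) fZ] card_sd[OF F(3) fZ] card_sd[OF fD fZ]
          using 1 2 by linarith
        then have "card (sd A Z) + card (sd C Z) = card (sd B Z) + card (sd D Z)" by linarith
        then show ?thesis using gd2[of _ Z] h2[of _ Z] Z V a(1) DV by simp
      qed
      then show "\<exists>b\<in>V. \<forall>z\<in>V. gdist V sd_adj A z + gdist V sd_adj C z = gdist V sd_adj B z + gdist V sd_adj b z"
        using DV by blast
    qed
  qed
qed

lemma sd_swap:
  assumes "finite A" "finite B" "i \<in> A - B" "j \<in> B - A"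
  defines "C \<equiv> insert j (A - {i})"
  shows "sd A C = {i, j}" "sd C B = sd A B - {i, j}" "card (sd A B) = card (sd C B) + 2"
proof -
  show 1: "sd A C = {i, j}" using assms by (auto simp: sd_def)
  show 2: "sd C B = sd A B - {i, j}" using assms by (auto simp: sd_def)
  have "{i, j} \<subseteq> sd A B" "i \<noteq> j" using assms by (auto simp: sd_def)
  moreover have "card {i, j} = 2" using calculation by simp
  ultimately show "card (sd A B) = card (sd C B) + 2"
    using card_mono[of "sd A B" "{i, j}"] card_Diff_subset[of "{i, j}" "sd A B"] assms unfolding 2 by simp
qed

lemma johnson_finite: "A \<in> johnson_V n k \<Longrightarrow> finite A"
  unfolding johnson_V_def using finite_subset by blast

lemma johnson_sd_pgraph: 
  shows "pgraph (johnson_V n k) sd_adj"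
    and "A \<in> johnson_V n k \<Longrightarrow> B \<in> johnson_V n k \<Longrightarrow> 2 * gdist (johnson_V n k) sd_adj A B = card (sd A B)"
proof -
  have fV: "finite (johnson_V n k)" unfolding johnson_V_def by (rule finite_subset[of _ "Pow {..<n}"]) auto
  have ev: "even (card (sd A B))" if "A \<in> johnson_V n k" "B \<in> johnson_V n k" for A B
  proof -
    have "int (card (sd A B)) = 2 * (int k - int (card (A \<inter> B)))"
      using card_sd[OF johnson_finite johnson_finite, OF that] that by (simp add: johnson_V_def)
    then show ?thesis by presburger
  qed
  have closed: "D \<in> johnson_V n k" if "A \<in> johnson_V n k" "B \<in> johnson_V n k" "C \<in> johnson_V n k"
    "A \<inter> C = B \<inter> D" "A \<union> C = B \<union> D" for A B C D
  proof -
    have "D \<subseteq> {..<n}" using that unfolding johnson_V_def by blast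
    moreover have "finite D" using calculation finite_subset by blast
    then have "card A + card C = card B + card D"
      using card_Un_Int[of A C] card_Un_Int[of B D] that johnson_finite by metis
    ultimately show ?thesis using that by (simp add: johnson_V_def)
  qed
  have step: "\<exists>C\<in>johnson_V n k. sd_adj A C \<and> card (sd A B) = card (sd C B) + 2"
    if AB: "A \<in> johnson_V n k" "B \<in> johnson_V n k" "A \<noteq> B" for A B
  proof -
    have f: "finite A" "finite B" "card A = card B" using johnson_finite AB by (auto simp: johnson_V_def)
    have "\<not> A \<subseteq> B" "\<not> B \<subseteq> A" using f AB card_subset_eq by metis+
    then obtain i j where ij: "i \<in> A - B" "j \<in> B - A" by blast
    let ?C = "insert j (A - {i})"
    have "card ?C = card A" using f ij card_Suc_Diff1[of A i] by simp
    then have "?C \<in> johnson_V n k" using AB ij by (auto simp: johnson_V_def)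
    moreover have "i \<noteq> j" using ij by auto
    then have "sd_adj A ?C" using sd_swap(1)[OF f(1,2) ij] by (simp add: sd_adj_def)
    ultimately show ?thesis using sd_swap(3)[OF f(1,2) ij] by blast
  qed
  show "pgraph (johnson_V n k) sd_adj"
    by (rule set_family_pgraph(1)[OF fV]) (fact johnson_finite ev closed step)+
  show "2 * gdist (johnson_V n k) sd_adj A B = card (sd A B)" if "A \<in> johnson_V n k" "B \<in> johnson_V n k"
    by (rule set_family_pgraph(2)[OF fV _ _ _ _ that]) (fact johnson_finite ev closed step)+
qed

lemma johnson_E_sd: "A \<in> johnson_V n k \<Longrightarrow> B \<in> johnson_V n k \<Longrightarrow> johnson_E k A B \<longleftrightarrow> sd_adj A B"
proof -
  assume a: "A \<in> johnson_V n k" "B \<in> johnson_V n k"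
  have "int (card (sd A B)) = 2 * (int k - int (card (A \<inter> B)))"
    using card_sd[OF johnson_finite johnson_finite, OF a] a by (simp add: johnson_V_def)
  moreover have "A = B \<Longrightarrow> card (A \<inter> B) = k" using a by (simp add: johnson_V_def)
  ultimately show ?thesis unfolding johnson_E_def sd_adj_def by auto
qed

lemma johnson_iso: "graph_iso (johnson_V n k) (johnson_E k) (johnson_V n k) sd_adj"
  unfolding graph_iso_def by (rule exI[of _ id]) (auto simp: johnson_E_sd)

text \<open>Supports of the binary strings of a halved cube; in this form adjacency is
  \<open>sd_adj\<close>, as for Johnson graphs.\<close>

definition even_V :: "nat \<Rightarrow> nat set set" where
  "even_V n = {A. A \<subseteq> {..<n} \<and> even (card A)}"

lemma even_finite: "A \<in> even_V n \<Longrightarrow> finite A"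
  unfolding even_V_def using finite_subset by blast

lemma even_sd_pgraph: 
  shows "pgraph (even_V n) sd_adj"
    and "A \<in> even_V n \<Longrightarrow> B \<in> even_V n \<Longrightarrow> 2 * gdist (even_V n) sd_adj A B = card (sd A B)"
proof -
  have fV: "finite (even_V n)" unfolding even_V_def by (rule finite_subset[of _ "Pow {..<n}"]) auto
  have ev: "even (card (sd A B))" if "A \<in> even_V n" "B \<in> even_V n" for A B
  proof -
    have "even (int (card (sd A B)))"
      unfolding card_sd[OF even_finite even_finite, OF that] using that by (simp add: even_V_def)
    then show ?thesis by presburger
  qed
  have closed: "D \<in> even_V n" if "A \<in> even_V n" "B \<in> even_V n" "C \<in> even_V n"
    "A \<inter> C = B \<inter> D" "A \<union> C = B \<union> D" for A B C D
  proof -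
    have "D \<subseteq> {..<n}" using that unfolding even_V_def by blast
    moreover have "finite D" using calculation finite_subset by blast
    then have "card A + card C = card B + card D"
      using card_Un_Int[of A C] card_Un_Int[of B D] that even_finite by metis
    moreover have "even (card A)" "even (card B)" "even (card C)" using that by (auto simp: even_V_def)
    ultimately have "even (card D)" by presburger
    then show ?thesis using \<open>D \<subseteq> {..<n}\<close> by (simp add: even_V_def)
  qed
  have step: "\<exists>C\<in>even_V n. sd_adj A C \<and> card (sd A B) = card (sd C B) + 2"
    if AB: "A \<in> even_V n" "B \<in> even_V n" "A \<noteq> B" for A B
  proof -
    have f: "finite A" "finite B" using even_finite AB by auto
    have "card (sd A B) \<noteq> 0" using f AB by (simp add: sd_empty_iff)
    then have "card (sd A B) \<ge> 2" using ev[OF AB(1,2)] by presburger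
    then obtain T where T: "T \<subseteq> sd A B" "card T = 2" using obtain_subset_with_card_n by metis
    then have fT: "finite T" using card.infinite by fastforce
    let ?C = "sd A T"
    have TA: "sd A ?C = T" "sd ?C B = sd A B - T" using T by (auto simp: sd_def)
    have "int (card (sd A ?C)) = int (card A) + int (card ?C) - 2 * int (card (A \<inter> ?C))"
      using f fT by (intro card_sd) auto
    moreover have "even (card A)" using AB by (simp add: even_V_def)
    moreover have "card (sd A ?C) = 2" using TA(1) T(2) by simp
    ultimately have "even (card ?C)" by presburger
    moreover have "?C \<subseteq> {..<n}" using AB T by (auto simp: even_V_def sd_def)
    ultimately have "?C \<in> even_V n" by (simp add: even_V_def)
    moreover have "sd_adj A ?C" using TA T by (simp add: sd_adj_def)
    moreover have "card (sd A B) = card (sd ?C B) + 2"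
      unfolding TA(2) using T fT card_mono[OF _ T(1)] f by (simp add: card_Diff_subset)
    ultimately show ?thesis by blast
  qed
  show "pgraph (even_V n) sd_adj"
    by (rule set_family_pgraph(1)[OF fV]) (fact even_finite ev closed step)+
  show "2 * gdist (even_V n) sd_adj A B = card (sd A B)" if "A \<in> even_V n" "B \<in> even_V n"
    by (rule set_family_pgraph(2)[OF fV _ _ _ _ that]) (fact even_finite ev closed step)+
qed

lemma halved_cube_iso: "graph_iso (even_V n) sd_adj (halved_cube_V n) halved_cube_E"
proof -
  define f where "f A = map (\<lambda>i. i \<in> A) [0..<n]" for A :: "nat set"
  have len: "length (filter id (f A)) = card (A \<inter> {..<n})" for A
  proof -
    have "length (filter id (f A)) = card {i. i < n \<and> f A ! i}"
      using length_filter_conv_card[of id "f A"] by (simp add: f_def)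
    also have "{i. i < n \<and> f A ! i} = A \<inter> {..<n}" by (auto simp: f_def)
    finally show ?thesis .
  qed
  have "bij_betw f (even_V n) (halved_cube_V n)"
  proof (rule bij_betw_byWitness[where f' = "\<lambda>xs. {i. i < n \<and> xs ! i}"])
    show "\<forall>A\<in>even_V n. {i. i < n \<and> f A ! i} = A" by (auto simp: f_def even_V_def)
    show inv: "\<forall>xs\<in>halved_cube_V n. f {i. i < n \<and> xs ! i} = xs"
      by (auto simp: f_def halved_cube_V_def intro!: nth_equalityI)
    show "f ` even_V n \<subseteq> halved_cube_V n"
      using len by (auto simp: halved_cube_V_def even_V_def Int_absorb2) (simp add: f_def)
    show "(\<lambda>xs. {i. i < n \<and> xs ! i}) ` halved_cube_V n \<subseteq> even_V n"
    proof (rule image_subsetI)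
      fix xs assume xs: "xs \<in> halved_cube_V n"
      have "length (filter id xs) = card ({i. i < n \<and> xs ! i} \<inter> {..<n})"
        using len[of "{i. i < n \<and> xs ! i}"] inv xs by simp
      moreover have "{i. i < n \<and> xs ! i} \<inter> {..<n} = {i. i < n \<and> xs ! i}" by auto
      ultimately show "{i. i < n \<and> xs ! i} \<in> even_V n" using xs by (auto simp: even_V_def halved_cube_V_def)
    qed
  qed
  moreover have "sd_adj A B \<longleftrightarrow> halved_cube_E (f A) (f B)" if "A \<in> even_V n" "B \<in> even_V n" for A B
  proof -
    have "{i. i < length (f A) \<and> f A ! i \<noteq> f B ! i} = sd A B"
      using that by (auto simp: f_def sd_def even_V_def)
    then show ?thesis by (simp add: sd_adj_def halved_cube_E_def)
  qed
  ultimately show ?thesis unfolding graph_iso_def by blast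
qed

text \<open>Vertices at distance 2 form an antipodal pair, and the distances from any vertex to such
  a pair sum up to 2; so the partner of \<open>x\<close> completes every quadrangle. A second pair,
  available by \<open>k \<ge> 2\<close>, joins antipodes.\<close>

lemma cocktail_pgraph:
  assumes "k \<ge> 2" shows "pgraph (cocktail_V k) cocktail_E"
proof -
  define h :: "nat \<Rightarrow> nat \<Rightarrow> nat" where "h i j = (if i = j then 0 else if i div 2 = j div 2 then 2 else 1)" for i j
  have zero: "h x y = 0 \<longleftrightarrow> x = y" for x y by (simp add: h_def)
  have lip: "h x y \<le> h w y + 1" if "cocktail_E x w" for x y w
    using that by (auto simp: h_def cocktail_E_def)
  have step: "\<exists>w\<in>cocktail_V k. cocktail_E x w \<and> h w y = n"
    if a: "x \<in> cocktail_V k" "y \<in> cocktail_V k" "h x y = Suc n" for x y n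
  proof (cases "x div 2 = y div 2")
    case True
    define w :: nat where "w = (if x div 2 = 0 then 2 else 0)"
    have "w \<in> cocktail_V k" using assms by (auto simp: cocktail_V_def w_def)
    moreover have "w div 2 \<noteq> x div 2" by (auto simp: w_def)
    then have "cocktail_E x w" "h w y = 1" using True by (auto simp: h_def cocktail_E_def)
    moreover have "n = 1" using a(3) True by (auto simp: h_def split: if_splits)
    ultimately show ?thesis by blast
  next
    case False
    then have "n = 0" "cocktail_E x y" using a(3) by (auto simp: h_def cocktail_E_def split: if_splits)
    then show ?thesis using a by (intro bexI[of _ y]) (auto simp: h_def)
  qed
  note gd = gdist_characterization[of "cocktail_V k" h cocktail_E, OF zero lip step]
  have gd2: "gdist (cocktail_V k) cocktail_E x y = h x y" if "x \<in> cocktail_V k" "y \<in> cocktail_V k" for x y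
    using gd(2) that by blast
  show ?thesis
  proof
    show "finite (cocktail_V k)" by (simp add: cocktail_V_def)
    show "connected_graph (cocktail_V k) cocktail_E" by (rule gd(1))
    show "parallelogram (cocktail_V k) cocktail_E" unfolding parallelogram_def
    proof (intro ballI impI)
      fix x a y assume a: "x \<in> cocktail_V k" "a \<in> nbhd (cocktail_V k) cocktail_E x"
        "y \<in> nbhd (cocktail_V k) cocktail_E x" "gdist (cocktail_V k) cocktail_E a y = 2"
      then have V: "a \<in> cocktail_V k" "y \<in> cocktail_V k" by (auto simp: nbhd_def)
      have ay: "a \<noteq> y" "a div 2 = y div 2" using a gd2[OF V] by (auto simp: h_def split: if_splits)
      define b where "b = (if even x then x + 1 else x - 1)"
      have b: "b \<noteq> x" "b div 2 = x div 2" by (auto simp: b_def elim: oddE)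
      then have bV: "b \<in> cocktail_V k" using a(1) unfolding cocktail_V_def lessThan_iff by presburger
      have two: "h u z + h v z = 2" if "u \<noteq> v" "u div 2 = v div 2" for u v z
        using that by (auto simp: h_def)
      have "\<forall>z\<in>cocktail_V k. gdist (cocktail_V k) cocktail_E a z + gdist (cocktail_V k) cocktail_E y z =
         gdist (cocktail_V k) cocktail_E x z + gdist (cocktail_V k) cocktail_E b z"
        using gd2 V bV a(1) two[OF ay] two[of x b] b by simp
      then show "\<exists>b\<in>cocktail_V k. \<forall>z\<in>cocktail_V k. gdist (cocktail_V k) cocktail_E a z + gdist (cocktail_V k) cocktail_E y z =
         gdist (cocktail_V k) cocktail_E x z + gdist (cocktail_V k) cocktail_E b z" using bV by blast
    qed
  qed (auto simp: cocktail_E_def)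
qed

text \<open>The vectors \<open>\<plusminus>(4 1\<^sub>S - 1)\<close> have squared norm 24, and the distance is \<open>(24 - \<langle>p, q\<rangle>) / 16\<close>. They are exactly
  the integer vectors of squared norm 24 whose coordinates are odd and congruent modulo 4.\<close>
definition gosset_vec :: "bool \<times> nat set \<Rightarrow> nat \<Rightarrow> int" where
  "gosset_vec p i = (if fst p then 1 else -1) * (if i \<in> snd p then 3 else -1)"

definition gosset_d :: "bool \<times> nat set \<Rightarrow> bool \<times> nat set \<Rightarrow> nat" where
  "gosset_d p q = (if fst p = fst q then 2 - card (snd p \<inter> snd q) else 1 + card (snd p \<inter> snd q))"

lemma gosset_VD: "p \<in> gosset_V \<Longrightarrow> finite (snd p) \<and> card (snd p) = 2 \<and> snd p \<subseteq> {..<8}"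
  unfolding gosset_V_def using finite_subset by fastforce

lemma card_Int_le2: "p \<in> gosset_V \<Longrightarrow> card (snd p \<inter> T) \<le> 2"
  using gosset_VD[of p] card_mono[of "snd p" "snd p \<inter> T"] by auto

lemma gosset_d_eq_0: assumes "p \<in> gosset_V" "q \<in> gosset_V" shows "gosset_d p q = 0 \<longleftrightarrow> p = q"
proof
  assume "gosset_d p q = 0"
  then have a: "fst p = fst q" "card (snd p \<inter> snd q) = 2"
    using card_Int_le2[OF assms(1), of "snd q"] by (auto simp: gosset_d_def split: if_splits)
  have "snd p \<inter> snd q = snd p" "snd p \<inter> snd q = snd q"
    using gosset_VD[OF assms(1)] gosset_VD[OF assms(2)] a by (intro card_subset_eq; simp)+
  then show "p = q" using a by (simp add: prod_eq_iff)
next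
  assume "p = q" then show "gosset_d p q = 0" using gosset_VD assms by (simp add: gosset_d_def)
qed

lemma gosset_E_iff: assumes "p \<in> gosset_V" "q \<in> gosset_V" shows "gosset_E p q \<longleftrightarrow> gosset_d p q = 1"
  using card_Int_le2[OF assms(1), of "snd q"] gosset_VD[OF assms(1)] by (auto simp: gosset_E_def gosset_d_def)

lemma gosset_d_commute: "gosset_d p q = gosset_d q p" by (auto simp: gosset_d_def Int_commute)

lemma gosset_vec_inner: assumes "p \<in> gosset_V" "q \<in> gosset_V"
  shows "(\<Sum>i<8. gosset_vec p i * gosset_vec q i) = 24 - 16 * int (gosset_d p q)"
proof -
  let ?S = "snd p" and ?T = "snd q"
  have S: "?S \<subseteq> {..<8}" "?T \<subseteq> {..<8}" "card ?S = 2" "card ?T = 2" using gosset_VD assms by auto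
  have ind: "(\<Sum>i<8. if i \<in> A then (1::int) else 0) = int (card A)" if "A \<subseteq> {..<8::nat}" for A
    using that by (simp add: sum.If_cases Int_absorb1)
  let ?e = "if fst p = fst q then 1 else - 1 :: int"
  have "(\<Sum>i<8. gosset_vec p i * gosset_vec q i) = (\<Sum>i<8. ?e * (1 - 4 * (if i \<in> ?S then 1 else 0) - 4 * (if i \<in> ?T then 1 else 0)
      + 16 * (if i \<in> ?S \<inter> ?T then 1 else 0)))"
    by (intro sum.cong) (auto simp: gosset_vec_def)
  also have "\<dots> = ?e * (8 - 4 * int (card ?S) - 4 * int (card ?T) + 16 * int (card (?S \<inter> ?T)))"
    using S ind[of "?S"] ind[of "?T"] ind[of "?S \<inter> ?T"]
    by (simp add: sum_distrib_left[symmetric] sum.distrib sum_subtractf le_infI1)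
  also have "\<dots> = 24 - 16 * int (gosset_d p q)"
    using S card_Int_le2[OF assms(1), of ?T] by (auto simp: gosset_d_def of_nat_diff)
  finally show ?thesis .
qed

text \<open>Each square is at least 1, so none exceeds 24 - 7 = 17 and the odd coordinates have
  absolute value 1 or 3. The residue leaves 1 and -3 for \<open>e = 1\<close>, and -1 and 3 for
  \<open>e = 3\<close>; the norm 8 + 8 * 2 allows exactly two coordinates of absolute value
  3.\<close>

lemma gosset_lattice:
  assumes w: "\<And>i. i < 8 \<Longrightarrow> w i mod 4 = e" and e: "e = 1 \<or> e = 3"
    and sum: "(\<Sum>i<8. w i ^ 2) = (24::int)"
  shows "\<exists>b\<in>gosset_V. \<forall>i<8. gosset_vec b i = w i"
proof -
  have sq1: "w i ^ 2 \<ge> 1" if "i < 8" for i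
  proof -
    have "w i \<noteq> 0" using w[OF that] e by auto
    then have "w i ^ 2 > 0" by simp
    then show ?thesis by linarith
  qed
  have val: "w i = 2 - e \<or> w i = 3 * (e - 2)" if i: "i < 8" for i
  proof -
    have "(\<Sum>j\<in>{..<8} - {i}. 1) \<le> (\<Sum>j\<in>{..<8} - {i}. w j ^ 2)" using sq1 by (intro sum_mono) auto
    moreover have "(\<Sum>j<8. w j ^ 2) = w i ^ 2 + (\<Sum>j\<in>{..<8} - {i}. w j ^ 2)"
      using i by (intro sum.remove) auto
    ultimately have "w i ^ 2 \<le> 17" using sum i by simp
    then have "w i ^ 2 < 5 ^ 2" by simp
    then have "\<bar>w i\<bar> < 5" using abs_le_square_iff[of 5 "w i"] by linarith
    then have "w i \<in> {-4..4}" by auto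
    then have "w i \<in> {-4,-3,-2,-1,0,1,2,3,4}" by auto
    then show ?thesis using w[OF i] e by auto
  qed
  define S where "S = {i. i < 8 \<and> w i = 3 * (e - 2)}"
  have S8: "S \<subseteq> {..<8}" by (auto simp: S_def)
  have "(\<Sum>i<8. w i ^ 2) = (\<Sum>i<8. 1 + 8 * (if i \<in> S then 1 else 0))"
  proof (rule sum.cong)
    fix i assume "i \<in> {..<8::nat}"
    then show "w i ^ 2 = 1 + 8 * (if i \<in> S then 1 else 0)"
      using val[of i] e by (cases "w i = 3 * (e - 2)") (auto simp: S_def power2_eq_square)
  qed simp
  also have "\<dots> = 8 + 8 * int (card S)"
    using S8 by (simp add: sum.distrib sum_distrib_left[symmetric] sum.If_cases Int_absorb1)
  finally have "card S = 2" using sum by simp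
  then have "(e = 3, S) \<in> gosset_V" using S8 by (simp add: gosset_V_def)
  moreover have "gosset_vec (e = 3, S) i = w i" if "i < 8" for i
    using val[OF that] e that by (cases "w i = 3 * (e - 2)") (auto simp: gosset_vec_def S_def)
  ultimately show ?thesis by blast
qed

lemma gosset_vec_mod: "gosset_vec p i mod 4 = (if fst p then 3 else 1)"
  by (simp add: gosset_vec_def)

lemma ex_fresh: "\<exists>v<8::nat. v \<notin> {a, b, c}"
proof -
  have "\<exists>v<8::nat. v \<noteq> a \<and> v \<noteq> b \<and> v \<noteq> c" by presburger
  then show ?thesis by simp
qed

text \<open>For equal signs at distance 2, exchange an element of \<open>S\<close> for one of
  \<open>T\<close>. For opposite signs, keep an element of \<open>S\<close> (outside
  \<open>T\<close> unless \<open>S = T\<close>) and add one of the eight points outside both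
  sets.\<close>

lemma gosset_step: assumes p: "p \<in> gosset_V" "q \<in> gosset_V" "gosset_d p q = Suc n"
  shows "\<exists>w\<in>gosset_V. gosset_E p w \<and> gosset_d w q = n"
proof -
  obtain b S c T where pq: "p = (b, S)" "q = (c, T)" by (metis prod.exhaust)
  have S: "S \<subseteq> {..<8}" "card S = 2" "T \<subseteq> {..<8}" "card T = 2" using gosset_VD p pq by fastforce+
  have fin: "finite S" "finite T" using S finite_subset by blast+
  consider "gosset_d p q = 1" | "b = c" "card (S \<inter> T) = 0" "n = 1" | "b \<noteq> c" "card (S \<inter> T) = 1" "n = 1"
    | "b \<noteq> c" "card (S \<inter> T) = 2" "n = 2"
  proof (cases "b = c")
    case True
    then show ?thesis using that(1,2) p(3) pq
      by (cases "card (S \<inter> T) = 0"; cases "card (S \<inter> T) = 1") (auto simp: gosset_d_def)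
  next
    case False
    then have "card (S \<inter> T) = n" using p(3) pq by (simp add: gosset_d_def)
    moreover have "n \<le> 2" using card_Int_le2[OF p(1), of T] pq calculation by simp
    ultimately show ?thesis using that False p(3) by (cases "n = 0"; cases "n = 1") auto
  qed
  then show ?thesis
  proof cases
    case 1
    then show ?thesis using p gosset_E_iff[of p q] gosset_d_eq_0[of q q] by (intro bexI[of _ q]) auto
  next
    case 2
    obtain s1 s2 where s: "S = {s1, s2}" "s1 \<noteq> s2" using S by (auto simp: card_2_iff)
    obtain t1 t2 where t: "T = {t1, t2}" "t1 \<noteq> t2" using S by (auto simp: card_2_iff)
    have "S \<inter> T = {}" using 2 fin by simp
    then have ne: "s1 \<noteq> t1" "s1 \<noteq> t2" "s2 \<noteq> t1" "s2 \<noteq> t2" using s t by auto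
    have "(b, {s1, t1}) \<in> gosset_V" using S s t ne by (auto simp: gosset_V_def)
    moreover have "S \<inter> {s1, t1} = {s1}" "{s1, t1} \<inter> T = {t1}" using ne s t by auto
    then have "gosset_E p (b, {s1, t1})" "gosset_d (b, {s1, t1}) q = n"
      using 2 by (simp_all add: gosset_E_def gosset_d_def pq)
    ultimately show ?thesis by blast
  next
    case 3
    then obtain a where a: "S \<inter> T = {a}" by (auto simp: card_1_singleton_iff)
    then obtain s where s: "S = {a, s}" "s \<noteq> a" using S(2)
      by (metis Int_iff card_2_iff doubleton_eq_iff insert_iff singletonD)
    then obtain t where t: "T = {a, t}" "t \<noteq> a" using S(4) a
      by (metis Int_iff card_2_iff doubleton_eq_iff insert_iff singletonD)
    have st: "s \<noteq> t" using a s t by auto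
    obtain v where v: "v < 8" "v \<notin> {a, s, t}" using ex_fresh[of a s t] by blast
    have "(b, {s, v}) \<in> gosset_V" using S s v by (auto simp: gosset_V_def)
    moreover have "S \<inter> {s, v} = {s}" "{s, v} \<inter> T = {}" using v s t st by auto
    then have "gosset_E p (b, {s, v})" "gosset_d (b, {s, v}) q = n"
      using 3 by (simp_all add: gosset_E_def gosset_d_def pq)
    ultimately show ?thesis by blast
  next
    case 4
    have "S \<inter> T = S" "S \<inter> T = T" using fin S 4 by (intro card_subset_eq; simp)+
    then have ST: "S = T" by simp
    obtain s1 s2 where s: "S = {s1, s2}" "s1 \<noteq> s2" using S by (auto simp: card_2_iff)
    obtain v where v: "v < 8" "v \<notin> {s1, s2}" using ex_fresh[of s1 s1 s2] by auto
    have "(b, {s1, v}) \<in> gosset_V" using S s v by (auto simp: gosset_V_def)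
    moreover have "S \<inter> {s1, v} = {s1}" "{s1, v} \<inter> T = {s1}" using v s ST by auto
    then have "gosset_E p (b, {s1, v})" "gosset_d (b, {s1, v}) q = n"
      using 4 by (simp_all add: gosset_E_def gosset_d_def pq)
    ultimately show ?thesis by blast
  qed
qed

text \<open>The delicate case is distance 3: \<open>x\<close> and \<open>y\<close> carry the same
  pair with opposite signs, and then the distances from \<open>w\<close> to them sum up to
  3.\<close>

lemma gosset_lip: assumes V: "x \<in> gosset_V" "y \<in> gosset_V" "w \<in> gosset_V" and E: "gosset_E x w"
  shows "gosset_d x y \<le> gosset_d w y + 1"
proof -
  have c: "card (snd x \<inter> snd y) \<le> 2" "card (snd w \<inter> snd y) \<le> 2" using card_Int_le2 V by blast+
  have xw: "gosset_d x w = 1" using gosset_E_iff V E by simp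
  consider "gosset_d x y \<le> 1" | "gosset_d x y = 2" | "gosset_d x y = 3" proof -
    have "gosset_d x y \<le> 3" using c unfolding gosset_d_def by (split if_split) linarith
    then show ?thesis using that by linarith
  qed
  then show ?thesis
  proof cases
    case 2
    then have "w \<noteq> y" using xw by auto
    then have "gosset_d w y \<noteq> 0" using gosset_d_eq_0 V by blast
    then show ?thesis using 2 by simp
  next
    case 3
    then have a: "fst x \<noteq> fst y" "card (snd x \<inter> snd y) = 2" using c by (auto simp: gosset_d_def split: if_splits)
    have "snd x \<inter> snd y = snd x" "snd x \<inter> snd y = snd y"
      using gosset_VD[OF V(1)] gosset_VD[OF V(2)] a by (intro card_subset_eq; simp)+
    then have "snd x = snd y" by simp
    then have "gosset_d w y = 2" using xw a c gosset_d_commute[of x w] by (auto simp: gosset_d_def split: if_splits)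
    then show ?thesis using 3 by simp
  qed simp
qed

lemma gosset_V_finite: "finite gosset_V"
proof (rule finite_subset)
  show "gosset_V \<subseteq> UNIV \<times> Pow {..<8}" by (auto simp: gosset_V_def)
qed simp

lemma gosset_dist:
  assumes "p \<in> gosset_V" "q \<in> gosset_V"
  shows "gdist gosset_V gosset_E p q = gosset_d p q"
  by (rule gdist_characterization(2)[OF _ _ _ assms]) (fact gosset_d_eq_0 gosset_lip gosset_step)+

lemma gosset_pgraph: "pgraph gosset_V gosset_E"
proof
  show "finite gosset_V" by (rule gosset_V_finite)
  show "gosset_E v u" if "gosset_E u v" for u v using that by (simp add: gosset_E_def Int_commute split: if_splits)
  show "\<not> gosset_E u u" if "u \<in> gosset_V" for u using that gosset_VD[OF that] by (simp add: gosset_E_def)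
  show "connected_graph gosset_V gosset_E"
    by (rule gdist_characterization(1)[of gosset_V gosset_d gosset_E]) (fact gosset_d_eq_0 gosset_lip gosset_step)+
  show "parallelogram gosset_V gosset_E" unfolding parallelogram_def
  proof (intro ballI impI)
    fix x a y assume h: "x \<in> gosset_V" "a \<in> nbhd gosset_V gosset_E x" "y \<in> nbhd gosset_V gosset_E x"
      "gdist gosset_V gosset_E a y = 2"
    then have V: "a \<in> gosset_V" "y \<in> gosset_V" by (auto simp: nbhd_def)
    have gs: "gosset_d x a = 1" "gosset_d x y = 1" "gosset_d a y = 2"
      using h V gosset_E_iff gosset_dist by (auto simp: nbhd_def)
    \<comment> \<open>The vector of the fourth vertex has to be a + y - x. It inherits the
      congruences, and its squared norm is 3 * 24 + 2 * (-8) - 2 * 8 - 2 * 8 = 24.\<close>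
    define w where "w i = gosset_vec a i + gosset_vec y i - gosset_vec x i" for i
    define e :: int where "e = ((if fst a then 3 else 1) + (if fst y then 3 else 1) - (if fst x then 3 else 1)) mod 4"
    have we: "w i mod 4 = e" for i
    proof -
      have "w i mod 4 = (gosset_vec a i mod 4 + gosset_vec y i mod 4 - gosset_vec x i mod 4) mod 4"
        unfolding w_def by (intro mod_diff_cong mod_add_cong) simp_all
      then show ?thesis unfolding gosset_vec_mod e_def .
    qed
    have e: "e = 1 \<or> e = 3" by (auto simp: e_def)
    have "(\<Sum>i<8. w i ^ 2) = (\<Sum>i<8. gosset_vec a i * gosset_vec a i + gosset_vec y i * gosset_vec y i + gosset_vec x i * gosset_vec x i
        + 2 * (gosset_vec a i * gosset_vec y i) - 2 * (gosset_vec x i * gosset_vec a i) - 2 * (gosset_vec x i * gosset_vec y i))"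
      by (intro sum.cong) (auto simp: w_def power2_eq_square algebra_simps)
    also have "\<dots> = (\<Sum>i<8. gosset_vec a i * gosset_vec a i) + (\<Sum>i<8. gosset_vec y i * gosset_vec y i) + (\<Sum>i<8. gosset_vec x i * gosset_vec x i)
        + 2 * (\<Sum>i<8. gosset_vec a i * gosset_vec y i) - 2 * (\<Sum>i<8. gosset_vec x i * gosset_vec a i) - 2 * (\<Sum>i<8. gosset_vec x i * gosset_vec y i)"
      by (simp only: sum.distrib sum_subtractf sum_distrib_left)
    also have "\<dots> = 24"
      using gs V h(1) gosset_d_eq_0[of a a] gosset_d_eq_0[of x x] gosset_d_eq_0[of y y] by (simp add: gosset_vec_inner)
    finally obtain b where b: "b \<in> gosset_V" "\<forall>i<8. gosset_vec b i = w i" using gosset_lattice[of w e] we e by blast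
    have "gosset_d a z + gosset_d y z = gosset_d x z + gosset_d b z" if z: "z \<in> gosset_V" for z
    proof -
      have "(\<Sum>i<8. gosset_vec a i * gosset_vec z i) + (\<Sum>i<8. gosset_vec y i * gosset_vec z i) = (\<Sum>i<8. gosset_vec x i * gosset_vec z i) + (\<Sum>i<8. gosset_vec b i * gosset_vec z i)"
        unfolding sum.distrib[symmetric]
      proof (rule sum.cong)
        fix i assume "i \<in> {..<8::nat}"
        then have "gosset_vec b i = gosset_vec a i + gosset_vec y i - gosset_vec x i" using b by (simp add: w_def)
        then show "gosset_vec a i * gosset_vec z i + gosset_vec y i * gosset_vec z i = gosset_vec x i * gosset_vec z i + gosset_vec b i * gosset_vec z i" by algebra
      qed simp
      then show ?thesis using z V h(1) b(1) by (simp add: gosset_vec_inner)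
    qed
    then show "\<exists>b\<in>gosset_V. \<forall>z\<in>gosset_V. gdist gosset_V gosset_E a z + gdist gosset_V gosset_E y z
        = gdist gosset_V gosset_E x z + gdist gosset_V gosset_E b z"
      using b(1) V h(1) by (intro bexI[of _ b]) (simp_all add: gosset_dist)
  qed
qed

text \<open>Non-adjacency is collinearity in a generalised quadrangle of order (2,4): distances from a vertex to the three
  points of a line always sum up to 4, so two lines with a common point yield a parallelogram.\<close>
lemma (in cgraph) schlafli_pgraph:
  assumes "is_schlafli V E"
  shows "pgraph V E"
proof -
  have cV: "card V = 27" and deg: "\<And>v. v \<in> V \<Longrightarrow> card (N v) = 16"
    and lam: "\<And>u v. u \<in> V \<Longrightarrow> v \<in> N u \<Longrightarrow> card (N u \<inter> N v) = 10"
    and mu: "\<And>u v. u \<in> V \<Longrightarrow> v \<in> V \<Longrightarrow> u \<noteq> v \<Longrightarrow> v \<notin> N u \<Longrightarrow> card (N u \<inter> N v) = 8"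
    using assms by (auto simp: is_schlafli_def strongly_regular_def Deg_def N_iff)
  \<comment> \<open>The points collinear with \<open>u\<close>; there are 27 - 17 = 10 of
    them.\<close>
  define C where "C u = V - insert u (N u)" for u
  have C_sym: "v \<in> C u \<longleftrightarrow> u \<in> C v" if "u \<in> V" "v \<in> V" for u v
    using that N_sym[of u v] N_sym[of v u] by (auto simp: C_def)
  have fC: "finite (C u)" for u using fin by (simp add: C_def)
  have cC: "card (C u) = 10" if "u \<in> V" for u
  proof -
    have "card (insert u (N u)) = 17" using deg[OF that] N_irr[OF that] by simp
    moreover have "insert u (N u) \<subseteq> V" using that N_subset by blast
    ultimately show ?thesis unfolding C_def using cV fin by (simp add: card_Diff_subset)
  qed
  \<comment> \<open>Apart from two non-adjacent vertices and their 16 + 16 - 8 = 24 neighbours a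
    single vertex is left: the third point of their line.\<close>
  have one: "\<exists>w. C u \<inter> C v = {w}" if "u \<in> V" "v \<in> C u" for u v
  proof -
    have v: "v \<in> V" "u \<noteq> v" "v \<notin> N u" "u \<notin> N v" using that C_sym[of u v] by (auto simp: C_def)
    have "card (N u \<union> N v) = 24"
      using card_Un_Int[of "N u" "N v"] deg mu that(1) v by simp
    moreover have "card (insert u (insert v (N u \<union> N v))) = 2 + card (N u \<union> N v)"
      using v N_irr that(1) by simp
    moreover have "insert u (insert v (N u \<union> N v)) \<subseteq> V" using that v N_subset by blast
    moreover have "C u \<inter> C v = V - insert u (insert v (N u \<union> N v))" by (auto simp: C_def)
    ultimately have "card (C u \<inter> C v) = 1" using cV fin by (simp add: card_Diff_subset)
    then show ?thesis by (simp add: card_1_singleton_iff)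
  qed
  have CV: "C u \<subseteq> V" for u by (auto simp: C_def)
  \<comment> \<open>Each point of a line is collinear with 8 points off the line. These three sets
    are disjoint and fill the remaining 24 vertices.\<close>
  have line: "z \<in> C p \<union> C q \<union> C s" "z \<notin> C p \<inter> C q" "z \<notin> C p \<inter> C s" "z \<notin> C q \<inter> C s"
    if pqs: "p \<in> V" "q \<in> C p" "s \<in> C p" "s \<in> C q" and z: "z \<in> V" "z \<notin> {p, q, s}" for p q s z
  proof -
    have V: "q \<in> V" "s \<in> V" using pqs CV by blast+
    have sy: "p \<in> C q" "p \<in> C s" "q \<in> C s" using pqs C_sym V by blast+
    have ne: "p \<notin> C p" "q \<notin> C q" "s \<notin> C s" by (auto simp: C_def)
    have ne2: "p \<noteq> q" "p \<noteq> s" "q \<noteq> s" using ne pqs sy by blast+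
    have sing: "A = {w}" if "\<exists>w. A = {w}" "w \<in> A" for A and w :: 'a using that by auto
    have I: "C p \<inter> C q = {s}" by (rule sing[OF one[OF pqs(1,2)]]) (simp add: pqs)
    have I2: "C p \<inter> C s = {q}" by (rule sing[OF one[OF pqs(1,3)]]) (simp add: pqs sy)
    have I3: "C q \<inter> C s = {p}" by (rule sing[OF one[OF V(1) pqs(4)]]) (simp add: sy)
    note I = I I2 I3
    show nz: "z \<notin> C p \<inter> C q" "z \<notin> C p \<inter> C s" "z \<notin> C q \<inter> C s" unfolding I using z by auto
    let ?P = "C p - {q, s}" and ?Q = "C q - {p, s}" and ?S = "C s - {p, q}"
    have c8: "card ?P = 8" "card ?Q = 8" "card ?S = 8"
      using cC pqs(1) V pqs sy ne2 by (simp_all add: card_Diff_subset)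
    have "?P \<inter> ?Q = {}" "(?P \<union> ?Q) \<inter> ?S = {}" using I by blast+
    then have "card (?P \<union> ?Q \<union> ?S) = 24" using c8 fC by (simp add: card_Un_disjoint)
    moreover have "?P \<union> ?Q \<union> ?S \<subseteq> V - {p, q, s}" using CV ne by blast
    moreover have "card (V - {p, q, s}) = 24" using cV pqs(1) V ne2 fin by (simp add: card_Diff_subset)
    ultimately have "?P \<union> ?Q \<union> ?S = V - {p, q, s}" using fin by (intro card_subset_eq) auto
    then show "z \<in> C p \<union> C q \<union> C s" using z by blast
  qed
  have dist: "d u v = (if u = v then 0 else if v \<in> C u then 2 else 1)" if "u \<in> V" "v \<in> V" for u v
  proof (cases "v \<in> C u")
    case True
    then have v: "u \<noteq> v" "v \<notin> N u" by (auto simp: C_def)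
    then have "N u \<inter> N v \<noteq> {}" using mu[OF that] by auto
    then show ?thesis using d_eq_2[OF that] v True N_sym that by auto
  next
    case False
    then show ?thesis using that d_eq_1[OF that] by (auto simp: C_def)
  qed
  have line_sum: "d p z + d q z + d s z = 4"
    if pqs: "p \<in> V" "q \<in> C p" "s \<in> C p" "s \<in> C q" and z: "z \<in> V" for p q s z
  proof -
    have V: "q \<in> V" "s \<in> V" using pqs CV by blast+
    have sy: "p \<in> C q" "p \<in> C s" "q \<in> C s" using pqs C_sym V by blast+
    have ne: "p \<notin> C p" "q \<notin> C q" "s \<notin> C s" by (auto simp: C_def)
    show ?thesis
    proof (cases "z \<in> {p, q, s}")
      case True
      then show ?thesis using dist pqs(1) V pqs sy ne by auto
    next
      case False
      then show ?thesis using line[OF pqs z False] dist pqs(1) V z by auto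
    qed
  qed
  have "parallelogram V E" unfolding parallelogram_def
  proof (intro ballI impI)
    fix x a y assume h: "x \<in> V" "a \<in> N x" "y \<in> N x" "d a y = 2"
    have V: "a \<in> V" "y \<in> V" using h N_V by blast+
    have ay: "y \<in> C a" using h(4) dist[OF V] by (auto split: if_splits)
    \<comment> \<open>\<open>c\<close> is the third point of the line through \<open>a\<close> and
      \<open>y\<close>. As \<open>x\<close> is collinear with neither of them, it is collinear with
      \<open>c\<close>, and \<open>b\<close> is the third point of that line. Comparing the two line
      sums removes \<open>c\<close>.\<close>
    obtain c where c: "C a \<inter> C y = {c}" using one[OF V(1) ay] by blast
    have cV: "c \<in> V" using c CV by blast
    have nx: "x \<notin> C a" "x \<notin> C y" using N_sym h by (auto simp: C_def)
    have "x \<notin> {a, y, c}" using N_irr h nx c by auto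
    then have "x \<in> C c" using line(1)[OF V(1) ay _ _ h(1), of c] c nx by blast
    then have xc: "c \<in> C x" using C_sym cV h(1) by blast
    obtain b where b: "C x \<inter> C c = {b}" using one[OF h(1) xc] by blast
    have "\<forall>z\<in>V. d a z + d y z = d x z + d b z"
    proof
      fix z assume z: "z \<in> V"
      have "d a z + d y z + d c z = 4" using line_sum[OF V(1) ay _ _ z, of c] c by blast
      moreover have "d x z + d c z + d b z = 4" using line_sum[OF h(1) xc _ _ z, of b] b by blast
      ultimately show "d a z + d y z = d x z + d b z" by simp
    qed
    then show "\<exists>b\<in>V. \<forall>z\<in>V. d a z + d y z = d x z + d b z" using b CV by blast
  qed
  then show ?thesis by unfold_locales
qed

section \<open>Neighbourhoods in the graphs of the list\<close>

lemma connected_two_step: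
  assumes "\<And>u v. u \<in> L \<Longrightarrow> v \<in> L \<Longrightarrow> u = v \<or> E u v \<or> (\<exists>w\<in>L. E u w \<and> E w v)"
  shows "connected_graph L E"
  unfolding connected_graph_def
proof (intro ballI)
  fix u v assume uv: "u \<in> L" "v \<in> L"
  consider "u = v" | "E u v" | w where "w \<in> L" "E u w" "E w v" using assms[OF uv] by blast
  then show "\<exists>n. (adj L E ^^ n) u v"
  proof cases
    case 1 then show ?thesis by (intro exI[of _ 0]) simp
  next
    case 2 then show ?thesis using uv by (intro exI[of _ 1]) (simp add: adj_def relpowp_1 del: One_nat_def)
  next
    case 3
    then have "adj L E u w" "adj L E w v" using uv by (simp_all add: adj_def)
    then show ?thesis by (intro exI[of _ "Suc (Suc 0)"]) auto
  qed
qed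

lemma graph_isoI:
  assumes "bij_betw f V W" "\<And>u v. u \<in> V \<Longrightarrow> v \<in> V \<Longrightarrow> E u v \<longleftrightarrow> F (f u) (f v)"
  shows "graph_iso V E W F"
  using assms unfolding graph_iso_def by blast

definition complete_on :: "'a set \<Rightarrow> ('a \<Rightarrow> 'a \<Rightarrow> bool) \<Rightarrow> bool" where
  "complete_on V E \<longleftrightarrow> (\<forall>u\<in>V. \<forall>v\<in>V. u \<noteq> v \<longrightarrow> E u v)"

lemma complete_iso:
  assumes "finite V" "\<And>u. u \<in> V \<Longrightarrow> \<not> E u u" "complete_on V E"
  shows "graph_iso V E (johnson_V (card V) 1) sd_adj"
proof -
  obtain f where f: "bij_betw f V {0..<card V}" using ex_bij_betw_finite_nat assms(1) by blast
  show ?thesis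
  proof (rule graph_isoI[where f = "\<lambda>v. {f v}"])
    have "johnson_V (card V) 1 = (\<lambda>i. {i}) ` {0..<card V}"
      by (auto simp: johnson_V_def card_1_singleton_iff)
    then show "bij_betw (\<lambda>v. {f v}) V (johnson_V (card V) 1)"
      using f by (auto simp: bij_betw_def inj_on_def)
    fix u v assume "u \<in> V" "v \<in> V"
    then show "E u v \<longleftrightarrow> sd_adj {f u} {f v}"
      using assms f by (cases "u = v") (auto simp: complete_on_def sd_adj_def sd_def bij_betw_def inj_on_def insert_Diff_if)
  qed
qed

text \<open>The shape of a neighbourhood in a rook graph: the rest of a row and the rest of a
  column.\<close>

definition two_cliques :: "'a set \<Rightarrow> ('a \<Rightarrow> 'a \<Rightarrow> bool) \<Rightarrow> nat \<Rightarrow> nat \<Rightarrow> bool" where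
  "two_cliques V E p q \<longleftrightarrow> finite V \<and> (\<exists>A\<subseteq>V. card A = p \<and> card (V - A) = q \<and>
     (\<forall>u\<in>V. \<forall>v\<in>V. E u v \<longleftrightarrow> u \<noteq> v \<and> (u \<in> A \<longleftrightarrow> v \<in> A)))"

lemma two_cliques_iso:
  assumes "two_cliques V E p q" "two_cliques W F p q"
  shows "graph_iso V E W F"
proof -
  obtain A where A: "finite V" "A \<subseteq> V" "card A = p" "card (V - A) = q"
    "\<And>u v. u \<in> V \<Longrightarrow> v \<in> V \<Longrightarrow> E u v \<longleftrightarrow> u \<noteq> v \<and> (u \<in> A \<longleftrightarrow> v \<in> A)"
    using assms(1) unfolding two_cliques_def by blast
  obtain B where B: "finite W" "B \<subseteq> W" "card B = p" "card (W - B) = q"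
    "\<And>u v. u \<in> W \<Longrightarrow> v \<in> W \<Longrightarrow> F u v \<longleftrightarrow> u \<noteq> v \<and> (u \<in> B \<longleftrightarrow> v \<in> B)"
    using assms(2) unfolding two_cliques_def by blast
  have fin: "finite A" "finite B" using A B finite_subset by blast+
  obtain f where f: "bij_betw f A B" using finite_same_card_bij[OF fin] A B by auto
  obtain g where g: "bij_betw g (V - A) (W - B)" using finite_same_card_bij[of "V - A" "W - B"] A B by auto
  define h where "h x = (if x \<in> A then f x else g x)" for x
  have "bij_betw h A B" using f bij_betw_cong[of A h f B] by (simp add: h_def)
  moreover have "bij_betw h (V - A) (W - B)" using g bij_betw_cong[of "V - A" h g "W - B"] by (simp add: h_def)
  ultimately have "bij_betw h (A \<union> (V - A)) (B \<union> (W - B))" by (rule bij_betw_combine) auto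
  then have h: "bij_betw h V W" using A B by (simp add: Un_absorb1)
  show ?thesis
  proof (rule graph_isoI[OF h])
    fix u v assume uv: "u \<in> V" "v \<in> V"
    have hB: "h x \<in> B \<longleftrightarrow> x \<in> A" if "x \<in> V" for x
      using that bij_betwE[OF f] bij_betwE[OF g] by (auto simp: h_def)
    have "h u \<in> W" "h v \<in> W" using bij_betwE[OF h] uv by auto
    moreover have "u = v \<longleftrightarrow> h u = h v" using h uv by (auto simp: bij_betw_def inj_on_def)
    ultimately show "E u v \<longleftrightarrow> F (h u) (h v)" using A(5)[OF uv] B(5)[of "h u" "h v"] hB uv by simp
  qed
qed

text \<open>The pair (i, j) stands for the neighbour of \<open>{..<k}\<close> in J(n,k) that loses
  \<open>i\<close> and gains \<open>j\<close>; two such neighbours are adjacent iff exactly one of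
  the two choices agrees.\<close>

definition rook_V :: "nat \<Rightarrow> nat \<Rightarrow> (nat \<times> nat) set" where "rook_V n k = {..<k} \<times> {k..<n}"
definition rook_E :: "nat \<times> nat \<Rightarrow> nat \<times> nat \<Rightarrow> bool" where
  "rook_E p q \<longleftrightarrow> (fst p = fst q) \<noteq> (snd p = snd q)"

lemma rook_iso:
  assumes "k \<le> n"
  shows "graph_iso (rook_V n k) rook_E (nbhd (johnson_V n k) sd_adj {..<k}) sd_adj"
proof (rule graph_isoI[where f = "\<lambda>(i, j). insert j ({..<k} - {i})"])
  let ?f = "\<lambda>(i, j). insert j ({..<k} - {i})" and ?A = "{..<k}"
  have AJ: "?A \<in> johnson_V n k" using assms by (auto simp: johnson_V_def)
  show adj: "rook_E p q \<longleftrightarrow> sd_adj (?f p) (?f q)" if "p \<in> rook_V n k" "q \<in> rook_V n k" for p q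
  proof -
    obtain i j i' j' where pq: "p = (i, j)" "q = (i', j')" by (metis prod.exhaust)
    have b: "i < k" "k \<le> j" "i' < k" "k \<le> j'" using that pq by (auto simp: rook_V_def)
    let ?X = "if i = i' then {} else {i, i'}" and ?Y = "if j = j' then {} else {j, j'}"
    have "sd (?f p) (?f q) = ?X \<union> ?Y"
      using b unfolding pq sd_def by auto
    moreover have "card (?X \<union> ?Y) = card ?X + card ?Y" using b by (intro card_Un_disjoint) auto
    moreover have "card ?X = (if i = i' then 0 else 2)" "card ?Y = (if j = j' then 0 else 2)" by simp_all
    ultimately have "card (sd (?f p) (?f q)) = (if i = i' then 0 else 2) + (if j = j' then 0 else 2)" by presburger
    then show ?thesis unfolding sd_adj_def rook_E_def pq fst_conv snd_conv by (cases "i = i'"; cases "j = j'") simp_all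
  qed
  show "bij_betw ?f (rook_V n k) (nbhd (johnson_V n k) sd_adj ?A)"
  proof (rule bij_betw_imageI)
    show "inj_on ?f (rook_V n k)"
    proof (rule inj_onI)
      have D: "?A - ?f p = {fst p}" "?f p - ?A = {snd p}" if "p \<in> rook_V n k" for p
        using that by (auto simp: rook_V_def)
      fix p q assume pq: "p \<in> rook_V n k" "q \<in> rook_V n k" "?f p = ?f q"
      have "{fst p} = {fst q}" "{snd p} = {snd q}"
        using D[OF pq(1)] D[OF pq(2)] unfolding pq(3) by simp_all
      then show "p = q" by (simp add: prod_eq_iff)
    qed
    show "?f ` rook_V n k = nbhd (johnson_V n k) sd_adj ?A"
    proof
      show "?f ` rook_V n k \<subseteq> nbhd (johnson_V n k) sd_adj ?A"
      proof (rule image_subsetI)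
        fix p assume p: "p \<in> rook_V n k"
        then obtain i j where ij: "p = (i, j)" "i < k" "k \<le> j" "j < n" by (auto simp: rook_V_def)
        have "sd ?A (?f p) = {i, j}" using ij by (auto simp: sd_def)
        moreover have "card (?f p) = k" using ij by (simp add: card_Diff_singleton_if)
        moreover have "?f p \<subseteq> {..<n}" using ij by auto
        ultimately show "?f p \<in> nbhd (johnson_V n k) sd_adj ?A"
          using ij by (simp add: nbhd_def johnson_V_def sd_adj_def)
      qed
      show "nbhd (johnson_V n k) sd_adj ?A \<subseteq> ?f ` rook_V n k"
      proof
        fix C assume "C \<in> nbhd (johnson_V n k) sd_adj ?A"
        then have C: "C \<in> johnson_V n k" "card (sd ?A C) = 2" by (auto simp: nbhd_def sd_adj_def)
        have Cf: "finite C" "card C = k" "C \<subseteq> {..<n}" using C(1) johnson_finite[OF C(1)] by (auto simp: johnson_V_def)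
        have "int 2 = int k + int k - 2 * int (card (?A \<inter> C))" using card_sd[of ?A C] Cf C(2) by simp
        then have "card (?A \<inter> C) + 1 = k" by linarith
        moreover have "card ?A = card (?A - C) + card (?A \<inter> C)"
          by (metis card_Diff_subset_Int card_mono finite_Int finite_lessThan inf_le1 le_add_diff_inverse2)
        moreover have "card C = card (C - ?A) + card (?A \<inter> C)"
          using Cf by (metis Int_commute card_Diff_subset_Int card_mono finite_Int inf_le1 le_add_diff_inverse2)
        ultimately have "card (?A - C) = 1" "card (C - ?A) = 1" using Cf by simp_all
        then obtain i j where ij: "?A - C = {i}" "C - ?A = {j}" by (auto simp: card_1_singleton_iff)
        have "i < k" "k \<le> j" "j < n" using ij Cf(3) by (auto simp: set_eq_iff not_less)
        moreover have "C = insert j (?A - {i})" using ij by auto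
        ultimately show "C \<in> ?f ` rook_V n k" by (intro image_eqI[of _ _ "(i, j)"]) (auto simp: rook_V_def)
      qed
    qed
  qed
qed

lemma connected_graph_iso:
  assumes "connected_graph V E" "graph_iso V E W F"
  shows "connected_graph W F"
proof -
  obtain f where f: "bij_betw f V W" "\<And>u v. u \<in> V \<Longrightarrow> v \<in> V \<Longrightarrow> E u v \<longleftrightarrow> F (f u) (f v)"
    using assms(2) unfolding graph_iso_def by blast
  have walk: "(adj V E ^^ n) x y \<Longrightarrow> (adj W F ^^ n) (f x) (f y)" for n x y
  proof (induction n arbitrary: y)
    case (Suc n)
    then obtain w where w: "(adj V E ^^ n) x w" "adj V E w y" by (auto elim: relpowp_Suc_E)
    then have "adj W F (f w) (f y)" using f bij_betwE[OF f(1)] by (auto simp: adj_def)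
    then show ?case using Suc.IH[OF w(1)] by auto
  qed simp
  show ?thesis unfolding connected_graph_def
  proof (intro ballI)
    fix x y assume "x \<in> W" "y \<in> W"
    then obtain u v where "u \<in> V" "v \<in> V" "x = f u" "y = f v" using f(1) by (auto simp: bij_betw_def)
    then show "\<exists>n. (adj W F ^^ n) x y" using assms(1) walk unfolding connected_graph_def by blast
  qed
qed

text \<open>Inherited from the Johnson graph, in which the rook graph is a neighbourhood; the corner
  \<open>(fst u, snd v)\<close> shows that it is connected.\<close>

lemma rook_pgraph: assumes "1 \<le> k" "k < n"
  shows "pgraph (rook_V n k) rook_E"
proof -
  have "connected_graph (rook_V n k) rook_E"
  proof (rule connected_two_step)
    fix u v assume uv: "u \<in> rook_V n k" "v \<in> rook_V n k"
    have "(fst u, snd v) \<in> rook_V n k" using uv by (auto simp: rook_V_def)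
    then show "u = v \<or> rook_E u v \<or> (\<exists>w\<in>rook_V n k. rook_E u w \<and> rook_E w v)"
      by (cases "fst u = fst v"; cases "snd u = snd v") (auto simp: rook_E_def prod_eq_iff intro!: bexI[of _ "(fst u, snd v)"])
  qed
  then have c: "connected_graph (nbhd (johnson_V n k) sd_adj {..<k}) sd_adj"
    using connected_graph_iso rook_iso assms by (metis less_imp_le)
  have "{..<k} \<in> johnson_V n k" using assms by (auto simp: johnson_V_def)
  then have "pgraph (nbhd (johnson_V n k) sd_adj {..<k}) sd_adj"
    using pgraph.local_pgraph[OF johnson_sd_pgraph(1) _ c] by blast
  then show ?thesis using pgraph_iso rook_iso assms by (metis less_imp_le)
qed

lemma rook_local: assumes "1 \<le> k" "k < n"
  shows "two_cliques (nbhd (rook_V n k) rook_E (0, k)) rook_E (k - 1) (n - k - 1)"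
proof -
  let ?V = "nbhd (rook_V n k) rook_E (0, k)"
  let ?A = "{1..<k} \<times> {k}" and ?B = "{0} \<times> {Suc k..<n}"
  have V: "?V = ?A \<union> ?B" using assms by (auto simp: nbhd_def rook_V_def rook_E_def)
  have d: "?A \<inter> ?B = {}" by auto
  then have VA: "?V - ?A = ?B" unfolding V by blast
  show ?thesis unfolding two_cliques_def
  proof (intro conjI exI[of _ ?A])
    show "finite ?V" unfolding V by simp
    show "?A \<subseteq> ?V" unfolding V by blast
    show "card ?A = k - 1" by simp
    show "card (?V - ?A) = n - k - 1" unfolding VA by simp
    show "\<forall>u\<in>?V. \<forall>v\<in>?V. rook_E u v \<longleftrightarrow> u \<noteq> v \<and> (u \<in> ?A \<longleftrightarrow> v \<in> ?A)"
      unfolding V by (auto simp: rook_E_def)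
  qed
qed

lemma johnson_complement:
  assumes "k \<le> n"
  shows "graph_iso (johnson_V n k) sd_adj (johnson_V n (n - k)) sd_adj"
proof (rule graph_isoI[where f = "\<lambda>A. {..<n} - A"])
  have c: "{..<n} - A \<in> johnson_V n (n - k)" if "A \<in> johnson_V n k" for A k
    using that johnson_finite[OF that] by (auto simp: johnson_V_def card_Diff_subset)
  show "bij_betw (\<lambda>A. {..<n} - A) (johnson_V n k) (johnson_V n (n - k))"
  proof (rule bij_betw_byWitness[where f' = "\<lambda>A. {..<n} - A"])
    show "(\<lambda>A. {..<n} - A) ` johnson_V n (n - k) \<subseteq> johnson_V n k" using c[of _ "n - k"] assms by auto
    show "(\<lambda>A. {..<n} - A) ` johnson_V n k \<subseteq> johnson_V n (n - k)" using c by auto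
  qed (auto simp: johnson_V_def)
  show "sd_adj A B \<longleftrightarrow> sd_adj ({..<n} - A) ({..<n} - B)" if "A \<in> johnson_V n k" "B \<in> johnson_V n k" for A B
  proof -
    have "sd ({..<n} - A) ({..<n} - B) = sd A B" using that by (auto simp: sd_def johnson_V_def)
    then show ?thesis by (simp add: sd_adj_def)
  qed
qed

lemma even_local: "nbhd (even_V n) sd_adj {} = johnson_V n 2"
  by (auto simp: nbhd_def even_V_def johnson_V_def sd_adj_def sd_def)

lemma cocktail_local: "nbhd (cocktail_V (Suc k)) cocktail_E (2 * k) = cocktail_V k"
proof -
  have "j < 2 * Suc k \<and> 2 * k \<noteq> j \<and> 2 * k div 2 \<noteq> j div 2 \<longleftrightarrow> j < 2 * k" for j by presburger
  then show ?thesis unfolding nbhd_def cocktail_V_def cocktail_E_def by auto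
qed

section \<open>Finite models, listed explicitly and checked by evaluation\<close>

lemma johnson_V_list: "johnson_V n k = set (filter (\<lambda>A. card A = k) (map set (subseqs [0..<n])))"
proof -
  have "johnson_V n k = {A \<in> Pow (set [0..<n]). card A = k}" by (auto simp: johnson_V_def)
  also have "\<dots> = set (filter (\<lambda>A. card A = k) (map set (subseqs [0..<n])))"
    using subseqs_powset[of "[0..<n]"] by auto
  finally show ?thesis .
qed

lemma even_V_list: "even_V n = set (filter (\<lambda>A. even (card A)) (map set (subseqs [0..<n])))"
proof -
  have "even_V n = {A \<in> Pow (set [0..<n]). even (card A)}" by (auto simp: even_V_def)
  also have "\<dots> = set (filter (\<lambda>A. even (card A)) (map set (subseqs [0..<n])))"
    using subseqs_powset[of "[0..<n]"] by auto
  finally show ?thesis .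
qed

text \<open>Positions 2i and 2i + 1 hold complementary pairs, which are the antipodes.\<close>

definition octahedron_map :: "nat \<Rightarrow> nat set" where
  "octahedron_map i = [{0, 1}, {2, 3}, {0, 2}, {1, 3}, {0, 3}, {1, 2}] ! i"

lemma octahedron_iso: "graph_iso (johnson_V 4 2) sd_adj (cocktail_V 3) cocktail_E"
proof (rule graph_iso_sym, rule graph_isoI[where f = octahedron_map])
  have V: "cocktail_V 3 = set [0..<6]" by (auto simp: cocktail_V_def)
  have im: "octahedron_map ` set [0..<6] = johnson_V 4 2" unfolding johnson_V_list by code_simp
  have ad: "\<forall>u\<in>set [0..<6]. \<forall>v\<in>set [0..<6]. cocktail_E u v \<longleftrightarrow> sd_adj (octahedron_map u) (octahedron_map v)" by code_simp
  have "\<forall>u\<in>set [0..<6]. \<forall>v\<in>set [0..<6]. octahedron_map u = octahedron_map v \<longrightarrow> u = v" by code_simp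
  then show "bij_betw octahedron_map (cocktail_V 3) (johnson_V 4 2)"
    unfolding V bij_betw_def inj_on_def using im by blast
  show "cocktail_E u v \<longleftrightarrow> sd_adj (octahedron_map u) (octahedron_map v)" if "u \<in> cocktail_V 3" "v \<in> cocktail_V 3" for u v
    using ad that unfolding V by blast
qed

text \<open>A concrete model inside the Gosset graph; \<open>schlafli_iso_srg\<close> recovers the
  parameters (27,16,10,8) from it.\<close>

definition schlafli_V :: "(bool \<times> nat set) set" where
  "schlafli_V = nbhd gosset_V gosset_E (True, {0, 1})"

text \<open>There are 12 vertices of the same sign, whose pairs meet {0, 1} in one point, and 15 of
  the opposite sign, whose pairs avoid it.\<close>

lemma schlafli_V_list: "schlafli_V = set (map (\<lambda>(i, j). (True, {i, j})) (List.product [0, 1] [2..<8])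
    @ map (\<lambda>A. (False, A)) (filter (\<lambda>A. card A = 2) (map set (subseqs [2..<8]))))"
proof -
  have "gosset_V = UNIV \<times> johnson_V 8 2" by (auto simp: gosset_V_def johnson_V_def)
  also have "\<dots> = set (List.product [True, False] (filter (\<lambda>A. card A = 2) (map set (subseqs [0..<8]))))"
    unfolding johnson_V_list by (auto simp: UNIV_bool)
  finally have "schlafli_V = set (filter (gosset_E (True, {0, 1}))
      (List.product [True, False] (filter (\<lambda>A. card A = 2) (map set (subseqs [0..<8])))))"
    unfolding schlafli_V_def nbhd_def by (simp only: set_filter)
  also have "\<dots> = set (map (\<lambda>(i, j). (True, {i, j})) (List.product [0, 1] [2..<8])
    @ map (\<lambda>A. (False, A)) (filter (\<lambda>A. card A = 2) (map set (subseqs [2..<8]))))"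
    by code_simp
  finally show ?thesis .
qed

lemma schlafli_connected: "connected_graph schlafli_V gosset_E"
proof (rule connected_two_step)
  have "\<forall>u\<in>schlafli_V. \<forall>v\<in>schlafli_V. u = v \<or> gosset_E u v \<or> (\<exists>w\<in>schlafli_V. gosset_E u w \<and> gosset_E w v)"
    unfolding schlafli_V_list by code_simp
  then show "u \<in> schlafli_V \<Longrightarrow> v \<in> schlafli_V \<Longrightarrow> u = v \<or> gosset_E u v \<or> (\<exists>w\<in>schlafli_V. gosset_E u w \<and> gosset_E w v)" for u v
    by blast
qed

lemma gosset_base: "(True, {0, 1}) \<in> gosset_V"
  by (simp add: gosset_V_def)

lemma schlafli_V_pgraph: "pgraph schlafli_V gosset_E"
  unfolding schlafli_V_def
  by (rule pgraph.local_pgraph[OF gosset_pgraph gosset_base schlafli_connected[unfolded schlafli_V_def]])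

text \<open>The two lists are complementary subgroups of order 4 of the even subsets of {0..4} under
  symmetric difference, so the 4 by 4 grid of index pairs enumerates all 16 even subsets.\<close>

definition clebsch_map :: "nat \<times> nat \<Rightarrow> nat set" where
  "clebsch_map = (\<lambda>(i, j). sd ([{}, {3, 4}, {0, 1, 2, 4}, {0, 1, 2, 3}] ! i) ([{}, {1, 2}, {0, 2}, {0, 1}] ! (j - 4)))"

definition clebsch_vertex :: "nat \<times> nat \<Rightarrow> bool \<times> nat set" where
  "clebsch_vertex = (\<lambda>(i, j). (i < 2, {i, j}))"

text \<open>Both graphs are compared with one 4 by 4 grid: the neighbours of (False, {2, 3}) are the
  pairs {i, j} with i < 4 \<le> j, with sign \<open>True\<close> exactly for i < 2.\<close>

lemma schlafli_local:
  "graph_iso (nbhd schlafli_V gosset_E (False, {2, 3})) gosset_E (even_V 5) sd_adj"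
proof -
  let ?V = "set (List.product [0..<4] [4..<8])"
  let ?E = "\<lambda>u v. sd_adj (clebsch_map u) (clebsch_map v)"
  have "nbhd schlafli_V gosset_E (False, {2, 3}) = Set.filter (gosset_E (False, {2, 3})) schlafli_V"
    by (auto simp: nbhd_def)
  also have "\<dots> = clebsch_vertex ` ?V" unfolding schlafli_V_list by code_simp
  finally have im1: "clebsch_vertex ` ?V = nbhd schlafli_V gosset_E (False, {2, 3})" ..
  have im2: "clebsch_map ` ?V = even_V 5" unfolding even_V_list by code_simp
  have inj1: "\<forall>u\<in>?V. \<forall>v\<in>?V. clebsch_vertex u = clebsch_vertex v \<longrightarrow> u = v" by code_simp
  have inj2: "\<forall>u\<in>?V. \<forall>v\<in>?V. clebsch_map u = clebsch_map v \<longrightarrow> u = v" by code_simp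
  have adj: "\<forall>u\<in>?V. \<forall>v\<in>?V. ?E u v \<longleftrightarrow> gosset_E (clebsch_vertex u) (clebsch_vertex v)"
    unfolding sd_adj_def by code_simp
  have "graph_iso ?V ?E (nbhd schlafli_V gosset_E (False, {2, 3})) gosset_E"
    by (rule graph_isoI[where f = clebsch_vertex]) (use im1 inj1 adj in \<open>auto simp: bij_betw_def inj_on_def\<close>)
  moreover have "graph_iso ?V ?E (even_V 5) sd_adj"
    by (rule graph_isoI[where f = clebsch_map]) (use im2 inj2 in \<open>auto simp: bij_betw_def inj_on_def\<close>)
  ultimately show ?thesis using graph_iso_sym graph_iso_trans by blast
qed

section \<open>Classification\<close>

text \<open>For a connected graph: diameter at least 3. Phrased by edges, it passes through
  isomorphisms without any talk of distances.\<close>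

definition has_far :: "'a set \<Rightarrow> ('a \<Rightarrow> 'a \<Rightarrow> bool) \<Rightarrow> bool" where
  "has_far V E \<longleftrightarrow> (\<exists>u\<in>V. \<exists>v\<in>V. u \<noteq> v \<and> \<not> E u v \<and> \<not> (\<exists>w\<in>V. E u w \<and> E w v))"

lemma has_far_iso: assumes "has_far W F" "graph_iso V E W F" shows "has_far V E"
proof -
  obtain f where f: "bij_betw f V W" "\<forall>u\<in>V. \<forall>v\<in>V. E u v \<longleftrightarrow> F (f u) (f v)"
    using assms(2) unfolding graph_iso_def by blast
  obtain u' v' where u': "u' \<in> W" "v' \<in> W" "u' \<noteq> v'" "\<not> F u' v'" "\<not> (\<exists>w\<in>W. F u' w \<and> F w v')"
    using assms(1) unfolding has_far_def by blast
  obtain u v where uv: "u \<in> V" "v \<in> V" "u' = f u" "v' = f v"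
    using f(1) u'(1,2) unfolding bij_betw_def by blast
  have "\<not> (\<exists>w\<in>V. E u w \<and> E w v)" using u'(5) f uv bij_betwE[OF f(1)] by blast
  moreover have "u \<noteq> v" "\<not> E u v" using u' uv f by auto
  ultimately show ?thesis using uv unfolding has_far_def by blast
qed

lemma (in cgraph) has_far_3: assumes "u \<in> V" "v \<in> V" "d u v = 3" shows "has_far V E"
proof -
  have "\<not> E u v" using d_eq_1[of u v] assms by (simp add: N_iff)
  moreover have "u \<noteq> v" using assms by auto
  moreover have "\<not> (\<exists>w\<in>V. E u w \<and> E w v)"
  proof
    assume "\<exists>w\<in>V. E u w \<and> E w v"
    then obtain w where "w \<in> N u" "v \<in> N w" "w \<in> V" using assms by (auto simp: N_iff)
    then show False using d_triangle[of u w v] d_N[of u w] d_N[of w v] assms by simp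
  qed
  ultimately show ?thesis using assms unfolding has_far_def by blast
qed

lemma johnson_far: assumes "3 \<le> k" "k + 3 \<le> n" shows "has_far (johnson_V n k) sd_adj"
proof -
  let ?A = "{..<k}" and ?B = "{3..<k+3}"
  have V: "?A \<in> johnson_V n k" "?B \<in> johnson_V n k" using assms by (auto simp: johnson_V_def)
  have "sd ?A ?B = {0, 1, 2} \<union> {k, k + 1, k + 2}" using assms by (auto simp: sd_def)
  moreover have "card ({0, 1, 2} \<union> {k, k + 1, k + 2}) = card {0, 1, 2 :: nat} + card {k, k + 1, k + 2}"
    using assms by (intro card_Un_disjoint) auto
  ultimately have "card (sd ?A ?B) = 6" by simp
  then have "gdist (johnson_V n k) sd_adj ?A ?B = 3" using johnson_sd_pgraph(2)[OF V] by simp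
  then show ?thesis using cgraph.has_far_3[OF pgraph.axioms(1)[OF johnson_sd_pgraph(1)] V] by simp
qed

lemma even_far: assumes "6 \<le> n" shows "has_far (even_V n) sd_adj"
proof -
  have V: "{} \<in> even_V n" "{..<6} \<in> even_V n" using assms by (auto simp: even_V_def)
  have "sd {} {..<6::nat} = {..<6}" by (auto simp: sd_def)
  then have "gdist (even_V n) sd_adj {} {..<6} = 3" using even_sd_pgraph(2)[OF V] by simp
  then show ?thesis using cgraph.has_far_3[OF pgraph.axioms(1)[OF even_sd_pgraph(1)] V] by simp
qed

lemma gosset_far: "has_far gosset_V gosset_E"
proof -
  have V: "(False, {0, 1}) \<in> gosset_V" by (simp add: gosset_V_def)
  have "gosset_d (True, {0, 1}) (False, {0, 1}) = 3" by (simp add: gosset_d_def)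
  then have "gdist gosset_V gosset_E (True, {0, 1}) (False, {0, 1}) = 3"
    using gosset_dist[OF gosset_base V] by simp
  then show ?thesis using cgraph.has_far_3[OF pgraph.axioms(1)[OF gosset_pgraph] gosset_base V] by simp
qed

text \<open>The bounds avoid coincidences of small cases: J(4,2) is the octahedron, the halved
  3-cube is complete, and the halved 4-cube is a cocktail party graph.\<close>

definition standard_graph :: "'a set \<Rightarrow> ('a \<Rightarrow> 'a \<Rightarrow> bool) \<Rightarrow> bool" where
  "standard_graph V E \<longleftrightarrow> complete_on V E
    \<or> (\<exists>k\<ge>3. graph_iso V E (cocktail_V k) cocktail_E)
    \<or> (\<exists>n k. 2 \<le> k \<and> k + 2 \<le> n \<and> graph_iso V E (johnson_V n k) sd_adj \<and> 5 \<le> n)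
    \<or> (\<exists>n\<ge>5. graph_iso V E (even_V n) sd_adj)
    \<or> graph_iso V E schlafli_V gosset_E
    \<or> graph_iso V E gosset_V gosset_E"

context pgraph begin

lemma local_not_far:
  assumes "x \<in> V" "connected_graph (N x) E" shows "\<not> has_far (N x) E"
proof
  assume "has_far (N x) E"
  then obtain u v where uv: "u \<in> N x" "v \<in> N x" "u \<noteq> v" "\<not> E u v" "\<not> (\<exists>w\<in>N x. E u w \<and> E w v)"
    unfolding has_far_def by blast
  have "v \<notin> N u" using uv by (simp add: N_iff)
  then show False using local_common[OF assms uv(1-3)] uv(5) by (auto simp: N_iff)
qed

text \<open>Neighbours of \<open>x\<close> at distance 2 belong to orthogonal roots. Reflecting
  \<open>u1\<close> along the arcs to \<open>u2\<close> and \<open>u3\<close> adds both roots, and x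
  plus three orthogonal roots has distance 3 from x.\<close>

lemma three_independent:
  assumes x: "x \<in> V" and u: "u1 \<in> N x" "u2 \<in> N x" "u3 \<in> N x"
    and ne: "u1 \<noteq> u2" "u1 \<noteq> u3" "u2 \<noteq> u3" "u2 \<notin> N u1" "u3 \<notin> N u1" "u3 \<notin> N u2"
  shows "\<exists>z\<in>V. d x z = 3"
proof -
  have V: "u1 \<in> V" "u2 \<in> V" "u3 \<in> V" using u N_V by blast+
  have dd: "d u1 u2 = 2" "d u1 u3 = 2" "d u2 u3 = 2" using d_two[OF x] u ne by simp_all
  have d1: "d x u1 = 1" using d_N x u by simp
  have r1: "r x u2 u1 = -1" "r x u3 u1 = -1"
    using d1 dd d_sym[of u2 u1] d_sym[of u3 u1] V by (simp_all add: r_def)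
  define z where "z = \<sigma> x u2 u1"
  have zV: "z \<in> V" using \<sigma>_V x u V by (simp add: z_def)
  have dz: "int (d x z) = 2" using d_x_\<sigma>[OF x u(2) V(1)] d1 r1 by (simp add: z_def)
  have "r x u3 z = -1" using r_act[OF x u(2,3) V(1)] r1 dd by (simp add: z_def)
  then have "int (d x (\<sigma> x u3 z)) = 3" using d_x_\<sigma>[OF x u(3) zV] dz by simp
  then show ?thesis using \<sigma>_V[OF x u(3) zV] by (intro bexI[of _ "\<sigma> x u3 z"]) simp_all
qed

lemma N_complete:
  assumes x: "x \<in> V" and c: "complete_on (N x) E" and y: "y \<in> N x"
  shows "complete_on (N y) E"
  unfolding complete_on_def
proof (intro ballI impI)
  fix u v assume uv: "u \<in> N y" "v \<in> N y" "u \<noteq> v"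
  have im: "N y = \<sigma> x y ` N x" using \<sigma>_image_N[OF x y x] \<sigma>_x[OF x y] by simp
  then obtain u' v' where u': "u' \<in> N x" "v' \<in> N x" "u = \<sigma> x y u'" "v = \<sigma> x y v'" using uv by blast
  have "u' \<noteq> v'" using uv(3) u' by auto
  then have "E u' v'" using c u'(1,2) unfolding complete_on_def by simp
  moreover have V: "u' \<in> V" "v' \<in> V" using u' N_V by blast+
  ultimately have "v' \<in> N u'" by (simp add: N_iff)
  then have "v \<in> N u" using \<sigma>_N[OF x y V] u' by simp
  then show "E u v" by (simp add: N_iff)
qed

text \<open>Reflections carry the clique \<open>N x\<close> to the neighbourhood of each neighbour,
  so \<open>x\<close> and its neighbours are closed under adjacency.\<close>

lemma complete_from_local:
  assumes x: "x \<in> V" and c: "complete_on (N x) E"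
  shows "complete_on V E"
proof -
  have Q: "z = x \<or> z \<in> N x" if "z \<in> V" for z
  proof (rule connected_induct[of x "\<lambda>z. z = x \<or> z \<in> N x" z])
    fix u v assume a: "u \<in> V" "v \<in> N u" "u = x \<or> u \<in> N x"
    show "v = x \<or> v \<in> N x"
    proof (cases "u = x")
      case False
      then have u: "u \<in> N x" using a by blast
      then have "x \<in> N u" using N_sym x by blast
      then have "x \<noteq> v \<longrightarrow> E x v" using N_complete[OF x c u] a(2) unfolding complete_on_def by simp
      then show ?thesis using N_V[OF a(2)] by (auto simp: N_iff)
    qed (use a in blast)
  qed (use x that in auto)
  show ?thesis unfolding complete_on_def
  proof (intro ballI impI)
    fix u v assume uv: "u \<in> V" "v \<in> V" "u \<noteq> v"
    show "E u v"
    proof (cases "u = x \<or> v = x")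
      case True
      then show ?thesis using Q[OF uv(1)] Q[OF uv(2)] uv(3) N_sym[OF x, of u] by (auto simp: N_iff)
    next
      case False
      then have "u \<in> N x" "v \<in> N x" using Q[OF uv(1)] Q[OF uv(2)] by simp_all
      then show ?thesis using uv(3) c unfolding complete_on_def by simp
    qed
  qed
qed

text \<open>In diameter at most 2 no three neighbours of \<open>y\<close> are pairwise non-adjacent,
  by \<open>three_independent\<close>. For \<open>u\<close> and \<open>v\<close> in different
  components, whatever is not adjacent to \<open>u\<close> is adjacent to \<open>v\<close>, and a
  non-edge inside one part would form an independent triple with a vertex of the other.\<close>

lemma disconnected_two_cliques:
  assumes y: "y \<in> V" and far: "\<not> has_far V E" and nc: "\<not> connected_graph (N y) E"
  shows "\<exists>p q. 1 \<le> p \<and> 1 \<le> q \<and> two_cliques (N y) E p q"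
proof -
  obtain u v where uv: "u \<in> N y" "v \<in> N y" "\<And>n. \<not> (adj (N y) E ^^ n) u v"
    using nc unfolding connected_graph_def by blast
  have n3: "\<not> (\<exists>z\<in>V. d y z = 3)" using has_far_3[OF y] far by blast
  define R where "R a b \<longleftrightarrow> (\<exists>n. (adj (N y) E ^^ n) a b)" for a b
  have R_refl: "R a a" for a unfolding R_def by (intro exI[of _ 0]) simp
  have R_trans: "R a c" if "R a b" "R b c" for a b c
  proof -
    from that obtain m n where "(adj (N y) E ^^ m) a b" "(adj (N y) E ^^ n) b c" unfolding R_def by blast
    then have "(adj (N y) E ^^ (m + n)) a c" by (auto simp: relpowp_add)
    then show ?thesis unfolding R_def by blast
  qed
  have R_E: "R a b" if "a \<in> N y" "b \<in> N y" "E a b" for a b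
    unfolding R_def using that by (intro exI[of _ 1]) (simp add: adj_def relpowp_1 del: One_nat_def)
  have Esym: "E b a" if "a \<in> N y" "b \<in> N y" "E a b" for a b using that sym N_V by blast
  have nR: "\<not> R u v" using uv R_def by blast
  have indep: False if "a \<in> N y" "b \<in> N y" "c \<in> N y" "a \<noteq> b" "a \<noteq> c" "b \<noteq> c" "\<not> E a b" "\<not> E a c" "\<not> E b c" for a b c
    using three_independent[OF y that(1-6)] n3 that(7-9) by (simp add: N_iff)
  define A where "A = {a \<in> N y. a = u \<or> E u a}"
  have A: "A \<subseteq> N y" "u \<in> A" using uv by (auto simp: A_def)
  have RA: "R u a" if "a \<in> A" for a using that R_refl R_E uv(1) by (auto simp: A_def)
  have vA: "v \<notin> A" using RA nR by blast
  have B: "b = v \<or> E v b" if "b \<in> N y - A" for b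
  proof (rule ccontr)
    assume "\<not> (b = v \<or> E v b)"
    then show False using indep[OF uv(1,2), of b] that vA A uv unfolding A_def by blast
  qed
  have RB: "R b v" if "b \<in> N y - A" for b using B[OF that] R_refl R_E Esym uv that by blast
  have cross: "\<not> E a b" "\<not> E b a" if "a \<in> A" "b \<in> N y - A" for a b
  proof -
    show n: "\<not> E a b" using that R_trans[OF R_trans[OF RA[of a] R_E[of a b]] RB[of b]] nR A by blast
    then show "\<not> E b a" using Esym[of b a] that A by blast
  qed
  have inA: "E a b" if "a \<in> A" "b \<in> A" "a \<noteq> b" for a b
  proof (rule ccontr)
    assume "\<not> E a b"
    then show False using indep[of a b v] that A uv vA cross by blast
  qed
  have inB: "E a b" if "a \<in> N y - A" "b \<in> N y - A" "a \<noteq> b" for a b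
  proof (rule ccontr)
    assume "\<not> E a b"
    then show False using indep[of u a b] that A uv cross by blast
  qed
  have irrN: "\<not> E a a" if "a \<in> N y" for a using that irr N_V by blast
  have "two_cliques (N y) E (card A) (card (N y - A))"
    unfolding two_cliques_def
  proof (intro conjI exI[of _ A] ballI)
    fix a b assume "a \<in> N y" "b \<in> N y"
    then show "E a b \<longleftrightarrow> a \<noteq> b \<and> (a \<in> A \<longleftrightarrow> b \<in> A)"
      using inA inB cross irrN by (metis DiffI)
  qed (use A in auto)
  moreover have "finite A" using A fin_N finite_subset by blast
  then have "card A \<ge> 1" using A by (metis One_nat_def Suc_leI card_gt_0_iff empty_iff)
  moreover have "v \<in> N y - A" using uv vA by blast
  then have "card (N y - A) \<ge> 1" by (metis One_nat_def Suc_leI card_gt_0_iff empty_iff fin_N finite_Diff)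
  ultimately show ?thesis by blast
qed

end

theorem standard_classification:
  fixes V :: "'a set"
  assumes "pgraph V E" "locally_connected V E" "V \<noteq> {}" 
  shows "standard_graph V E"
  using assms
proof (induction "card V" arbitrary: V rule: less_induct)
  case less
  interpret pgraph V E by fact
  obtain x where x: "x \<in> V" using less by blast
  have cL: "connected_graph (N x) E" using less x unfolding locally_connected_def by blast
  have L: "pgraph (N x) E" by (rule local_pgraph[OF x cL])
  interpret L: pgraph "N x" E by fact
  have nf: "\<not> has_far (N x) E" by (rule local_not_far[OF x cL])
  note det = local_determines[OF less(2) _ x]
  show ?case
  proof (cases "complete_on (N x) E")
    case True
    then show ?thesis using complete_from_local[OF x] unfolding standard_graph_def by blast
  next
    case nc: False
    show ?thesis
    proof (cases "\<forall>y\<in>N x. connected_graph (L.N y) E")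
      case False
      then obtain y where y: "y \<in> N x" "\<not> connected_graph (L.N y) E" by blast
      obtain p q where pq: "1 \<le> p" "1 \<le> q" "two_cliques (L.N y) E p q"
        using L.disconnected_two_cliques[OF y(1) nf y(2)] by blast
      \<comment> \<open>A rook graph with p + 1 rows and q + 1 columns. It is determined by its
        neighbourhood of two cliques, and in turn determines the Johnson graph.\<close>
      define k n where "k = p + 1" and "n = p + q + 2"
      have kn: "1 \<le> k" "k < n" "k - 1 = p" "n - k - 1 = q" by (auto simp: k_def n_def)
      have "graph_iso (L.N y) E (nbhd (rook_V n k) rook_E (0, k)) rook_E"
        using two_cliques_iso[OF pq(3)] rook_local[OF kn(1,2)] kn by simp
      moreover have "(0, k) \<in> rook_V n k" using kn by (simp add: rook_V_def)
      ultimately have "graph_iso (N x) E (rook_V n k) rook_E"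
        using local_determines[OF L rook_pgraph[OF kn(1,2)] y(1)] by blast
      then have "graph_iso (N x) E (nbhd (johnson_V n k) sd_adj {..<k}) sd_adj"
        using rook_iso graph_iso_trans kn by (metis less_imp_le)
      moreover have "{..<k} \<in> johnson_V n k" using kn by (simp add: johnson_V_def)
      ultimately have iso: "graph_iso V E (johnson_V n k) sd_adj"
        using det[OF johnson_sd_pgraph(1)] by blast
      show ?thesis
      proof (cases "n \<ge> 5")
        case True
        have "2 \<le> k" "k + 2 \<le> n" using pq by (auto simp: k_def n_def)
        then show ?thesis using iso True unfolding standard_graph_def by blast
      next
        case False
        then have "n = 4" "k = 2" using pq by (auto simp: k_def n_def)
        then have "graph_iso V E (cocktail_V 3) cocktail_E" using iso octahedron_iso graph_iso_trans by metis
        then show ?thesis unfolding standard_graph_def by blast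
      qed
    next
      case True
      then have lc: "locally_connected (N x) E" unfolding locally_connected_def by blast
      have "card (N x) < card V" using x N_irr N_subset fin by (intro psubset_card_mono) auto
      moreover have "N x \<noteq> {}" using nc unfolding complete_on_def by blast
      ultimately have "standard_graph (N x) E" using less(1)[OF _ L lc] by blast
      then consider (cp) k where "k \<ge> 3" "graph_iso (N x) E (cocktail_V k) cocktail_E"
        | (J) n k where "2 \<le> k" "k + 2 \<le> n" "graph_iso (N x) E (johnson_V n k) sd_adj" "5 \<le> n"
        | (H) n where "n \<ge> 5" "graph_iso (N x) E (even_V n) sd_adj"
        | (S) "graph_iso (N x) E schlafli_V gosset_E"
        | (G) "graph_iso (N x) E gosset_V gosset_E"
        using nc unfolding standard_graph_def by blast
      then show ?thesis
      proof cases
        case cp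
        have "2 * k \<in> cocktail_V (Suc k)" by (simp add: cocktail_V_def)
        then have "graph_iso V E (cocktail_V (Suc k)) cocktail_E"
          using det[OF cocktail_pgraph] cp cocktail_local by fastforce
        then show ?thesis using cp unfolding standard_graph_def by (meson le_SucI)
      next
        case J
        \<comment> \<open>A neighbourhood has diameter at most 2, which leaves J(n,2) up to
          complements.\<close>
        have "\<not> (3 \<le> k \<and> k + 3 \<le> n)" using johnson_far has_far_iso[OF _ J(3)] nf by blast
        then consider "k = 2" | "n - k = 2" using J by linarith
        then have "graph_iso (N x) E (johnson_V n 2) sd_adj"
        proof cases
          case 2
          then show ?thesis using johnson_complement[of k n] J graph_iso_trans by (metis add_leD1)
        qed (use J in simp)
        moreover have "{} \<in> even_V n" by (simp add: even_V_def)
        ultimately have "graph_iso V E (even_V n) sd_adj"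
          using det[OF even_sd_pgraph(1)] even_local by metis
        then show ?thesis using J unfolding standard_graph_def by blast
      next
        case H
        have "\<not> 6 \<le> n" using even_far has_far_iso[OF _ H(2)] nf by blast
        then have "n = 5" using H by simp
        then have "graph_iso (N x) E (nbhd schlafli_V gosset_E (False, {2, 3})) gosset_E"
          using H schlafli_local graph_iso_sym graph_iso_trans by blast
        moreover have "(False, {2, 3}) \<in> schlafli_V"
          by (simp add: schlafli_V_def nbhd_def gosset_V_def gosset_E_def)
        ultimately have "graph_iso V E schlafli_V gosset_E" using det[OF schlafli_V_pgraph] by blast
        then show ?thesis unfolding standard_graph_def by blast
      next
        case S
        then have "graph_iso V E gosset_V gosset_E"
          using det[OF gosset_pgraph gosset_base] unfolding schlafli_V_def by blast
        then show ?thesis unfolding standard_graph_def by blast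
      next
        case G
        then show ?thesis using gosset_far has_far_iso nf by blast
      qed
    qed
  qed
qed

section \<open>Curvature and eigenvalues\<close>

context cgraph begin

abbreviation lap where "lap \<equiv> laplacian V E"

definition lipschitz :: "('a \<Rightarrow> real) \<Rightarrow> bool" where
  "lipschitz f \<longleftrightarrow> (\<forall>u\<in>V. \<forall>v\<in>N u. \<bar>f u - f v\<bar> \<le> 1)"

lemma lap_sum_zero: "(\<Sum>x\<in>V. lap f x) = 0"
proof -
  define g where "g x y = (if y \<in> N x then f y - f x else 0)" for x y
  have g: "g y x = - g x y" if "x \<in> V" "y \<in> V" for x y
    using that N_sym[of x y] N_sym[of y x] by (auto simp: g_def)
  have lap: "lap f x = (\<Sum>y\<in>V. g x y)" for x
    unfolding laplacian_def g_def using fin N_subset[of x] by (simp add: sum.If_cases Int_absorb1)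
  have "(\<Sum>x\<in>V. \<Sum>y\<in>V. g x y) = (\<Sum>y\<in>V. \<Sum>x\<in>V. g x y)" by (rule sum.swap)
  also have "\<dots> = (\<Sum>y\<in>V. \<Sum>x\<in>V. - g y x)" by (intro sum.cong refl g)
  also have "\<dots> = - (\<Sum>y\<in>V. \<Sum>x\<in>V. g y x)" by (simp add: sum_negf)
  finally show ?thesis unfolding lap by simp
qed

lemma lap_scale: "lap (\<lambda>v. c * f v) x = c * lap f x"
  unfolding laplacian_def by (simp add: sum_distrib_left right_diff_distrib)

lemma lap_shift: "lap (\<lambda>v. f v - c) x = lap f x"
  unfolding laplacian_def by simp

lemma grad_set: "{\<bar>f u - f v\<bar> | u v. u \<in> V \<and> v \<in> V \<and> E u v} = (\<lambda>(u, v). \<bar>f u - f v\<bar>) ` (SIGMA u:V. N u)"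
  by (auto simp: N_iff image_iff) blast+

lemma fin_grad_set: "finite ((\<lambda>(u, v). \<bar>f u - f v\<bar>) ` (SIGMA u:V. N u))"
  using fin by auto

text \<open>The edge from \<open>x\<close> to \<open>y\<close> already attains 1, so prescribing the
  maximum is the same as bounding it.\<close>

lemma lipschitz_Max:
  assumes "x \<in> V" "y \<in> N x" "f y - f x = (1::real)"
  shows "Max {\<bar>f u - f v\<bar> | u v. u \<in> V \<and> v \<in> V \<and> E u v} = 1 \<longleftrightarrow> lipschitz f"
  unfolding grad_set
proof
  assume m: "Max ((\<lambda>(u, v). \<bar>f u - f v\<bar>) ` (SIGMA u:V. N u)) = 1"
  show "lipschitz f" unfolding lipschitz_def
  proof (intro ballI)
    fix u v assume "u \<in> V" "v \<in> N u"
    then have "\<bar>f u - f v\<bar> \<in> (\<lambda>(u, v). \<bar>f u - f v\<bar>) ` (SIGMA u:V. N u)" by force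
    then show "\<bar>f u - f v\<bar> \<le> 1" using Max_ge[OF fin_grad_set] m by metis
  qed
next
  assume "lipschitz f"
  moreover have "\<bar>f x - f y\<bar> \<in> (\<lambda>(u, v). \<bar>f u - f v\<bar>) ` (SIGMA u:V. N u)" using assms by force
  moreover have "\<bar>f x - f y\<bar> = 1" using assms by simp
  ultimately show "Max ((\<lambda>(u, v). \<bar>f u - f v\<bar>) ` (SIGMA u:V. N u)) = 1"
    using fin_grad_set by (intro Max_eqI) (auto simp: lipschitz_def)
qed

lemma ollivier_alt:
  assumes "x \<in> V" "y \<in> N x"
  shows "ollivier V E x y = Inf {lap f x - lap f y | f. f y - f x = 1 \<and> lipschitz f}"
proof -
  have "{lap f x - lap f y | f. f y - f x = 1 \<and> Max {\<bar>f u - f v\<bar> | u v. u \<in> V \<and> v \<in> V \<and> E u v} = 1}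
    = {lap f x - lap f y | f. f y - f x = 1 \<and> lipschitz f}"
    using lipschitz_Max[OF assms] by blast
  then show ?thesis unfolding ollivier_def by simp
qed

lemma lap_bound: assumes "lipschitz f" "x \<in> V" shows "\<bar>lap f x\<bar> \<le> real (card (N x))"
proof -
  have "\<bar>lap f x\<bar> \<le> (\<Sum>y\<in>N x. \<bar>f y - f x\<bar>)" unfolding laplacian_def by (rule sum_abs)
  also have "\<dots> \<le> (\<Sum>y\<in>N x. 1)" using assms by (intro sum_mono) (auto simp: lipschitz_def abs_minus_commute)
  finally show ?thesis by simp
qed

lemma ollivier_le:
  assumes "x \<in> V" "y \<in> N x" "lipschitz f" "f y - f x = 1"
  shows "ollivier V E x y \<le> lap f x - lap f y"
  unfolding ollivier_alt[OF assms(1,2)]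
proof (rule cInf_lower)
  show "lap f x - lap f y \<in> {lap f x - lap f y | f. f y - f x = 1 \<and> lipschitz f}" using assms by blast
  have y: "y \<in> V" using assms N_V by blast
  \<comment> \<open>The infimum is a lower bound only if the set is bounded below; the two degrees
    provide a bound.\<close>
  show "bdd_below {lap f x - lap f y | f. f y - f x = 1 \<and> lipschitz f}"
  proof (rule bdd_belowI[of _ "- real (card (N x)) - real (card (N y))"])
    fix t assume "t \<in> {lap f x - lap f y | f. f y - f x = 1 \<and> lipschitz f}"
    then obtain g where "t = lap g x - lap g y" "lipschitz g" by blast
    then show "- real (card (N x)) - real (card (N y)) \<le> t"
      using lap_bound[of g x] lap_bound[of g y] assms(1) y by linarith
  qed
qed

lemma dist_lipschitz: "z \<in> V \<Longrightarrow> lipschitz (\<lambda>v. real (d v z))"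
  unfolding lipschitz_def
proof (intro ballI)
  fix u v assume a: "z \<in> V" "u \<in> V" "v \<in> N u"
  then show "\<bar>real (d u z) - real (d v z)\<bar> \<le> 1" using d_N_le2[of u v z] by linarith
qed

lemma ollivier_ge:
  assumes "x \<in> V" "y \<in> N x" "\<And>f. lipschitz f \<Longrightarrow> f y - f x = 1 \<Longrightarrow> K \<le> lap f x - lap f y"
  shows "K \<le> ollivier V E x y"
  unfolding ollivier_alt[OF assms(1,2)]
proof (rule cInf_greatest)
  have "real (d y x) - real (d x x) = 1" using d_N'[OF assms(1,2)] by simp
  then have "lap (\<lambda>v. real (d v x)) x - lap (\<lambda>v. real (d v x)) y \<in> {lap f x - lap f y | f. f y - f x = 1 \<and> lipschitz f}"
    using dist_lipschitz[OF assms(1)] by (intro CollectI exI[of _ "\<lambda>v. real (d v x)"] conjI refl)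
  then show "{lap f x - lap f y | f. f y - f x = 1 \<and> lipschitz f} \<noteq> {}" by (metis empty_iff)
qed (use assms(3) in blast)

lemma curv_set: "{ollivier V E x y | x y. x \<in> V \<and> y \<in> V \<and> E x y} = (\<lambda>(x, y). ollivier V E x y) ` (SIGMA u:V. N u)"
  by (auto simp: N_iff image_iff) blast+

lemma min_curv_le:
  assumes "x \<in> V" "y \<in> N x" "lipschitz f" "f y - f x = 1"
  shows "min_curv V E \<le> lap f x - lap f y"
proof -
  have "min_curv V E \<le> ollivier V E x y"
    unfolding min_curv_def curv_set using assms fin by (intro Min_le) auto
  then show ?thesis using ollivier_le[OF assms] by simp
qed

lemma min_curv_eq:
  assumes "x \<in> V" "y \<in> N x" "\<And>u v. u \<in> V \<Longrightarrow> v \<in> N u \<Longrightarrow> ollivier V E u v = K"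
  shows "min_curv V E = K"
proof -
  have "(\<lambda>(x, y). ollivier V E x y) ` (SIGMA u:V. N u) = {K}" using assms by force
  then show ?thesis unfolding min_curv_def curv_set by simp
qed

definition outer where "outer x y = N x - insert y (N y)"

lemma fin_outer [simp]: "finite (outer x y)" by (simp add: outer_def)

lemma outer_iff:
  assumes "x \<in> V" "y \<in> N x"
  shows "w \<in> outer x y \<longleftrightarrow> w \<in> N x \<and> d w y = 2"
proof (cases "w \<in> N x")
  case True
  have "y \<in> N w \<longleftrightarrow> w \<in> N y" using N_sym N_V[OF True] N_V[OF assms(2)] by blast
  then show ?thesis using d_two_iff[OF assms(1) True assms(2)] True unfolding outer_def by blast
next
  case False
  then show ?thesis unfolding outer_def by blast
qed

lemma lap_outer:
  assumes "x \<in> V" "y \<in> N x"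
  shows "lap f x = (f y - f x) + (\<Sum>w\<in>N x \<inter> N y. f w - f x) + (\<Sum>w\<in>outer x y. f w - f x)"
proof -
  have y: "y \<notin> N y" using N_irr N_V assms by blast
  have "N x = insert y ((N x \<inter> N y) \<union> outer x y)" using assms by (auto simp: outer_def)
  then have "lap f x = (\<Sum>w\<in>insert y ((N x \<inter> N y) \<union> outer x y). f w - f x)"
    unfolding laplacian_def by simp
  also have "\<dots> = (f y - f x) + (\<Sum>w\<in>(N x \<inter> N y) \<union> outer x y. f w - f x)"
    using y by (subst sum.insert) (auto simp: outer_def)
  also have "(\<Sum>w\<in>(N x \<inter> N y) \<union> outer x y. f w - f x) =
      (\<Sum>w\<in>N x \<inter> N y. f w - f x) + (\<Sum>w\<in>outer x y. f w - f x)"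
    by (rule sum.union_disjoint) (auto simp: outer_def)
  finally show ?thesis by simp
qed

text \<open>A common neighbour contributes \<open>f y - f x\<close>, and the edge itself counts from
  both ends, whence the 2. The rest is transport between the two outer neighbourhoods.\<close>

lemma lap_diff:
  assumes "x \<in> V" "y \<in> N x"
  shows "lap f x - lap f y = (real (card (N x \<inter> N y)) + 2) * (f y - f x)
    + (\<Sum>w\<in>outer x y. f w - f x) - (\<Sum>w\<in>outer y x. f w - f y)"
proof -
  have y: "y \<in> V" "x \<in> N y" using assms N_V N_sym by blast+
  have "(\<Sum>w\<in>N x \<inter> N y. f w - f x) - (\<Sum>w\<in>N y \<inter> N x. f w - f y) = (\<Sum>w\<in>N x \<inter> N y. f y - f x)"
    unfolding Int_commute[of "N y"] sum_subtractf[symmetric] by simp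
  also have "\<dots> = real (card (N x \<inter> N y)) * (f y - f x)" by simp
  finally show ?thesis unfolding lap_outer[OF assms] lap_outer[OF y] by (simp add: algebra_simps)
qed

text \<open>An eigenfunction divided by its largest gradient is a test function for an edge where
  this gradient is attained, and its Laplacian difference there is \<open>mu\<close>.\<close>

lemma lichnerowicz_bound:
  assumes "neg_lap_eigenvalue V E mu" "mu > 0"
  shows "min_curv V E \<le> mu"
proof -
  obtain f x0 where f: "x0 \<in> V" "f x0 \<noteq> 0" "\<And>x. x \<in> V \<Longrightarrow> - lap f x = mu * f x"
    using assms(1) unfolding neg_lap_eigenvalue_def by blast
  have "\<exists>u\<in>V. \<exists>v\<in>N u. f u \<noteq> f v"
  proof (rule ccontr)
    assume n: "\<not> (\<exists>u\<in>V. \<exists>v\<in>N u. f u \<noteq> f v)"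
    then have "lap f x0 = 0" unfolding laplacian_def using f(1) by simp
    then show False using f(2) f(3)[OF f(1)] assms(2) by simp
  qed
  then obtain u0 v0 where uv0: "u0 \<in> V" "v0 \<in> N u0" "f u0 \<noteq> f v0" by blast
  let ?G = "(\<lambda>(u, v). \<bar>f u - f v\<bar>) ` (SIGMA u:V. N u)"
  define M where "M = Max ?G"
  have ge: "\<bar>f u - f v\<bar> \<le> M" if "u \<in> V" "v \<in> N u" for u v
    unfolding M_def using that by (intro Max_ge[OF fin_grad_set]) force
  have Mpos: "M > 0" using ge[OF uv0(1,2)] uv0(3) by simp
  have "?G \<noteq> {}" using uv0 by blast
  then have "M \<in> ?G" unfolding M_def using Max_in[OF fin_grad_set] by blast
  then obtain u v where uv: "u \<in> V" "v \<in> N u" "\<bar>f u - f v\<bar> = M" by auto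
  obtain x y where xy: "x \<in> V" "y \<in> N x" "f y - f x = M"
  proof (cases "f v - f u = M")
    case True then show ?thesis using that uv by blast
  next
    case False
    then have "f u - f v = M" using uv(3) by linarith
    then show ?thesis using that[of v u] uv N_sym N_V by blast
  qed
  define g where "g w = (1 / M) * f w" for w
  have "lipschitz g" unfolding lipschitz_def
  proof (intro ballI)
    fix a b assume "a \<in> V" "b \<in> N a"
    then have "\<bar>f a - f b\<bar> / M \<le> 1" using ge Mpos by simp
    moreover have "\<bar>g a - g b\<bar> = \<bar>f a - f b\<bar> / M"
      unfolding g_def using Mpos by (simp add: diff_divide_distrib[symmetric])
    ultimately show "\<bar>g a - g b\<bar> \<le> 1" by simp
  qed
  moreover have "g y - g x = 1" using xy(3) Mpos by (simp add: g_def diff_divide_distrib[symmetric])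
  ultimately have "min_curv V E \<le> lap g x - lap g y" using min_curv_le[OF xy(1,2)] by blast
  also have "\<dots> = (1 / M) * (lap f x - lap f y)"
    using lap_scale[of "1 / M" f x] lap_scale[of "1 / M" f y] unfolding g_def by (simp add: algebra_simps)
  also have "lap f x - lap f y = mu * M" using f(3)[OF xy(1)] f(3)[of y] N_V[OF xy(2)] xy(3) by (simp add: algebra_simps)
  finally show ?thesis using Mpos by simp
qed

end

section \<open>Curvature and the Laplacian of distances under the parallelogram property\<close>

context pgraph begin

lemma card_N_const: "x \<in> V \<Longrightarrow> y \<in> V \<Longrightarrow> card (N x) = card (N y)"
proof (rule connected_induct[of x "\<lambda>y. card (N x) = card (N y)" y])
  fix u v assume a: "u \<in> V" "v \<in> N u" "card (N x) = card (N u)"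
  have "inj_on (\<sigma> u v) (N u)" using \<sigma>_bij[OF a(1,2)] N_subset bij_betw_imp_inj_on inj_on_subset by metis
  then have "card (\<sigma> u v ` N u) = card (N u)" by (rule card_image)
  then show "card (N x) = card (N v)" using \<sigma>_image_N[OF a(1,2,1)] \<sigma>_x[OF a(1,2)] a(3) by simp
qed auto

lemma \<sigma>_inj: "x \<in> V \<Longrightarrow> y \<in> N x \<Longrightarrow> S \<subseteq> V \<Longrightarrow> inj_on (\<sigma> x y) S"
  using \<sigma>_bij bij_betw_imp_inj_on inj_on_subset by metis

lemma r_eq_0: "x \<in> V \<Longrightarrow> y \<in> N x \<Longrightarrow> z \<in> N x \<Longrightarrow> z \<in> N y \<Longrightarrow> r x y z = 0"
  using d_N[of x z] d_N[of y z] N_V[of y x] by (simp add: r_def)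

text \<open>For adjacent \<open>u\<close> and \<open>v\<close> in \<open>N x\<close> the reflection
  from \<open>u\<close> to \<open>v\<close> fixes \<open>x\<close>, so it maps the common neighbours
  of \<open>x\<close> and \<open>u\<close> to those of \<open>x\<close> and \<open>v\<close>. Local
  connectedness spreads the number over the edges at \<open>x\<close>, and the symmetry of an edge
  carries it to the next vertex.\<close>

lemma card_common_const:
  assumes "locally_connected V E"
  shows "\<exists>a. \<forall>x\<in>V. \<forall>y\<in>N x. card (N x \<inter> N y) = a"
proof -
  have loc: "card (N x \<inter> N y) = card (N x \<inter> N z)" if xyz: "x \<in> V" "y \<in> N x" "z \<in> N x" for x y z
  proof -
    have "connected_graph (N x) E" using assms xyz unfolding locally_connected_def by blast
    then interpret L: cgraph "N x" E using local_cgraph xyz by blast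
    show ?thesis
    proof (rule L.connected_induct[of y "\<lambda>z. card (N x \<inter> N y) = card (N x \<inter> N z)" z])
      fix u v assume a: "u \<in> N x" "v \<in> L.N u" "card (N x \<inter> N y) = card (N x \<inter> N u)"
      then have uv: "u \<in> V" "v \<in> N u" "v \<in> N x" "x \<in> N u" "x \<in> N v" using N_V N_sym xyz nbhd_local by blast+
      have fx: "\<sigma> u v x = x" using \<sigma>_fix[OF uv(1,2) xyz(1)] r_eq_0[OF uv(1,2,4,5)] by simp
      have "\<sigma> u v ` (N x \<inter> N u) = N x \<inter> N v"
        using inj_on_image_Int[OF \<sigma>_inj[OF uv(1,2) order_refl], of "N x" "N u"] N_subset
          \<sigma>_image_N[OF uv(1,2) xyz(1)] \<sigma>_image_N[OF uv(1,2,1)] \<sigma>_x[OF uv(1,2)] fx by simp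
      moreover have "inj_on (\<sigma> u v) (N x \<inter> N u)" using N_subset[of x] by (intro \<sigma>_inj[OF uv(1,2)]) blast
      ultimately have "card (N x \<inter> N u) = card (N x \<inter> N v)"
        using card_image[of "\<sigma> u v" "N x \<inter> N u"] by simp
      then show "card (N x \<inter> N y) = card (N x \<inter> N v)" using a by simp
    qed (use xyz in auto)
  qed
  show ?thesis
  proof (cases "V = {}")
    case False
    then obtain x0 where x0: "x0 \<in> V" by blast
    show ?thesis
    proof (cases "N x0 = {}")
      case True
      then have "N x = {}" if "x \<in> V" for x using card_N_const[OF that x0] by simp
      then show ?thesis by blast
    next
      case False
      then obtain y0 where y0: "y0 \<in> N x0" by blast
      have "\<forall>y\<in>N x. card (N x \<inter> N y) = card (N x0 \<inter> N y0)" if "x \<in> V" for x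
      proof (rule connected_induct[of x0 "\<lambda>x. \<forall>y\<in>N x. card (N x \<inter> N y) = card (N x0 \<inter> N y0)" x])
        show "\<forall>y\<in>N x0. card (N x0 \<inter> N y) = card (N x0 \<inter> N y0)" using loc[OF x0 _ y0] by blast
        fix u v assume a: "u \<in> V" "v \<in> N u" "\<forall>y\<in>N u. card (N u \<inter> N y) = card (N x0 \<inter> N y0)"
        have v: "v \<in> V" "u \<in> N v" using a N_V N_sym by blast+
        have "card (N v \<inter> N u) = card (N x0 \<inter> N y0)" using a(3)[rule_format, OF a(2)] by (simp add: Int_commute)
        then show "\<forall>y\<in>N v. card (N v \<inter> N y) = card (N x0 \<inter> N y0)" using loc[OF v(1) _ v(2)] by simp
      qed (use x0 that in auto)
      then show ?thesis by blast
    qed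
  qed auto
qed

text \<open>The reflection is a perfect matching of the outer neighbourhoods, hence an explicit
  transport plan.\<close>

lemma \<sigma>_outer: assumes "x \<in> V" "y \<in> N x" shows "bij_betw (\<sigma> x y) (outer x y) (outer y x)"
proof -
  have V: "y \<in> V" "x \<in> N y" using assms N_V N_sym by blast+
  have sx: "\<sigma> x y x = y" "\<sigma> x y y = x" using \<sigma>_x[OF assms] \<sigma>_invol[OF assms assms(1)] by auto
  have sub: "N x \<subseteq> V" "insert y (N y) \<subseteq> V" using N_subset V by blast+
  have "\<sigma> x y ` outer x y = \<sigma> x y ` N x - \<sigma> x y ` insert y (N y)"
    unfolding outer_def by (rule inj_on_image_set_diff[OF \<sigma>_inj[OF assms order_refl]]) (use sub in auto)
  also have "\<dots> = outer y x"
    unfolding outer_def image_insert \<sigma>_image_N[OF assms assms(1)] \<sigma>_image_N[OF assms V(1)] sx ..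
  finally show ?thesis using \<sigma>_inj[OF assms, of "outer x y"] sub unfolding bij_betw_def outer_def by blast
qed

lemma lap_diff_\<sigma>:
  assumes "x \<in> V" "y \<in> N x"
  shows "lap f x - lap f y = (real (card (N x \<inter> N y)) + 2) * (f y - f x)
    + (\<Sum>w\<in>outer x y. f w - f (\<sigma> x y w) + (f y - f x))"
proof -
  have "(\<Sum>w\<in>outer y x. f w - f y) = (\<Sum>w\<in>outer x y. f (\<sigma> x y w) - f y)"
    using sum.reindex_bij_betw[OF \<sigma>_outer[OF assms], of "\<lambda>w. f w - f y"] by simp
  then have "(\<Sum>w\<in>outer x y. f w - f x) - (\<Sum>w\<in>outer y x. f w - f y)
     = (\<Sum>w\<in>outer x y. f w - f (\<sigma> x y w) + (f y - f x))"
    by (simp add: sum.distrib sum_subtractf right_diff_distrib)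
  then show ?thesis unfolding lap_diff[OF assms] by simp
qed

lemma outer_r: "x \<in> V \<Longrightarrow> y \<in> N x \<Longrightarrow> w \<in> outer x y \<Longrightarrow> w \<in> V \<and> r x y w = -1 \<and> \<sigma> x y w \<in> N w"
proof -
  assume a: "x \<in> V" "y \<in> N x" "w \<in> outer x y"
  then have w: "w \<in> N x" "d w y = 2" using outer_iff by blast+
  have V: "w \<in> V" "y \<in> V" using w a N_V by blast+
  have r: "r x y w = -1" using w d_N[OF a(1) w(1)] d_sym[OF V] by (simp add: r_def)
  have "int (d (\<sigma> x y w) w) = 1" using d_\<sigma>[OF a(1,2) V(1) V(1)] r V by simp
  then have "\<sigma> x y w \<in> N w"
    using d_eq_1[of w "\<sigma> x y w"] d_sym[of w "\<sigma> x y w"] V \<sigma>_V[OF a(1,2) V(1)] by simp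
  then show ?thesis using V r by blast
qed

text \<open>Outer neighbours of \<open>x\<close> pair to -1 with the root, so the distance to
  \<open>z\<close> changes across each matched pair exactly as across the edge, and the matched
  terms cancel.\<close>

lemma lap_dist_diff:
  assumes "x \<in> V" "y \<in> N x" "z \<in> V"
  defines "f \<equiv> \<lambda>v. real (d v z)"
  shows "lap f x - lap f y = (real (card (N x \<inter> N y)) + 2) * (f y - f x)"
proof -
  have "f w - f (\<sigma> x y w) + (f y - f x) = 0" if "w \<in> outer x y" for w
  proof -
    have w: "w \<in> V" "r x y w = -1" using outer_r[OF assms(1,2) that] by blast+
    have "int (d (\<sigma> x y w) z) = int (d w z) - (int (d x z) - int (d y z))"
      using d_\<sigma>[OF assms(1,2) w(1) assms(3)] w(2) by (simp add: r_def)
    then show ?thesis unfolding f_def by linarith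
  qed
  then show ?thesis unfolding lap_diff_\<sigma>[OF assms(1,2)] by simp
qed

text \<open>Matched outer vertices are adjacent, so each pair contributes at least 0 for every test
  function; the distance to \<open>x\<close> attains the bound.\<close>

lemma ollivier_pgraph:
  assumes "x \<in> V" "y \<in> N x"
  shows "ollivier V E x y = real (card (N x \<inter> N y)) + 2"
proof (rule antisym)
  have "real (d y x) - real (d x x) = 1" using d_N'[OF assms(1,2)] by simp
  then show "ollivier V E x y \<le> real (card (N x \<inter> N y)) + 2"
    using ollivier_le[OF assms dist_lipschitz[OF assms(1)]] lap_dist_diff[OF assms assms(1)] by simp
  show "real (card (N x \<inter> N y)) + 2 \<le> ollivier V E x y"
  proof (rule ollivier_ge[OF assms])
    fix f assume f: "lipschitz f" "f y - f x = 1"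
    have "(\<Sum>w\<in>outer x y. f w - f (\<sigma> x y w) + (f y - f x)) \<ge> 0"
    proof (rule sum_nonneg)
      fix w assume "w \<in> outer x y"
      then have "\<bar>f w - f (\<sigma> x y w)\<bar> \<le> 1" using outer_r[OF assms] f(1) unfolding lipschitz_def by blast
      then show "0 \<le> f w - f (\<sigma> x y w) + (f y - f x)" using f(2) by linarith
    qed
    then show "real (card (N x \<inter> N y)) + 2 \<le> lap f x - lap f y" unfolding lap_diff_\<sigma>[OF assms] using f(2) by simp
  qed
qed

lemma lap_dist:
  assumes a: "\<And>x y. x \<in> V \<Longrightarrow> y \<in> N x \<Longrightarrow> card (N x \<inter> N y) = a" and z: "z \<in> V" and v: "v \<in> V"
  shows "lap (\<lambda>v. real (d v z)) v = real (card (N z)) - (real a + 2) * real (d v z)"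
proof -
  let ?f = "\<lambda>v. real (d v z)"
  show ?thesis
  proof (rule connected_induct[of z "\<lambda>v. lap ?f v = real (card (N z)) - (real a + 2) * ?f v" v])
    have "lap ?f z = (\<Sum>w\<in>N z. 1)" unfolding laplacian_def using d_N'[OF z] by (intro sum.cong) auto
    then show "lap ?f z = real (card (N z)) - (real a + 2) * ?f z" by simp
    fix u v assume uv: "u \<in> V" "v \<in> N u" "lap ?f u = real (card (N z)) - (real a + 2) * ?f u"
    then show "lap ?f v = real (card (N z)) - (real a + 2) * ?f v"
      using lap_dist_diff[OF uv(1,2) z] a[OF uv(1,2)] by (simp add: algebra_simps)
  qed (use z v in auto)
qed

context
  assumes lc: "locally_connected V E" and edge: "\<exists>x\<in>V. N x \<noteq> {}"
begin

text \<open>Summing \<Delta> d(z,v) = D - K d(z,v) over v gives the average distance D / K, and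
  subtracting this constant from the distance leaves an eigenfunction for K. By
  \<open>lichnerowicz_bound\<close> no positive eigenvalue is smaller.\<close>

lemma sharp_pgraph: "eff_BM_sharp V E" "lichnerowicz_sharp V E"
proof -
  obtain x0 y0 where x0: "x0 \<in> V" "y0 \<in> N x0" using edge by blast
  obtain a where a: "\<And>x y. x \<in> V \<Longrightarrow> y \<in> N x \<Longrightarrow> card (N x \<inter> N y) = a"
    using card_common_const[OF lc] by blast
  define D where "D = card (N x0)"
  have D: "card (N x) = D" if "x \<in> V" for x unfolding D_def using card_N_const[OF that x0(1)] .
  have Dpos: "D > 0" unfolding D_def using x0 by (auto simp: card_gt_0_iff)
  define K where "K = real a + 2"
  have Kpos: "K > 0" by (simp add: K_def)
  have mc: "min_curv V E = K"
    by (rule min_curv_eq[OF x0]) (simp add: ollivier_pgraph a K_def)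
  have lap: "lap (\<lambda>v. real (d v z)) v = real D - K * real (d v z)" if "z \<in> V" "v \<in> V" for z v
    using lap_dist[OF a that] D[OF that(1)] by (simp add: K_def)
  have cpos: "card V > 0" using x0 fin by (auto simp: card_gt_0_iff)
  have sumd: "(\<Sum>v\<in>V. real (d v z)) = real (card V) * real D / K" if "z \<in> V" for z
  proof -
    have "0 = (\<Sum>v\<in>V. real D - K * real (d v z))"
      using lap_sum_zero[of "\<lambda>v. real (d v z)"] lap[OF that] by simp
    also have "\<dots> = real (card V) * real D - K * (\<Sum>v\<in>V. real (d v z))"
      by (simp add: sum_subtractf sum_distrib_left)
    finally show ?thesis using Kpos by (simp add: field_simps)
  qed
  have "(\<Sum>x\<in>V. \<Sum>y\<in>V. real (d x y)) = (\<Sum>x\<in>V. real (card V) * real D / K)"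
    using sumd d_sym by (intro sum.cong refl) (metis (no_types, lifting) sum.cong)
  then have "diam_eff V E = real D / K" unfolding diam_eff_def using cpos by (simp add: power2_eq_square)
  moreover have "max_deg V E = D"
  proof -
    have "Deg V E ` V = {D}" using D x0 by (auto simp: Deg_def)
    then show ?thesis unfolding max_deg_def by simp
  qed
  ultimately show "eff_BM_sharp V E" unfolding eff_BM_sharp_def mc using Kpos by simp
  have "neg_lap_eigenvalue V E K" unfolding neg_lap_eigenvalue_def
  proof (intro exI[of _ "\<lambda>v. real (d v x0) - real D / K"] conjI ballI bexI[of _ x0])
    show "real (d x0 x0) - real D / K \<noteq> 0" using Dpos Kpos by simp
    show "- lap (\<lambda>v. real (d v x0) - real D / K) x = K * (real (d x x0) - real D / K)" if "x \<in> V" for x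
      unfolding lap_shift lap[OF x0(1) that] using Kpos by (simp add: field_simps)
  qed (use x0 in auto)
  then show "lichnerowicz_sharp V E"
    unfolding lichnerowicz_sharp_def using Kpos mc lichnerowicz_bound by metis
qed

end

end

section \<open>Distance regularity\<close>

text \<open>In closed form n + m * n * (n - 1) / 2; here m will be the number of common neighbours
  inside \<open>N x\<close> of two non-adjacent neighbours of \<open>x\<close>.\<close>

primrec c_num :: "nat \<Rightarrow> nat \<Rightarrow> nat" where
  "c_num m 0 = 0"
| "c_num m (Suc n) = c_num m n + 1 + n * m"

context pgraph begin

definition common_local :: "'a \<Rightarrow> nat \<Rightarrow> bool" where
  "common_local x m \<longleftrightarrow> (\<forall>u\<in>N x. \<forall>w\<in>N x. u \<noteq> w \<longrightarrow> w \<notin> N u \<longrightarrow> card (N x \<inter> N u \<inter> N w) = m)"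

definition common2 :: "'a \<Rightarrow> nat \<Rightarrow> bool" where
  "common2 y m \<longleftrightarrow> (\<forall>u\<in>V. d y u = 2 \<longrightarrow> card (N u \<inter> N y) = m)"

text \<open>Here \<open>p\<close> is the reflection of a vertex \<open>q\<close> one step closer to
  \<open>x\<close>. The coordinate at \<open>w\<close> grows by 2, 1 or 0 according to whether
  \<open>w\<close> is \<open>v\<close>, adjacent to \<open>v\<close>, or orthogonal to it.\<close>

lemma descend:
  assumes x: "x \<in> V" and p: "p \<in> V" "d x p = Suc n"
  obtains v q where "v \<in> N x" "q \<in> V" "d x q = n" "r x v q = -1"
    "\<And>w. w \<in> N x \<Longrightarrow> r x w p = r x w q + (2 - int (d v w))"
proof -
  obtain v where v: "v \<in> N x" "r x v p = 1" "d x (\<sigma> x v p) = n" using r_ex[OF x p] .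
  define q where "q = \<sigma> x v p"
  have q: "q \<in> V" "d x q = n" using \<sigma>_V[OF x v(1) p(1)] v by (simp_all add: q_def)
  have rq: "r x v q = -1" using r_\<sigma>[OF x v(1) p(1)] v by (simp add: q_def)
  have pq: "p = \<sigma> x v q" using \<sigma>_invol[OF x v(1) p(1)] by (simp add: q_def)
  have "r x w p = r x w q + (2 - int (d v w))" if "w \<in> N x" for w
    using r_act[OF x v(1) that q(1)] rq pq by simp
  then show ?thesis using that v q rq by blast
qed

lemma d_local_le2: "x \<in> V \<Longrightarrow> u \<in> N x \<Longrightarrow> v \<in> N x \<Longrightarrow> d u v \<le> 2"
  using d_two_iff[of x u v] d_N[of u v] N_V[of u x] by (cases "u = v"; cases "v \<in> N u") auto

text \<open>Coordinates only grow on the way out from \<open>x\<close>, so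
  \<open>r x y p = -1\<close> forces every root \<open>v\<close> on the way to be orthogonal to
  \<open>y\<close>. Each of the \<open>n\<close> steps then adds 1 for each of the \<open>m\<close>
  common neighbours of \<open>v\<close> and \<open>y\<close> in \<open>N x\<close>.\<close>

lemma r_sum:
  assumes x: "x \<in> V" and m: "common_local x m"
  shows "p \<in> V \<Longrightarrow> d x p = n \<Longrightarrow> y \<in> N x \<Longrightarrow> r x y p = -1 \<Longrightarrow> (\<Sum>w\<in>N x \<inter> N y. r x w p + 1) = int (n * m)"
proof (induction n arbitrary: p)
  case 0
  then have "p = x" using x by simp
  then have "(\<Sum>w\<in>N x \<inter> N y. r x w p + 1) = (\<Sum>w\<in>N x \<inter> N y. 0)"
    using r_self(1)[OF x] by (intro sum.cong) auto
  then show ?case by simp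
next
  case (Suc n)
  obtain v q where v: "v \<in> N x" "q \<in> V" "d x q = n" "r x v q = -1"
    and act: "\<And>w. w \<in> N x \<Longrightarrow> r x w p = r x w q + (2 - int (d v w))"
    using descend[OF x Suc(2,3)] by metis
  have V: "v \<in> V" "y \<in> V" using v Suc N_V by blast+
  have "r x y q + (2 - int (d v y)) = -1" using act[OF Suc(4)] Suc(5) by simp
  moreover have "r x y q \<ge> -1" using r_cases[OF x Suc(4) v(2)] by auto
  moreover have "d v y \<le> 2" using d_local_le2[OF x v(1) Suc(4)] .
  ultimately have ry: "r x y q = -1" and dvy: "d v y = 2" by linarith+
  have vy: "v \<noteq> y" "y \<notin> N v" using dvy d_two_iff[OF x v(1) Suc(4)] by blast+
  have "(\<Sum>w\<in>N x \<inter> N y. r x w p + 1) = (\<Sum>w\<in>N x \<inter> N y. (r x w q + 1) + (2 - int (d v w)))"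
    using act by (intro sum.cong) auto
  also have "\<dots> = (\<Sum>w\<in>N x \<inter> N y. r x w q + 1) + (\<Sum>w\<in>N x \<inter> N y. 2 - int (d v w))"
    by (rule sum.distrib)
  also have "(\<Sum>w\<in>N x \<inter> N y. r x w q + 1) = int (n * m)" by (rule Suc.IH[OF v(2,3) Suc(4) ry])
  also have "(\<Sum>w\<in>N x \<inter> N y. 2 - int (d v w)) = (\<Sum>w\<in>N x \<inter> N y. if w \<in> N v then 1 else 0)"
  proof (rule sum.cong)
    fix w assume w: "w \<in> N x \<inter> N y"
    then have "w \<noteq> v" using vy N_sym[OF V(2)] by blast
    then show "2 - int (d v w) = (if w \<in> N v then 1 else 0)"
      using d_two[OF x v(1), of w] d_N[OF V(1), of w] w by auto
  qed simp
  also have "\<dots> = int (card (N x \<inter> N y \<inter> N v))" by (simp add: sum.If_cases)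
  also have "N x \<inter> N y \<inter> N v = N x \<inter> N v \<inter> N y" by blast
  also have "card (N x \<inter> N v \<inter> N y) = m" using m v Suc(4) vy unfolding common_local_def by blast
  finally show ?case by simp
qed

lemma closer_r: "x \<in> V \<Longrightarrow> {w \<in> N x. d w p + 1 = d x p} = {w \<in> N x. r x w p = 1}"
  by (auto simp: r_def)

text \<open>From \<open>q\<close> to \<open>p\<close>, the coordinate becomes 1 at \<open>v\<close>
  itself and at those neighbours of \<open>v\<close> where it was 0. On
  \<open>N x \<inter> N v\<close> the coordinates of \<open>q\<close> are -1 or 0, so
  \<open>r_sum\<close> counts the latter.\<close>

lemma c_count:
  assumes x: "x \<in> V" and m: "common_local x m"
  shows "p \<in> V \<Longrightarrow> d x p = n \<Longrightarrow> card {w \<in> N x. d w p + 1 = d x p} = c_num m n"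
  unfolding closer_r[OF x]
proof (induction n arbitrary: p)
  case 0
  then have "p = x" using x by simp
  then have "{w \<in> N x. r x w p = 1} = {}" using r_self(1)[OF x] by force
  then show ?case by simp
next
  case (Suc n)
  obtain v q where v: "v \<in> N x" "q \<in> V" "d x q = n" "r x v q = -1"
    and act: "\<And>w. w \<in> N x \<Longrightarrow> r x w p = r x w q + (2 - int (d v w))"
    using descend[OF x Suc(2,3)] by metis
  have V: "v \<in> V" using v N_V by blast
  have ge: "r x w q \<in> {-1, 0, 1}" "r x w p \<in> {-1, 0, 1}" if "w \<in> N x" for w
    using r_cases[OF x that v(2)] r_cases[OF x that Suc(2)] by auto
  have rv: "r x v p = 1" using act[OF v(1)] v(4) by simp
  have rN: "r x w p = r x w q + 1" if "w \<in> N x" "w \<in> N v" for w using act that d_N[OF V] by simp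
  have rO: "r x w p = r x w q" if "w \<in> N x" "w \<notin> N v" "w \<noteq> v" for w
    using act[OF that(1)] d_two[OF x v(1) that(1)] that by simp
  let ?A = "{w \<in> N x. r x w q = 1}" and ?B = "{w \<in> N x \<inter> N v. r x w q = 0}"
  have nv: "v \<notin> N v" using N_irr V by blast
  \<comment> \<open>A neighbour of \<open>v\<close> with coordinate 1 at \<open>q\<close> would have
    coordinate 2 at \<open>p\<close>.\<close>
  have nA: "w \<notin> N v" if "w \<in> ?A" for w using that rN[of w] ge(2)[of w] by auto
  have "{w \<in> N x. r x w p = 1} = insert v (?A \<union> ?B)"
  proof (rule set_eqI)
    fix w
    show "w \<in> {w \<in> N x. r x w p = 1} \<longleftrightarrow> w \<in> insert v (?A \<union> ?B)"
    proof (cases "w \<in> N x")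
      case True
      consider "w = v" | "w \<in> N v" "w \<noteq> v" | "w \<notin> N v" "w \<noteq> v" by blast
      then show ?thesis
      proof cases
        case 1 then show ?thesis using rv v by simp
      next
        case 2 then show ?thesis using rN[OF True 2(1)] nA[of w] True by auto
      next
        case 3 then show ?thesis using rO[OF True 3] True by auto
      qed
    qed (use v in auto)
  qed
  moreover have "card (insert v (?A \<union> ?B)) = card ?A + card ?B + 1"
  proof -
    have "card (insert v (?A \<union> ?B)) = card (?A \<union> ?B) + 1"
      using v nv by (subst card_insert_disjoint) auto
    also have "card (?A \<union> ?B) = card ?A + card ?B" by (intro card_Un_disjoint) auto
    finally show ?thesis by simp
  qed
  moreover have "card ?A = c_num m n" using Suc.IH[OF v(2,3)] .
  moreover have "card ?B = n * m"
  proof -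
    have "int (card ?B) = (\<Sum>w\<in>N x \<inter> N v. if r x w q = 0 then 1 else 0)"
      by (simp add: sum.If_cases Int_def)
    also have "\<dots> = (\<Sum>w\<in>N x \<inter> N v. r x w q + 1)"
    proof (rule sum.cong)
      fix w assume "w \<in> N x \<inter> N v"
      then show "(if r x w q = 0 then 1 else 0) = r x w q + 1" using rN[of w] ge[of w] by auto
    qed simp
    also have "\<dots> = int (n * m)" by (rule r_sum[OF x m v(2,3,1,4)])
    finally show ?thesis by (simp only: of_nat_eq_iff)
  qed
  ultimately show ?case by simp
qed

lemma common_local_transfer: assumes "u \<in> V" "v \<in> N u" "common_local u m" shows "common_local v m"
  unfolding common_local_def
proof (intro ballI impI)
  fix a b assume ab: "a \<in> N v" "b \<in> N v" "a \<noteq> b" "b \<notin> N a"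
  have im: "N v = \<sigma> u v ` N u" using \<sigma>_image_N[OF assms(1,2,1)] \<sigma>_x[OF assms(1,2)] by simp
  then obtain a' b' where a': "a' \<in> N u" "b' \<in> N u" "a = \<sigma> u v a'" "b = \<sigma> u v b'" using ab by blast
  have V: "a' \<in> V" "b' \<in> V" using a' N_V by blast+
  have ne: "a' \<noteq> b'" "b' \<notin> N a'" using ab a' \<sigma>_N[OF assms(1,2) V] by auto
  have "N v \<inter> N a \<inter> N b = \<sigma> u v ` (N u \<inter> N a' \<inter> N b')"
    unfolding im a'(3,4) \<sigma>_image_N[OF assms(1,2) V(1), symmetric] \<sigma>_image_N[OF assms(1,2) V(2), symmetric]
    using inj_on_image_Int[OF \<sigma>_inj[OF assms(1,2) order_refl]] N_subset by (metis inf.coboundedI1)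
  moreover have "inj_on (\<sigma> u v) (N u \<inter> N a' \<inter> N b')" using N_subset[of u] by (intro \<sigma>_inj[OF assms(1,2)]) blast
  ultimately have "card (N v \<inter> N a \<inter> N b) = card (N u \<inter> N a' \<inter> N b')"
    using card_image[of "\<sigma> u v" "N u \<inter> N a' \<inter> N b'"] by simp
  also have "\<dots> = m" using assms(3) a' ne unfolding common_local_def by blast
  finally show "card (N v \<inter> N a \<inter> N b) = m" .
qed

lemma common2_transfer: assumes "u \<in> V" "v \<in> N u" "common2 u m" shows "common2 v m"
  unfolding common2_def
proof (intro ballI impI)
  fix a assume a: "a \<in> V" "d v a = 2"
  define a' where "a' = \<sigma> u v a"
  have a': "a' \<in> V" "a = \<sigma> u v a'" using \<sigma>_V[OF assms(1,2) a(1)] \<sigma>_invol[OF assms(1,2) a(1)] by (simp_all add: a'_def)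
  have "d u a' = 2" using \<sigma>_isom[OF assms(1,2,1) a'(1)] \<sigma>_x[OF assms(1,2)] a a' by simp
  then have "card (N a' \<inter> N u) = m" using assms(3) a' unfolding common2_def by blast
  moreover have "N a \<inter> N v = \<sigma> u v ` (N a' \<inter> N u)"
    using inj_on_image_Int[OF \<sigma>_inj[OF assms(1,2) order_refl], of "N a'" "N u"] N_subset
      \<sigma>_image_N[OF assms(1,2) a'(1)] \<sigma>_image_N[OF assms(1,2,1)] \<sigma>_x[OF assms(1,2)] a' by simp
  moreover have "inj_on (\<sigma> u v) (N a' \<inter> N u)" using N_subset[of u] by (intro \<sigma>_inj[OF assms(1,2)]) blast
  ultimately show "card (N a \<inter> N v) = m" using card_image[of "\<sigma> u v" "N a' \<inter> N u"] by simp
qed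

text \<open>The formula for \<Delta> d(y,u), read at distance 2. No vertex is farther from
  \<open>y\<close>, so exactly the common neighbours contribute, each with -1.\<close>

lemma diam2_card_common:
  assumes far: "\<not> has_far V E" and a: "\<And>x y. x \<in> V \<Longrightarrow> y \<in> N x \<Longrightarrow> card (N x \<inter> N y) = a"
    and yu: "y \<in> V" "u \<in> V" "d y u = 2"
  shows "int (card (N u \<inter> N y)) = 2 * (int a + 2) - int (card (N y))"
proof -
  have n3: "d u v \<le> 2" if uv: "u \<in> V" "v \<in> V" for u v
  proof (rule ccontr)
    assume "\<not> d u v \<le> 2"
    then have ne: "d u v > 2" by simp
    then have "u \<noteq> v" "\<not> E u v" using d_eq_1[OF uv] uv by (auto simp: N_iff)
    then obtain w where "w \<in> V" "E u w" "E w v" using far uv unfolding has_far_def by blast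
    then have "w \<in> N u" "v \<in> N w" using uv by (simp_all add: N_iff)
    then show False using d_triangle[OF uv(1) \<open>w \<in> V\<close> uv(2)] d_N[OF uv(1)] d_N[OF \<open>w \<in> V\<close>] ne by simp
  qed
  have duy: "d u y = 2" using d_sym yu by simp
  then have y: "y \<notin> N u" using d_eq_1[of u y] yu by simp
  have "laplacian V E (\<lambda>v. real (d v y)) u = (\<Sum>w\<in>N u. if w \<in> N y then -1 else 0)"
    unfolding laplacian_def
  proof (rule sum.cong)
    fix w assume w: "w \<in> N u"
    have "w \<in> V" "w \<noteq> y" using w N_V y by blast+
    then have "d w y \<le> 2" "d w y \<noteq> 0" "d w y = 1 \<longleftrightarrow> w \<in> N y"
      using n3[of w y] d_eq_1[of y w] d_sym[of w y] yu by simp_all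
    then have "d w y = (if w \<in> N y then 1 else 2)" by presburger
    then show "real (d w y) - real (d u y) = (if w \<in> N y then -1 else 0)" using duy by simp
  qed simp
  also have "\<dots> = - real (card (N u \<inter> N y))" by (simp add: sum.If_cases)
  finally have "real (card (N u \<inter> N y)) = 2 * (real a + 2) - real (card (N y))"
    using lap_dist[OF a yu(1,2)] duy by simp
  then have "real_of_int (int (card (N u \<inter> N y))) = real_of_int (2 * (int a + 2) - int (card (N y)))" by simp
  then show ?thesis by (simp only: of_int_eq_iff)
qed

text \<open>Meant for neighbourhoods, which may fail to be locally connected. If they are, the
  Laplacian gives the number; otherwise some neighbourhood consists of two cliques, so
  \<open>m = 0\<close> in \<open>c_count\<close>, and the number is 2 as in a rook graph.\<close>

lemma common2_exists:
  assumes far: "\<not> has_far V E"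
  shows "\<exists>m. \<forall>y\<in>V. common2 y m"
proof (cases "\<forall>y\<in>V. connected_graph (N y) E")
  case True
  then have lc: "locally_connected V E" unfolding locally_connected_def by blast
  obtain a where a: "\<And>x y. x \<in> V \<Longrightarrow> y \<in> N x \<Longrightarrow> card (N x \<inter> N y) = a"
    using card_common_const[OF lc] by blast
  have key: "int (card (N u \<inter> N y)) = 2 * (int a + 2) - int (card (N y))"
    if "y \<in> V" "u \<in> V" "d y u = 2" for y u
    by (rule diam2_card_common[OF far _ that]) (rule a)
  show ?thesis
  proof (cases "\<exists>y0 u0. y0 \<in> V \<and> u0 \<in> V \<and> d y0 u0 = 2")
    case True
    then obtain y0 u0 where y0: "y0 \<in> V" "u0 \<in> V" "d y0 u0 = 2" by blast
    have "common2 y (card (N u0 \<inter> N y0))" if "y \<in> V" for y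
      unfolding common2_def using key[OF y0] key[OF that] card_N_const[OF that y0(1)] by force
    then show ?thesis by blast
  next
    case False
    then show ?thesis unfolding common2_def by blast
  qed
next
  case False
  then obtain y0 where y0: "y0 \<in> V" "\<not> connected_graph (N y0) E" by blast
  then obtain p q where "two_cliques (N y0) E p q" using disconnected_two_cliques[OF _ far] by blast
  then obtain A where A: "A \<subseteq> N y0" "\<And>u v. u \<in> N y0 \<Longrightarrow> v \<in> N y0 \<Longrightarrow> E u v \<longleftrightarrow> u \<noteq> v \<and> (u \<in> A \<longleftrightarrow> v \<in> A)"
    unfolding two_cliques_def by blast
  have "common_local y0 0" unfolding common_local_def
  proof (intro ballI impI)
    fix u w assume uw: "u \<in> N y0" "w \<in> N y0" "u \<noteq> w" "w \<notin> N u"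
    then have n: "\<not> E u w" using N_V by (auto simp: N_iff)
    have "N y0 \<inter> N u \<inter> N w = {}"
    proof (rule equals0I)
      fix z assume "z \<in> N y0 \<inter> N u \<inter> N w"
      then have "z \<in> N y0" "E u z" "E w z" by (auto simp: N_iff)
      then show False using A(2)[OF uw(1), of z] A(2)[OF uw(2), of z] A(2)[OF uw(1,2)] n uw by blast
    qed
    then show "card (N y0 \<inter> N u \<inter> N w) = 0" by simp
  qed
  note cc = c_count[OF y0(1) this]
  have "common2 y0 2" unfolding common2_def
  proof (intro ballI impI)
    fix u assume u: "u \<in> V" "d y0 u = 2"
    have "{w \<in> N y0. d w u + 1 = d y0 u} = N u \<inter> N y0"
      using u d_eq_1[OF u(1)] d_sym[OF u(1)] N_V by (auto simp: numeral_2_eq_2)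
    moreover have "c_num 0 2 = 2" by (simp add: numeral_2_eq_2)
    ultimately show "card (N u \<inter> N y0) = 2" using cc[OF u] by simp
  qed
  then have "common2 y 2" if "y \<in> V" for y
    using connected_induct[of y0 "\<lambda>y. common2 y 2" y] common2_transfer y0(1) that by blast
  then show ?thesis by blast
qed

text \<open>\<open>c_count\<close> gives c_n, and the Laplacian of the distance gives b_n - c_n = D
  - (a + 2) n. The truncation by \<open>nat\<close> is exact at every n that occurs as a
  distance.\<close>

theorem distance_regular_pgraph:
  assumes lc: "locally_connected V E"
  shows "distance_regular V E"
proof (cases "V = {}")
  case True
  then show ?thesis unfolding distance_regular_def by simp
next
  case False
  then obtain x0 where x0: "x0 \<in> V" by blast
  have cL: "connected_graph (N x0) E" using lc x0 unfolding locally_connected_def by blast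
  interpret L: pgraph "N x0" E by (rule local_pgraph[OF x0 cL])
  obtain m where m: "\<forall>y\<in>N x0. L.common2 y m" using L.common2_exists[OF local_not_far[OF x0 cL]] by blast
  have "common_local x0 m" unfolding common_local_def
  proof (intro ballI impI)
    fix u w assume uw: "u \<in> N x0" "w \<in> N x0" "u \<noteq> w" "w \<notin> N u"
    have "L.d w u = 2" using local_dist[OF x0 cL uw(2,1)] d_two[OF x0 uw] d_sym N_V uw by metis
    then have "card (L.N u \<inter> L.N w) = m" using m uw unfolding L.common2_def by blast
    then show "card (N x0 \<inter> N u \<inter> N w) = m" unfolding nbhd_local by (simp add: Int_ac)
  qed
  then have cl: "common_local x m" if "x \<in> V" for x
    using connected_induct[of x0 "\<lambda>x. common_local x m" x] common_local_transfer x0 that by blast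
  obtain a where a: "\<And>x y. x \<in> V \<Longrightarrow> y \<in> N x \<Longrightarrow> card (N x \<inter> N y) = a"
    using card_common_const[OF lc] by blast
  define D where "D = card (N x0)"
  have c: "card {w \<in> N z. d x w + 1 = d x z} = c_num m (d x z)" if "x \<in> V" "z \<in> V" for x z
  proof -
    have "{w \<in> N z. d x w + 1 = d x z} = {w \<in> N z. d w x + 1 = d z x}"
      using d_sym[OF that(1)] that N_V by auto
    then show ?thesis using c_count[OF that(2) cl[OF that(2)] that(1) refl] d_sym[OF that] by simp
  qed
  have b: "card {w \<in> N z. d x w = d x z + 1} = nat (int D + int (c_num m (d x z)) - int (a + 2) * int (d x z))"
    if xz: "x \<in> V" "z \<in> V" for x z
  proof -
    let ?C = "{w \<in> N z. d x w + 1 = d x z}" and ?B = "{w \<in> N z. d x w = d x z + 1}"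
    have "laplacian V E (\<lambda>v. real (d v x)) z = (\<Sum>w\<in>N z. (if d x w = d x z + 1 then 1 else 0) - (if d x w + 1 = d x z then 1 else 0))"
      unfolding laplacian_def
    proof (rule sum.cong)
      fix w assume w: "w \<in> N z"
      then show "real (d w x) - real (d z x) = (if d x w = d x z + 1 then 1 else 0) - (if d x w + 1 = d x z then 1 else 0)"
        using d_N_le[OF xz(2) w xz(1)] d_N_le'[OF xz(2) w xz(1)] d_sym[OF xz] d_sym[OF xz(1) N_V[OF w]] by auto
    qed simp
    also have "\<dots> = real (card ?B) - real (card ?C)"
      unfolding sum_subtractf by (simp add: sum.If_cases Int_def)
    finally have "real (card ?B) - real (card ?C) = real D - (real a + 2) * real (d x z)"
      using lap_dist[OF a xz] card_N_const[OF xz(1) x0] d_sym[OF xz] by (simp add: D_def)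
    then have "real (card ?B) = real D + real (c_num m (d x z)) - (real a + 2) * real (d x z)"
      using c[OF xz] by linarith
    then have "real_of_int (int (card ?B)) = real_of_int (int D + int (c_num m (d x z)) - int (a + 2) * int (d x z))"
      by (simp add: algebra_simps)
    then have "int (card ?B) = int D + int (c_num m (d x z)) - int (a + 2) * int (d x z)" by (simp only: of_int_eq_iff)
    then show ?thesis by simp
  qed
  show ?thesis unfolding distance_regular_def
    by (rule exI[of _ "\<lambda>n. nat (int D + int (c_num m n) - int (a + 2) * int n)"], rule exI[of _ "c_num m"])
      (intro ballI conjI impI b c)
qed

end

section \<open>Reflective and Bonnet--Myers sharp graphs\<close>

text \<open>Induction on \<open>card B\<close>: a tight nonempty proper subset splits the problem in
  two; if there is none, every such subset has an element to spare and any first choice can be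
  made.\<close>

lemma hall:
  fixes R :: "'a \<Rightarrow> 'b set"
  assumes "finite B" "\<And>b. b \<in> B \<Longrightarrow> finite (R b)" "\<And>T. T \<subseteq> B \<Longrightarrow> card T \<le> card (\<Union> (R ` T))"
  shows "\<exists>m. inj_on m B \<and> (\<forall>b\<in>B. m b \<in> R b)"
  using assms
proof (induction "card B" arbitrary: B R rule: less_induct)
  case less
  note finB = less(2) and finR = less(3) and cond = less(4)
  show ?case
  proof (cases "B = {}")
    case False
    show ?thesis
    proof (cases "\<exists>T. T \<noteq> {} \<and> T \<subset> B \<and> card (\<Union> (R ` T)) \<le> card T")
      case True
      then obtain T where T: "T \<noteq> {}" "T \<subset> B" "card (\<Union> (R ` T)) \<le> card T" by blast
      have TB: "T \<subseteq> B" and finT: "finite T" using T finB finite_subset by blast+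
      let ?U = "\<Union> (R ` T)"
      have "\<exists>m. inj_on m T \<and> (\<forall>b\<in>T. m b \<in> R b)"
      proof (rule less(1))
        show "card T < card B" by (rule psubset_card_mono[OF finB T(2)])
        show "finite T" by (rule finT)
        show "finite (R b)" if "b \<in> T" for b using that TB by (intro finR) blast
        show "card S \<le> card (\<Union> (R ` S))" if "S \<subseteq> T" for S using that TB by (intro cond) blast
      qed
      then obtain m1 where m1: "inj_on m1 T" "\<forall>b\<in>T. m1 b \<in> R b" by blast
      have "\<exists>m. inj_on m (B - T) \<and> (\<forall>b\<in>B - T. m b \<in> R b - ?U)"
      proof (rule less(1))
        show "card (B - T) < card B" using T TB finB by (intro psubset_card_mono) auto
        show "finite (B - T)" using finB by simp
        show "finite (R b - ?U)" if "b \<in> B - T" for b using that finR by simp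
        fix S assume S: "S \<subseteq> B - T"
        then have SB: "S \<union> T \<subseteq> B" and finS: "finite S" using TB finB finite_subset[of S B] by blast+
        have "card S + card T = card (S \<union> T)" using S finS finT by (intro card_Un_disjoint[symmetric]) auto
        also have "\<dots> \<le> card (\<Union> (R ` (S \<union> T)))" by (rule cond[OF SB])
        also have "\<Union> (R ` (S \<union> T)) = \<Union> ((\<lambda>b. R b - ?U) ` S) \<union> ?U" by blast
        also have "card \<dots> \<le> card (\<Union> ((\<lambda>b. R b - ?U) ` S)) + card ?U" by (rule card_Un_le)
        finally show "card S \<le> card (\<Union> ((\<lambda>b. R b - ?U) ` S))" using T(3) by linarith
      qed
      then obtain m2 where m2: "inj_on m2 (B - T)" "\<forall>b\<in>B - T. m2 b \<in> R b - ?U" by blast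
      define m where "m b = (if b \<in> T then m1 b else m2 b)" for b
      have "inj_on m B"
      proof (rule inj_onI)
        fix a b assume ab: "a \<in> B" "b \<in> B" "m a = m b"
        have "m c \<in> ?U \<longleftrightarrow> c \<in> T" if "c \<in> B" for c using m1(2) m2(2) that unfolding m_def by auto
        then have "a \<in> T \<longleftrightarrow> b \<in> T" using ab by metis
        then show "a = b" using ab m1(1) m2(1) unfolding m_def inj_on_def by (cases "a \<in> T") auto
      qed
      moreover have "\<forall>b\<in>B. m b \<in> R b" using m1(2) m2(2) by (simp add: m_def)
      ultimately show ?thesis by blast
    next
      case nT: False
      obtain b where b: "b \<in> B" using False by blast
      have "card {b} \<le> card (\<Union> (R ` {b}))" using cond[of "{b}"] b by blast
      then have "R b \<noteq> {}" by auto
      then obtain a where a: "a \<in> R b" by blast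
      have "\<exists>m. inj_on m (B - {b}) \<and> (\<forall>c\<in>B - {b}. m c \<in> R c - {a})"
      proof (rule less(1))
        show "card (B - {b}) < card B" using b finB by (intro psubset_card_mono) auto
        show "finite (B - {b})" using finB by simp
        show "finite (R c - {a})" if "c \<in> B - {b}" for c using that finR by simp
        fix S assume S: "S \<subseteq> B - {b}"
        show "card S \<le> card (\<Union> ((\<lambda>c. R c - {a}) ` S))"
        proof (cases "S = {}")
          case False
          have "S \<subset> B" using S b by blast
          then have "card S < card (\<Union> (R ` S))" using nT False by (meson not_less)
          moreover have "\<Union> ((\<lambda>c. R c - {a}) ` S) = \<Union> (R ` S) - {a}" by blast
          moreover have "card (\<Union> (R ` S)) - 1 \<le> card (\<Union> (R ` S) - {a})" using diff_card_le_card_Diff[of "{a}" "\<Union> (R ` S)"] by simp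
          ultimately show ?thesis by simp
        qed simp
      qed
      then obtain m where m: "inj_on m (B - {b})" "\<forall>c\<in>B - {b}. m c \<in> R c - {a}" by blast
      have "inj_on (m(b := a)) B"
      proof (rule inj_onI)
        fix c e assume "c \<in> B" "e \<in> B" "(m(b := a)) c = (m(b := a)) e"
        then show "c = e" using m by (cases "c = b"; cases "e = b") (auto simp: inj_on_def)
      qed
      moreover have "\<forall>c\<in>B. (m(b := a)) c \<in> R c" using m(2) a by simp
      ultimately show ?thesis by blast
    qed
  qed simp
qed

lemma sum_of_mem: "finite S \<Longrightarrow> (\<Sum>w\<in>S. if w \<in> U then 1 else 0) = real (card (S \<inter> U))"
  by (simp add: sum.If_cases)

context cgraph begin

lemma automorphism_d_le:
  assumes "graph_automorphism V E \<phi>" "u \<in> V" "v \<in> V"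
  shows "d (\<phi> u) (\<phi> v) \<le> d u v"
proof -
  have "(adj V E ^^ n) u v \<Longrightarrow> (adj V E ^^ n) (\<phi> u) (\<phi> v)" for n v
  proof (induction n arbitrary: v)
    case (Suc n)
    then obtain w where w: "(adj V E ^^ n) u w" "adj V E w v" by (auto elim: relpowp_Suc_E)
    then have "adj V E (\<phi> w) (\<phi> v)" using assms(1) bij_betwE unfolding graph_automorphism_def adj_def by blast
    then show ?case using Suc.IH[OF w(1)] by auto
  qed simp
  then show ?thesis using d_le d_walk[OF assms(2,3)] by blast
qed

context
  fixes x y \<phi>
  assumes xy: "x \<in> V" "y \<in> N x" and refl: "is_reflection V E x y \<phi>"
begin

lemma refl_V: "v \<in> V \<Longrightarrow> \<phi> v \<in> V"
proof -
  have "bij_betw \<phi> V V" using refl unfolding is_reflection_def graph_automorphism_def by simp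
  then show "v \<in> V \<Longrightarrow> \<phi> v \<in> V" using bij_betwE by blast
qed

lemma refl_invol: "v \<in> V \<Longrightarrow> \<phi> (\<phi> v) = v"
  using refl unfolding is_reflection_def by simp

lemma refl_isom: assumes "u \<in> V" "v \<in> V" shows "d (\<phi> u) (\<phi> v) = d u v"
proof -
  have a: "graph_automorphism V E \<phi>" using refl unfolding is_reflection_def by simp
  show ?thesis
    using automorphism_d_le[OF a assms] automorphism_d_le[OF a refl_V[OF assms(1)] refl_V[OF assms(2)]]
      refl_invol assms by simp
qed

lemma refl_fix: "v \<in> V \<Longrightarrow> d v x = d v y \<Longrightarrow> \<phi> v = v"
  using refl unfolding is_reflection_def equidistant_def by simp

lemma refl_x: "\<phi> x = y" "\<phi> y = x"
  using refl refl_invol[OF xy(1)] unfolding is_reflection_def by auto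

lemma refl_closer: "u \<in> closer V E x y \<Longrightarrow> \<phi> u \<in> closer V E y x" "u \<in> closer V E y x \<Longrightarrow> \<phi> u \<in> closer V E x y"
  using refl_isom[of u x] refl_isom[of u y] xy(1) N_V[OF xy(2)] refl_V[of u] unfolding refl_x closer_def by auto

lemma refl_cross:
  assumes "u \<in> closer V E x y" "w \<in> closer V E y x" "E u w"
  shows "w = \<phi> u"
proof -
  have "{u, w} \<in> {{u, w} | u w. u \<in> closer V E x y \<and> w \<in> closer V E y x \<and> E u w}" using assms by blast
  also have "\<dots> = {{u, \<phi> u} | u. u \<in> closer V E x y}" using refl unfolding is_reflection_def by simp
  finally have "{u, w} \<in> {{u, \<phi> u} | u. u \<in> closer V E x y}" .
  then obtain u' where u': "{u, w} = {u', \<phi> u'}" "u' \<in> closer V E x y" by blast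
  \<comment> \<open>Excludes the swapped reading of the unordered pair.\<close>
  have "u' \<noteq> w" using u' assms(2) unfolding closer_def by auto
  then have "u' = u" using u'(1) by blast
  then show ?thesis using u'(1) by (metis doubleton_eq_iff)
qed

lemma refl_edge: assumes "u \<in> closer V E x y" shows "\<phi> u \<in> N u"
proof -
  have "{u, \<phi> u} \<in> {{u, \<phi> u} | u. u \<in> closer V E x y}" using assms by blast
  also have "\<dots> = {{u, w} | u w. u \<in> closer V E x y \<and> w \<in> closer V E y x \<and> E u w}"
    using refl unfolding is_reflection_def by simp
  finally have "{u, \<phi> u} \<in> {{u, w} | u w. u \<in> closer V E x y \<and> w \<in> closer V E y x \<and> E u w}" .
  then obtain u' w' where u': "{u, \<phi> u} = {u', w'}" "u' \<in> closer V E x y" "w' \<in> closer V E y x" "E u' w'" by blast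
  have "u \<noteq> w'" using u' assms unfolding closer_def by auto
  then have "u = u'" "\<phi> u = w'" using u'(1) by (metis doubleton_eq_iff)+
  then show ?thesis using u' by (simp add: N_iff closer_def)
qed

text \<open>Folding: a walk from the side of \<open>x\<close> to \<open>w\<close> is reflected from
  the point where it leaves that side. It leaves through a fixed vertex, or along an edge from a
  vertex to its image, and then even saves a step.\<close>

lemma refl_shortcut:
  assumes "w \<in> closer V E y x"
  shows "u \<in> closer V E x y \<Longrightarrow> (adj V E ^^ k) u w \<Longrightarrow> d u (\<phi> w) \<le> k"
proof (induction k arbitrary: u)
  case 0
  then show ?case using assms by (auto simp: closer_def)
next
  case (Suc k)
  have V: "w \<in> V" "u \<in> V" "y \<in> V" using assms Suc N_V xy by (auto simp: closer_def)
  obtain p where p: "adj V E u p" "(adj V E ^^ k) p w" using relpowp_Suc_D2[OF Suc(3)] by blast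
  have pN: "p \<in> N u" "p \<in> V" "E u p" using p by (auto simp: adj_def N_iff)
  have le: "d u (\<phi> w) \<le> d p (\<phi> w) + 1" using d_N_le2[OF V(2) pN(1) refl_V[OF V(1)]] by simp
  consider "p \<in> closer V E x y" | "d p x = d p y" | "p \<in> closer V E y x"
    using pN unfolding closer_def by fastforce
  then show ?case
  proof cases
    case 1
    then show ?thesis using Suc.IH[OF 1 p(2)] le by simp
  next
    case 2
    then have "d p (\<phi> w) = d p w" using refl_fix[OF pN(2) 2] refl_isom[OF pN(2) V(1)] by simp
    then show ?thesis using le d_le[OF p(2)] by simp
  next
    case 3
    then have "p = \<phi> u" using refl_cross Suc(2) pN by blast
    then have "u = \<phi> p" using refl_invol V by simp
    then have "d u (\<phi> w) = d p w" using refl_isom[OF pN(2) V(1)] by simp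
    then show ?thesis using d_le[OF p(2)] by simp
  qed
qed

end

text \<open>The fourth vertex is the image of \<open>a\<close>. If \<open>d b z = d a z + 1\<close>
  failed for a \<open>z\<close> on the side of \<open>x\<close>, then \<open>z\<close> would be
  equidistant from the ends of the edge from \<open>x\<close> to \<open>a\<close> or of the edge
  from \<open>y\<close> to \<open>b\<close>. The reflection along that edge fixes \<open>z\<close>
  and maps \<open>y\<close> to \<open>b\<close>, respectively \<open>x\<close> to \<open>a\<close>,
  which equates two different distances.\<close>

lemma reflective_parallelogram:
  assumes "reflective V E" shows "parallelogram V E"
  unfolding parallelogram_def
proof (intro ballI impI)
  fix x a y assume h: "x \<in> V" "a \<in> N x" "y \<in> N x" "d a y = 2"
  have refl: "\<exists>\<phi>. is_reflection V E u v \<phi>" if "u \<in> V" "v \<in> N u" for u v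
    using assms that unfolding reflective_def N_iff by blast
  obtain \<phi> where \<phi>: "is_reflection V E x y \<phi>" using refl h by blast
  note V\<phi> = refl_V[OF h(1,3) \<phi>] and inv\<phi> = refl_invol[OF h(1,3) \<phi>] and iso\<phi> = refl_isom[OF h(1,3) \<phi>]
  have V: "a \<in> V" "y \<in> V" using h N_V by blast+
  define b where "b = \<phi> a"
  have bV: "b \<in> V" using V\<phi> V by (simp add: b_def)
  have ax: "d a x = 1" "d x y = 1" "d y x = 1" using d_N' d_N h by simp_all
  have ac: "a \<in> closer V E x y" using V ax h by (simp add: closer_def)
  have bN: "b \<in> N a" using refl_edge[OF h(1,3) \<phi> ac] by (simp add: b_def)
  have bc: "b \<in> closer V E y x" using refl_closer(1)[OF h(1,3) \<phi> ac] by (simp add: b_def)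
  have \<phi>b: "\<phi> b = a" using inv\<phi> V by (simp add: b_def)
  have by1: "d b y = 1" using iso\<phi>[OF V(1) h(1)] ax refl_x[OF h(1,3) \<phi>] by (simp add: b_def)
  have bx: "d b x = 2" using iso\<phi>[OF V] h refl_x[OF h(1,3) \<phi>] by (simp add: b_def)
  have yb: "b \<in> N y" using d_eq_1[of y b] by1 d_sym[of y b] V bV by simp
  have ya: "d y a = 2" "d a b = 1" "d b a = 1" "d x b = 2"
    using d_sym[of y a] h d_N[OF V(1) bN] d_N'[OF V(1) bN] d_sym[of x b] bx V bV by simp_all
  have key: "d b z = d a z + 1" if z: "z \<in> closer V E x y" for z
  proof (rule ccontr)
    assume ne: "d b z \<noteq> d a z + 1"
    have zV: "z \<in> V" using z by (simp add: closer_def)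
    have yz: "d y z = d x z + 1"
      using z d_N_le2[OF h(1,3) zV] d_sym[of z x] d_sym[of z y] h V unfolding closer_def by simp
    have "d z a \<le> d z b" using refl_shortcut[OF h(1,3) \<phi> bc z d_walk[OF zV bV]] \<phi>b by simp
    then have "d a z \<le> d b z" using d_sym zV V bV by simp
    then have ab: "d b z = d a z" using d_N_le2[OF V(1) bN zV] ne by linarith
    \<comment> \<open>The common value of \<open>d a z\<close> and \<open>d b z\<close> is within 1
      of both \<open>d x z\<close> and \<open>d y z\<close>, which differ by 1.\<close>
    have "d a z = d x z \<or> d a z = d y z"
      using ab yz d_N_le2[OF h(1,2) zV] d_N_le2[OF V(2) yb zV] by linarith
    then show False
    proof
      assume e: "d a z = d x z"
      obtain \<psi> where \<psi>: "is_reflection V E x a \<psi>" using refl h by blast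
      have "y \<in> closer V E x a" "b \<in> closer V E a x" using V bV ax ya bx by (simp_all add: closer_def)
      then have "b = \<psi> y" using refl_cross[OF h(1,2) \<psi>] yb by (simp add: N_iff)
      moreover have "\<psi> z = z" using refl_fix[OF h(1,2) \<psi> zV] e d_sym[of z x] d_sym[of z a] zV V h by simp
      ultimately have "d b z = d y z" using refl_isom[OF h(1,2) \<psi> V(2) zV] by simp
      then show False using ab e yz by simp
    next
      assume e: "d a z = d y z"
      obtain \<psi> where \<psi>: "is_reflection V E y b \<psi>" using refl V yb by blast
      have "x \<in> closer V E y b" "a \<in> closer V E b y" using V h ax ya by (simp_all add: closer_def)
      then have "a = \<psi> x" using refl_cross[OF V(2) yb \<psi>] h(2) by (simp add: N_iff)
      moreover have "\<psi> z = z" using refl_fix[OF V(2) yb \<psi> zV] ab e d_sym[of z y] d_sym[of z b] zV V bV by simp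
      ultimately have "d a z = d x z" using refl_isom[OF V(2) yb \<psi> h(1) zV] by simp
      then show False using e yz by simp
    qed
  qed
  have key2: "d y z = d x z + 1" if z: "z \<in> closer V E x y" for z
    using z d_N_le2[OF h(1,3), of z] d_sym[of z x] d_sym[of z y] h V unfolding closer_def by simp
  show "\<exists>b\<in>V. \<forall>z\<in>V. d a z + d y z = d x z + d b z"
  proof (rule bexI[OF _ bV], rule ballI)
    fix z assume z: "z \<in> V"
    consider "z \<in> closer V E x y" | "z \<in> closer V E y x" | "d z x = d z y"
      using z unfolding closer_def by fastforce
    then show "d a z + d y z = d x z + d b z"
    proof cases
      case 1
      then show ?thesis using key key2 by simp
    next
      case 2
      then have c: "\<phi> z \<in> closer V E x y" using refl_closer(2)[OF h(1,3) \<phi>] by blast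
      have "d b (\<phi> z) = d a z" using iso\<phi>[OF V(1) z] by (simp add: b_def)
      moreover have "d a (\<phi> z) = d b z" using iso\<phi>[OF bV z] \<phi>b by simp
      moreover have "d y (\<phi> z) = d x z" "d x (\<phi> z) = d y z"
        using iso\<phi>[OF h(1) z] iso\<phi>[OF V(2) z] refl_x[OF h(1,3) \<phi>] by simp_all
      ultimately show ?thesis using key[OF c] key2[OF c] by simp
    next
      case 3
      have "\<phi> z = z" using refl_fix[OF h(1,3) \<phi> z 3] .
      then have "d b z = d a z" using iso\<phi>[OF V(1) z] by (simp add: b_def)
      then show ?thesis using 3 d_sym[of z x] d_sym[of z y] z h V by simp
    qed
  qed
qed

text \<open>The test function is 2 on T, 0 on x and the outer neighbours of x without neighbour in T, and 1 elsewhere.\<close>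
lemma curv_transport_bound:
  assumes xy: "x \<in> V" "y \<in> N x" and T: "T \<subseteq> outer y x"
  shows "min_curv V E \<le> real (card (N x \<inter> N y)) + 2
    + real (card (\<Union> ((\<lambda>b. N b \<inter> outer x y) ` T))) - real (card T)"
proof -
  have V: "y \<in> V" "x \<in> N y" using xy N_V N_sym by blast+
  let ?R = "\<lambda>b. N b \<inter> outer x y"
  let ?U = "\<Union> (?R ` T)"
  define Z where "Z = insert x (outer x y - ?U)"
  define f :: "'a \<Rightarrow> real" where "f v = (if v \<in> T then 2 else if v \<in> Z then 0 else 1)" for v
  have Tn: "t \<in> V" "t \<notin> N x" "t \<noteq> x" "t \<in> N y" if "t \<in> T" for t using that T N_V by (auto simp: outer_def)
  have far: "v \<notin> N t" if t: "t \<in> T" and v: "v \<in> Z" for t v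
  proof (cases "v = x")
    case True
    then show ?thesis using Tn[OF t] N_sym by blast
  next
    case False
    then show ?thesis using v t unfolding Z_def by blast
  qed
  have "lipschitz f" unfolding lipschitz_def
  proof (intro ballI)
    fix u v assume uv: "u \<in> V" "v \<in> N u"
    then have vu: "u \<in> N v" "v \<in> V" using N_sym N_V by blast+
    show "\<bar>f u - f v\<bar> \<le> 1"
    proof (cases "u \<in> T")
      case True
      then have "v \<notin> Z" using far uv by blast
      then have "f v \<ge> 1" "f v \<le> 2" by (simp_all add: f_def)
      then show ?thesis using True by (simp add: f_def)
    next
      case u: False
      show ?thesis
      proof (cases "v \<in> T")
        case True
        then have "u \<notin> Z" using far vu by blast
        then have "f u \<ge> 1" "f u \<le> 2" by (simp_all add: f_def)
        then show ?thesis using True by (simp add: f_def)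
      next
        case False
        then have "0 \<le> f u" "f u \<le> 1" "0 \<le> f v" "f v \<le> 1" using u by (simp_all add: f_def)
        then show ?thesis by linarith
      qed
    qed
  qed
  moreover have fx: "f x = 0" using Tn(3)[of x] by (auto simp: f_def Z_def)
  moreover have "y \<notin> T" "y \<noteq> x" "y \<notin> outer x y" using Tn(2)[of y] N_irr[OF xy(1)] xy by (auto simp: outer_def)
  then have fy: "f y = 1" by (simp add: f_def Z_def)
  ultimately have "min_curv V E \<le> lap f x - lap f y" by (intro min_curv_le[OF xy]) auto
  moreover have "(\<Sum>w\<in>outer x y. f w - f x) = real (card ?U)"
  proof -
    have "outer x y \<inter> T = {}" using T by (auto simp: outer_def)
    have "(\<Sum>w\<in>outer x y. f w - f x) = (\<Sum>w\<in>outer x y. if w \<in> ?U then 1 else 0)"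
    proof (intro sum.cong refl)
      fix w assume w: "w \<in> outer x y"
      then have "w \<noteq> x" using N_irr[OF xy(1)] by (auto simp: outer_def)
      moreover have "w \<notin> T" using w \<open>outer x y \<inter> T = {}\<close> by blast
      ultimately show "f w - f x = (if w \<in> ?U then 1 else 0)" using w fx by (simp add: f_def Z_def)
    qed
    also have "\<dots> = real (card (outer x y \<inter> ?U))" by (rule sum_of_mem[OF fin_outer])
    also have "outer x y \<inter> ?U = ?U" by blast
    finally show ?thesis .
  qed
  moreover have "(\<Sum>w\<in>outer y x. f w - f y) = real (card T)"
  proof -
    have "(\<Sum>w\<in>outer y x. f w - f y) = (\<Sum>w\<in>outer y x. if w \<in> T then 1 else 0)"
    proof (intro sum.cong refl)
      fix w assume "w \<in> outer y x"
      then have "w \<notin> Z" by (auto simp: outer_def Z_def)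
      then show "f w - f y = (if w \<in> T then 1 else 0)" using fy by (simp add: f_def)
    qed
    also have "\<dots> = real (card (outer y x \<inter> T))" by (simp add: sum.If_cases)
    also have "outer y x \<inter> T = T" using T by blast
    finally show ?thesis .
  qed
  ultimately show ?thesis
    unfolding lap_diff[OF xy] using fx fy by simp
qed

text \<open>The curvature bound, added up along geodesics from \<open>z\<close>, gives an upper
  bound for the Laplacian of the distance. As Laplacians sum to 0, sharpness says that the total
  defect over all pairs is 0; so each defect vanishes, and all degrees are maximal.\<close>

lemma sharp_lap_dist:
  assumes "eff_BM_sharp V E" "z \<in> V" "v \<in> V"
  shows "lap (\<lambda>v. real (d v z)) v = real (max_deg V E) - min_curv V E * real (d v z)"
    and "card (N z) = max_deg V E"
proof -
  define K D where "K = min_curv V E" and "D = max_deg V E"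
  have K: "K > 0" "diam_eff V E = real D / K" using assms(1) unfolding eff_BM_sharp_def K_def D_def by auto
  have le: "card (N z) \<le> D" if "z \<in> V" for z
    unfolding D_def max_deg_def using fin that by (intro Max_ge) (auto simp: Deg_def)
  have ub: "lap (\<lambda>v. real (d v z)) v \<le> real (card (N z)) - K * real (d v z)" if z: "z \<in> V" and v: "v \<in> V" for z v
    using v
  proof (induction "d v z" arbitrary: v)
    case 0
    then have "v = z" using z by simp
    moreover have "lap (\<lambda>v. real (d v z)) z = (\<Sum>w\<in>N z. 1)"
      unfolding laplacian_def using d_N'[OF z] by (intro sum.cong) auto
    ultimately show ?case by simp
  next
    case (Suc n)
    obtain w where w: "w \<in> N v" "d w z = n" using step_left[OF Suc(3) z Suc(2)[symmetric]] .
    have wV: "w \<in> V" "v \<in> N w" using w Suc(3) N_V N_sym by blast+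
    have "K \<le> lap (\<lambda>v. real (d v z)) w - lap (\<lambda>v. real (d v z)) v"
      unfolding K_def using Suc(2) w by (intro min_curv_le[OF wV dist_lipschitz[OF z]]) simp
    moreover have "lap (\<lambda>v. real (d v z)) w \<le> real (card (N z)) - K * real (d w z)"
      using Suc(1)[OF w(2)[symmetric] wV(1)] .
    moreover have "real (d v z) = real (d w z) + 1" using Suc(2) w by simp
    ultimately show ?case by (simp add: algebra_simps)
  qed
  define T where "T z v = real D - K * real (d v z) - lap (\<lambda>v. real (d v z)) v" for z v
  have T0: "T z v \<ge> 0" if "z \<in> V" "v \<in> V" for z v
    using ub[OF that] le[OF that(1)] by (simp add: T_def)
  have cpos: "card V > 0" using assms fin by (auto simp: card_gt_0_iff)
  have "(\<Sum>z\<in>V. \<Sum>v\<in>V. T z v) = (\<Sum>z\<in>V. real (card V) * real D - K * (\<Sum>v\<in>V. real (d v z)))"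
    unfolding T_def sum_subtractf lap_sum_zero by (simp add: sum_distrib_left)
  also have "\<dots> = real (card V) ^ 2 * real D - K * (\<Sum>z\<in>V. \<Sum>v\<in>V. real (d v z))"
    by (simp add: sum_subtractf sum_distrib_left power2_eq_square)
  also have "(\<Sum>z\<in>V. \<Sum>v\<in>V. real (d v z)) = (\<Sum>x\<in>V. \<Sum>y\<in>V. real (d x y))" by (rule sum.swap)
  also have "\<dots> = real (card V) ^ 2 * (real D / K)"
    using K(2) cpos unfolding diam_eff_def by (simp add: field_simps)
  also have "real (card V) ^ 2 * real D - K * (real (card V) ^ 2 * (real D / K)) = 0" using K(1) by simp
  finally have "(\<Sum>z\<in>V. \<Sum>v\<in>V. T z v) = 0" .
  then have "\<forall>z\<in>V. (\<Sum>v\<in>V. T z v) = 0"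
    using T0 fin by (subst (asm) sum_nonneg_eq_0_iff) (auto intro: sum_nonneg)
  then have all0: "T z v = 0" if "z \<in> V" "v \<in> V" for z v
    using T0[OF that(1)] fin that sum_nonneg_eq_0_iff[of V "T z"] by blast
  show "lap (\<lambda>v. real (d v z)) v = real (max_deg V E) - min_curv V E * real (d v z)"
    using all0[OF assms(2,3)] unfolding T_def K_def D_def by simp
  have "real D \<le> real (card (N z))" using all0[OF assms(2,2)] ub[OF assms(2,2)] unfolding T_def by simp
  then show "card (N z) = max_deg V E" using le[OF assms(2)] unfolding D_def by simp
qed

lemma sharp_parallelogram:
  assumes sh: "eff_BM_sharp V E" shows "parallelogram V E"
proof -
  define K D where "K = min_curv V E" and "D = max_deg V E"
  have lapd: "lap (\<lambda>v. real (d v z)) v = real D - K * real (d v z)" if "z \<in> V" "v \<in> V" for z v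
    unfolding K_def D_def by (rule sharp_lap_dist(1)[OF sh that])
  have deg: "card (N z) = D" if "z \<in> V" for z unfolding D_def by (rule sharp_lap_dist(2)[OF sh that that])
  have co: "card (outer x y) = card (outer y x)" if xy: "x \<in> V" "y \<in> N x" for x y
  proof -
    have V: "y \<in> V" "x \<in> N y" using xy N_V N_sym by blast+
    have o: "card (outer u v) + card (N u \<inter> N v) + 1 = D" if uv: "u \<in> V" "v \<in> N u" for u v
    proof -
      have "N u = insert v (outer u v \<union> (N u \<inter> N v))" using uv by (auto simp: outer_def)
      moreover have "v \<notin> outer u v \<union> (N u \<inter> N v)" using uv N_irr N_V by (auto simp: outer_def)
      moreover have "card (outer u v \<union> (N u \<inter> N v)) = card (outer u v) + card (N u \<inter> N v)"
        by (intro card_Un_disjoint) (auto simp: outer_def)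
      ultimately have "card (N u) = card (outer u v) + card (N u \<inter> N v) + 1"
        by (metis card_insert_disjoint fin_N fin_outer finite_Int finite_UnI Suc_eq_plus1)
      then show ?thesis using deg[OF uv(1)] by simp
    qed
    show ?thesis using o[OF xy] o[OF V] by (simp add: Int_commute)
  qed
  \<comment> \<open>By regularity both ends have equally many outer neighbours, whose contributions
    for the distance to \<open>x\<close> cancel.\<close>
  have Kc: "K = real (card (N x \<inter> N y)) + 2" if xy: "x \<in> V" "y \<in> N x" for x y
  proof -
    let ?f = "\<lambda>v. real (d v x)"
    have V: "y \<in> V" "x \<in> N y" using xy N_V N_sym by blast+
    have "K = lap ?f x - lap ?f y" using lapd[OF xy(1,1)] lapd[OF xy(1) V(1)] d_N'[OF xy] by simp
    also have "\<dots> = (real (card (N x \<inter> N y)) + 2) * (?f y - ?f x)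
      + (\<Sum>w\<in>outer x y. ?f w - ?f x) - (\<Sum>w\<in>outer y x. ?f w - ?f y)" by (rule lap_diff[OF xy])
    also have "(\<Sum>w\<in>outer x y. ?f w - ?f x) = (\<Sum>w\<in>outer x y. 1)"
      using d_N'[OF xy(1)] outer_iff[OF xy] by (intro sum.cong) auto
    also have "(\<Sum>w\<in>outer y x. ?f w - ?f y) = (\<Sum>w\<in>outer y x. 1)"
      using d_N'[OF xy] outer_iff[OF V] by (intro sum.cong) auto
    finally show ?thesis using d_N'[OF xy] co[OF xy] by simp
  qed
  \<comment> \<open>With this value of K the transport bound reads as Hall's condition.\<close>
  have match: "\<exists>m. bij_betw m (outer y x) (outer x y) \<and> (\<forall>b\<in>outer y x. m b \<in> N b)" if xy: "x \<in> V" "y \<in> N x" for x y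
  proof -
    have V: "y \<in> V" "x \<in> N y" using xy N_V N_sym by blast+
    let ?R = "\<lambda>b. N b \<inter> outer x y"
    have "\<exists>m. inj_on m (outer y x) \<and> (\<forall>b\<in>outer y x. m b \<in> ?R b)"
    proof (rule hall)
      fix T assume "T \<subseteq> outer y x"
      then show "card T \<le> card (\<Union> (?R ` T))"
        using curv_transport_bound[OF xy] Kc[OF xy] unfolding K_def by fastforce
    qed auto
    then obtain m where m: "inj_on m (outer y x)" "\<forall>b\<in>outer y x. m b \<in> ?R b" by blast
    have "m ` outer y x = outer x y"
      using m co[OF xy] card_image[OF m(1)] by (intro card_subset_eq) auto
    then show ?thesis using m unfolding bij_betw_def by blast
  qed
  \<comment> \<open>If \<open>z\<close> is closer to \<open>x\<close>, the terms along the matching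
    are nonnegative and sum up to 0, so each of them vanishes.\<close>
  have quad: "d z b = d z a + 1"
    if xy: "x \<in> V" "y \<in> N x" and ab: "a \<in> outer x y" "b \<in> outer y x" "b \<in> N a" and z: "z \<in> V" "d z y = d z x + 1"
    for x y a b z
  proof -
    obtain m where m: "bij_betw m (outer y x) (outer x y)" "\<forall>b\<in>outer y x. m b \<in> N b" using match[OF xy] by blast
    have V: "y \<in> V" "x \<in> N y" using xy N_V N_sym by blast+
    have all: "d z b = d z (m b) + 1" if z: "z \<in> V" "d z y = d z x + 1" and b: "b \<in> outer y x" for z b
    proof -
      let ?f = "\<lambda>v. real (d v z)"
      have dz: "?f y = ?f x + 1" using z d_sym[of z x] d_sym[of z y] xy V by simp
      have "(\<Sum>w\<in>outer x y. ?f w - ?f x) = (\<Sum>b\<in>outer y x. ?f (m b) - ?f x)"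
        using sum.reindex_bij_betw[OF m(1), of "\<lambda>w. ?f w - ?f x"] by simp
      moreover have "K = lap ?f x - lap ?f y" using lapd[OF z(1) xy(1)] lapd[OF z(1) V(1)] dz by (simp add: algebra_simps)
      ultimately have "(\<Sum>b\<in>outer y x. ?f (m b) - ?f x) - (\<Sum>w\<in>outer y x. ?f w - ?f y) = 0"
        unfolding lap_diff[OF xy] using Kc[OF xy] dz by simp
      then have "(\<Sum>b\<in>outer y x. (?f (m b) - ?f x) - (?f b - ?f y)) = 0" unfolding sum_subtractf .
      moreover have "(?f (m b) - ?f x) - (?f b - ?f y) \<ge> 0" if "b \<in> outer y x" for b
      proof -
        have "b \<in> V" "m b \<in> N b" using that m N_V by (auto simp: outer_def)
        then show ?thesis using d_N_le2[of b "m b" z] z dz by simp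
      qed
      ultimately have "(?f (m b) - ?f x) - (?f b - ?f y) = 0"
        using b by (subst (asm) sum_nonneg_eq_0_iff) auto
      then have e: "?f b = ?f (m b) + 1" using dz by simp
      have "b \<in> V" "m b \<in> V" using b m N_V by (auto simp: outer_def)
      then show ?thesis using e d_sym[of b z] d_sym[of "m b" z] z by simp
    qed
    have a: "a \<in> N x" "d a y = 2" using outer_iff[OF xy] ab by blast+
    have aV: "a \<in> V" using a N_V by blast
    \<comment> \<open>Taking \<open>z = a\<close> shows \<open>m b = a\<close>: the matching
      contains every edge between the outer neighbourhoods.\<close>
    have "d a b = d a (m b) + 1" using all[OF aV _ ab(2)] a d_N'[OF xy(1) a(1)] by simp
    moreover have "d a b = 1" using d_N[OF aV ab(3)] .
    moreover have "m b \<in> V" using m(2) ab N_V by blast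
    ultimately have "m b = a" using aV by simp
    then show ?thesis using all[OF z ab(2)] by simp
  qed
  show ?thesis unfolding parallelogram_def
  proof (intro ballI impI)
    fix x a y assume h: "x \<in> V" "a \<in> N x" "y \<in> N x" "d a y = 2"
    have V: "a \<in> V" "y \<in> V" "x \<in> N y" "x \<in> N a" using h N_V N_sym by blast+
    have ao: "a \<in> outer x y" using outer_iff[OF h(1,3)] h by blast
    obtain m where m: "bij_betw m (outer y x) (outer x y)" "\<forall>b\<in>outer y x. m b \<in> N b" using match[OF h(1,3)] by blast
    have "a \<in> m ` outer y x" using m(1) ao by (simp add: bij_betw_def)
    then obtain b where b: "b \<in> outer y x" "m b = a" by blast
    have bV: "b \<in> N y" using b unfolding outer_def by blast
    then have bV: "b \<in> V" "b \<in> N y" using N_V by blast+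
    have ab: "a \<in> N b" using b m by blast
    then have ba: "b \<in> N a" using N_sym bV by blast
    have yb: "y \<in> N b" using N_sym V bV by blast
    have nb: "a \<notin> N y" "b \<notin> N x" "x \<notin> N b" "y \<notin> N a" "a \<noteq> y" "x \<noteq> b"
      using ao b N_sym bV V h(1) by (auto simp: outer_def)
    have o: "x \<in> outer a b" "y \<in> outer b a" using V yb nb by (auto simp: outer_def)
    show "\<exists>b\<in>V. \<forall>z\<in>V. d a z + d y z = d x z + d b z"
    proof (rule bexI[OF _ bV(1)], rule ballI)
      fix z assume z: "z \<in> V"
      \<comment> \<open>\<open>quad\<close> is applied to two opposite sides of the quadrangle in
        both directions: the differences of distances along them lie in {-1, 0, 1} and have the same
        sign, so they agree.\<close>
      have 1: "d z y = d z x + 1 \<Longrightarrow> d z b = d z a + 1" using quad[OF h(1,3) ao b(1) ba z] .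
      have 2: "d z x = d z y + 1 \<Longrightarrow> d z a = d z b + 1" using quad[OF V(2,3) b(1) ao ab z] .
      have 3: "d z b = d z a + 1 \<Longrightarrow> d z y = d z x + 1" using quad[OF V(1) ba o h(3) z] .
      have 4: "d z a = d z b + 1 \<Longrightarrow> d z x = d z y + 1" using quad[OF bV(1) ab o(2,1) V(3) z] .
      have "d z y = d z x + 1 \<or> d z x = d z y + 1 \<or> d z x = d z y"
        using d_N_le[OF h(1,3) z] d_N_le'[OF h(1,3) z] by linarith
      moreover have "d z b = d z a + 1 \<or> d z a = d z b + 1 \<or> d z a = d z b"
        using d_N_le[OF V(1) ba z] d_N_le'[OF V(1) ba z] by linarith
      ultimately have "d z a + d z y = d z x + d z b" using 1 2 3 4 by linarith
      then show "d a z + d y z = d x z + d b z" using d_sym z V bV h(1) by simp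
    qed
  qed
qed

end

section \<open>Distance regular Lichnerowicz sharp graphs\<close>

lemma sum_by_value:
  fixes f :: "'a \<Rightarrow> real" and h :: "'a \<Rightarrow> nat"
  assumes "finite W" "\<And>w. w \<in> W \<Longrightarrow> h w \<le> M"
  shows "(\<Sum>w\<in>W. g (h w) * f w) = (\<Sum>k\<le>M. g k * (\<Sum>w\<in>{w \<in> W. h w = k}. f w))"
proof -
  have "(\<Sum>w\<in>W. g (h w) * f w) = (\<Sum>k\<le>M. \<Sum>w\<in>{w \<in> W. h w = k}. g (h w) * f w)"
    using assms by (intro sum.group[symmetric]) auto
  also have "\<dots> = (\<Sum>k\<le>M. g k * (\<Sum>w\<in>{w \<in> W. h w = k}. f w))"
    by (intro sum.cong refl) (simp add: sum_distrib_left)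
  finally show ?thesis .
qed

lemma sum_by_value_card:
  fixes h :: "'a \<Rightarrow> nat"
  assumes "finite W" "\<And>w. w \<in> W \<Longrightarrow> h w \<le> M"
  shows "(\<Sum>w\<in>W. g (h w)) = (\<Sum>k\<le>M. g k * real (card {w \<in> W. h w = k}))"
  using sum_by_value[OF assms, where g = g and f = "\<lambda>_. 1"] by simp

context cgraph begin

definition sphere :: "'a \<Rightarrow> nat \<Rightarrow> 'a set" where "sphere x n = {z \<in> V. d x z = n}"

lemma fin_sphere [simp]: "finite (sphere x n)" using fin by (simp add: sphere_def)

lemma sphere_0: "x \<in> V \<Longrightarrow> sphere x 0 = {x}" by (auto simp: sphere_def)

lemma lap_N: "lap f z = (\<Sum>w\<in>N z. f w) - real (card (N z)) * f z"
  by (simp add: laplacian_def sum_subtractf)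

lemma sum_nbhd_swap:
  assumes "x \<in> V"
  shows "(\<Sum>z\<in>sphere x n. \<Sum>w\<in>N z. f w) = (\<Sum>w\<in>V. real (card (N w \<inter> sphere x n)) * f w)"
proof -
  have e: "w \<in> N z \<longleftrightarrow> z \<in> N w" if "z \<in> V" "w \<in> V" for z w using N_sym that by blast
  have S: "sphere x n \<subseteq> V" by (auto simp: sphere_def)
  have "(\<Sum>z\<in>sphere x n. \<Sum>w\<in>N z. f w) = (\<Sum>z\<in>sphere x n. \<Sum>w\<in>V. if w \<in> N z then f w else 0)"
    by (rule sum.cong[OF refl]) (simp add: sum.If_cases[OF fin] Int_absorb1[OF N_subset])
  also have "\<dots> = (\<Sum>w\<in>V. \<Sum>z\<in>sphere x n. if w \<in> N z then f w else 0)" by (rule sum.swap)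
  also have "\<dots> = (\<Sum>w\<in>V. real (card (N w \<inter> sphere x n)) * f w)"
  proof (rule sum.cong[OF refl])
    fix w assume w: "w \<in> V"
    have "(\<Sum>z\<in>sphere x n. if w \<in> N z then f w else 0) = (\<Sum>z\<in>sphere x n. (if z \<in> N w then 1 else 0) * f w)"
      using e w S by (intro sum.cong refl) auto
    also have "\<dots> = (\<Sum>z\<in>sphere x n. if z \<in> N w then 1 else 0) * f w" by (rule sum_distrib_right[symmetric])
    also have "\<dots> = real (card (N w \<inter> sphere x n)) * f w"
      unfolding sum_of_mem[OF fin_sphere] by (simp add: Int_commute)
    finally show "(\<Sum>z\<in>sphere x n. if w \<in> N z then f w else 0) = real (card (N w \<inter> sphere x n)) * f w" .
  qed
  finally show ?thesis .
qed

end

text \<open>The intersection matrix: the two sequences of distance regularity and the diagonal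
  entries in a single function.\<close>

locale drg = cgraph +
  fixes q :: "nat \<Rightarrow> nat \<Rightarrow> nat"
  assumes q: "\<And>x w n. x \<in> V \<Longrightarrow> w \<in> V \<Longrightarrow> card (N w \<inter> sphere x n) = q n (d x w)"
begin

definition deg where "deg = q 1 0"

lemma card_N: "x \<in> V \<Longrightarrow> card (N x) = deg"
proof -
  assume x: "x \<in> V"
  have "N x \<inter> sphere x 1 = N x" using d_N[OF x] N_V by (auto simp: sphere_def)
  then show ?thesis using q[OF x x, of 1] by (simp add: deg_def)
qed

definition eig :: "real \<Rightarrow> ('a \<Rightarrow> real) \<Rightarrow> bool" where
  "eig L f \<longleftrightarrow> (\<forall>x\<in>V. - lap f x = L * f x)"

lemma eig_sum_N: "eig L f \<Longrightarrow> z \<in> V \<Longrightarrow> (\<Sum>w\<in>N z. f w) = (real deg - L) * f z"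
  unfolding eig_def lap_N using card_N by (simp add: algebra_simps)

lemma sum_spheres:
  assumes "x \<in> V"
  shows "(\<Sum>w\<in>V. real (card (N w \<inter> sphere x n)) * f w) = (\<Sum>k\<le>Suc n. real (q n k) * sum f (sphere x k))"
proof -
  let ?W = "{w \<in> V. d x w \<le> Suc n}"
  have z: "card (N w \<inter> sphere x n) = 0" if "w \<in> V - ?W" for w
  proof -
    have "N w \<inter> sphere x n = {}"
      using that assms d_N_le'[of w _ x] by (force simp: sphere_def)
    then show ?thesis by simp
  qed
  have "(\<Sum>w\<in>V. real (card (N w \<inter> sphere x n)) * f w) = (\<Sum>w\<in>?W. real (card (N w \<inter> sphere x n)) * f w)"
    using fin z by (intro sum.mono_neutral_right) auto
  also have "\<dots> = (\<Sum>w\<in>?W. real (q n (d x w)) * f w)" using q assms by (intro sum.cong) auto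
  also have "\<dots> = (\<Sum>k\<le>Suc n. real (q n k) * (\<Sum>w\<in>{w \<in> ?W. d x w = k}. f w))"
    using fin by (intro sum_by_value) auto
  also have "\<dots> = (\<Sum>k\<le>Suc n. real (q n k) * sum f (sphere x k))"
    by (intro sum.cong refl arg_cong2[where f = "(*)"]) (auto simp: sphere_def)
  finally show ?thesis .
qed

text \<open>Distance matrices are polynomials in the adjacency matrix. Neighbour sums over a sphere
  give a recursion whose leading coefficient \<open>q m n\<close> is nonzero once some sphere of
  radius \<open>n\<close> is nonempty. One scalar serves all eigenfunctions for
  \<open>L\<close>.\<close>

lemma sphere_sums:
  "\<exists>s. \<forall>f. eig L f \<longrightarrow> (\<forall>x\<in>V. sum f (sphere x n) = s * f x)"
proof (induction n rule: less_induct)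
  case (less n)
  show ?case
  proof (cases n)
    case 0
    then show ?thesis using sphere_0 by (intro exI[of _ 1]) simp
  next
    case (Suc m)
    have "\<forall>k. \<exists>s. k < n \<longrightarrow> (\<forall>f. eig L f \<longrightarrow> (\<forall>x\<in>V. sum f (sphere x k) = s * f x))" using less by blast
    then obtain s where s: "\<And>k f x. k < n \<Longrightarrow> eig L f \<Longrightarrow> x \<in> V \<Longrightarrow> sum f (sphere x k) = s k * f x"
      by metis
    show ?thesis
    proof (cases "\<exists>x\<in>V. sphere x n \<noteq> {}")
      case True
      then obtain x z where xz: "x \<in> V" "z \<in> V" "d x z = Suc m" by (auto simp: sphere_def Suc)
      then have "d z x = Suc m" using d_sym by simp
      then obtain w where w: "w \<in> N z" "d w x = m" using step_left[OF xz(2,1)] by blast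
      have "w \<in> V" using w N_V by blast
      then have "w \<in> sphere x m" using w(2) d_sym[OF xz(1), of w] by (simp add: sphere_def)
      then have "N z \<inter> sphere x m \<noteq> {}" using w by blast
      then have qpos: "q m n \<noteq> 0" using q[OF xz(1,2), of m] xz Suc by (metis card_0_eq fin_sphere finite_Int)
      show ?thesis
      proof (intro exI allI impI ballI)
        fix f x assume f: "eig L f" and x: "x \<in> V"
        have "(real deg - L) * s m * f x = (\<Sum>z\<in>sphere x m. (real deg - L) * f z)"
          using s[of m f x] f x Suc by (simp add: sum_distrib_left[symmetric])
        also have "\<dots> = (\<Sum>z\<in>sphere x m. \<Sum>w\<in>N z. f w)"
          using eig_sum_N[OF f] by (intro sum.cong refl) (auto simp: sphere_def)
        also have "\<dots> = (\<Sum>k\<le>Suc m. real (q m k) * sum f (sphere x k))"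
          unfolding sum_nbhd_swap[OF x] sum_spheres[OF x] ..
        also have "\<dots> = (\<Sum>k\<le>m. real (q m k) * s k * f x) + real (q m n) * sum f (sphere x n)"
          using s f x Suc by (simp add: mult.assoc)
        also have "(\<Sum>k\<le>m. real (q m k) * s k * f x) = (\<Sum>k\<le>m. real (q m k) * s k) * f x"
          by (rule sum_distrib_right[symmetric])
        finally have "real (q m n) * sum f (sphere x n) = ((real deg - L) * s m - (\<Sum>k\<le>m. real (q m k) * s k)) * f x"
          by (simp add: algebra_simps)
        then show "sum f (sphere x n) = (((real deg - L) * s m - (\<Sum>k\<le>m. real (q m k) * s k)) / real (q m n)) * f x"
          using qpos by (simp add: field_simps)
      qed
    next
      case False
      then show ?thesis by (intro exI[of _ 0]) auto
    qed
  qed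
qed

text \<open>The constant function is an eigenfunction for 0.\<close>

lemma card_sphere: "\<exists>k. \<forall>x\<in>V. card (sphere x n) = k"
proof -
  have e: "eig 0 (\<lambda>_. 1)" by (simp add: eig_def laplacian_def)
  obtain s where s: "\<And>f x. eig 0 f \<Longrightarrow> x \<in> V \<Longrightarrow> sum f (sphere x n) = s * f x" using sphere_sums[of 0 n] by blast
  have s1: "real (card (sphere x n)) = s" if "x \<in> V" for x using s[OF e that] by simp
  show ?thesis
  proof (cases "V = {}")
    case False
    then obtain y where y: "y \<in> V" by blast
    show ?thesis
    proof (intro exI[of _ "card (sphere y n)"] ballI)
      fix x assume "x \<in> V"
      then show "card (sphere x n) = card (sphere y n)" using s1[of x] s1[OF y] by simp
    qed
  qed simp
qed

definition ks :: "nat \<Rightarrow> nat" where "ks n = (SOME k. \<forall>x\<in>V. card (sphere x n) = k)"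

lemma ks: "x \<in> V \<Longrightarrow> card (sphere x n) = ks n"
  using someI_ex[OF card_sphere[of n]] unfolding ks_def by blast

end

section \<open>Representation of the vertices in an eigenspace\<close>

locale drg_eigen = drg +
  fixes L :: real and \<phi> :: "'a \<Rightarrow> real" and x0
  assumes \<phi>: "eig L \<phi>" and x0: "x0 \<in> V" "\<phi> x0 \<noteq> 0"
begin

definition s :: "nat \<Rightarrow> real" where
  "s n = (SOME t. \<forall>f. eig L f \<longrightarrow> (\<forall>x\<in>V. sum f (sphere x n) = t * f x))"

lemma s: "eig L f \<Longrightarrow> x \<in> V \<Longrightarrow> sum f (sphere x n) = s n * f x"
  using someI_ex[OF sphere_sums[of L n]] unfolding s_def by blast

text \<open>The standard sequence of the eigenvalue; it is only meaningful when spheres of radius n are nonempty.\<close>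
definition u :: "nat \<Rightarrow> real" where "u n = s n / real (ks n)"

lemma ks_u: "real (ks n) * u n = s n"
proof (cases "ks n = 0")
  case True
  then have "sphere x0 n = {}" using ks[OF x0(1), of n] by simp
  then have "s n = 0" using s[OF \<phi> x0(1), of n] x0(2) by simp
  then show ?thesis using True by simp
qed (simp add: u_def)

lemma u_0: "u 0 = 1"
proof -
  have "s 0 = 1" using s[OF \<phi> x0(1), of 0] sphere_0[OF x0(1)] x0(2) by simp
  moreover have "ks 0 = 1" using ks[OF x0(1), of 0] sphere_0[OF x0(1)] by simp
  ultimately show ?thesis by (simp add: u_def)
qed

definition T :: "nat \<Rightarrow> real" where "T n = (\<Sum>k\<le>Suc n. u k * real (q k n))"

lemma sum_N_u: "x \<in> V \<Longrightarrow> z \<in> V \<Longrightarrow> (\<Sum>w\<in>N z. u (d x w)) = T (d x z)"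
proof -
  assume x: "x \<in> V" and z: "z \<in> V"
  have "(\<Sum>w\<in>N z. u (d x w)) = (\<Sum>k\<le>Suc (d x z). u k * real (card {w \<in> N z. d x w = k}))"
    using d_N_le[OF z _ x] by (intro sum_by_value_card) auto
  also have "{w \<in> N z. d x w = k} = N z \<inter> sphere x k" for k using N_V by (auto simp: sphere_def)
  then have "(\<Sum>k\<le>Suc (d x z). u k * real (card {w \<in> N z. d x w = k})) = T (d x z)"
    unfolding T_def using q[OF x z] by simp
  finally show ?thesis .
qed

lemma sphere_u: "x \<in> V \<Longrightarrow> (\<Sum>w\<in>sphere x k. u (d x w)) = s k"
proof -
  assume x: "x \<in> V"
  have "(\<Sum>w\<in>sphere x k. u (d x w)) = (\<Sum>w\<in>sphere x k. u k)" by (intro sum.cong) (auto simp: sphere_def)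
  then show ?thesis using ks[OF x, of k] ks_u[of k] by simp
qed

text \<open>On each sphere around \<open>x0\<close> the functions \<open>\<phi>\<close> and
  \<open>\<phi> x0 * u\<close> have the same sum. Comparing their neighbour sums over one sphere
  transfers the eigenvalue equation from \<open>\<phi>\<close> to \<open>u\<close>.\<close>

lemma T_u: assumes "x \<in> V" "z \<in> V" shows "T (d x z) = (real deg - L) * u (d x z)"
proof -
  define n where "n = d x z"
  have "z \<in> sphere x n" using assms by (simp add: n_def sphere_def)
  then have kn: "ks n > 0" using ks[OF assms(1), of n] by (metis card_gt_0_iff empty_iff fin_sphere)
  have "real (ks n) * T n = (\<Sum>z\<in>sphere x0 n. \<Sum>w\<in>N z. u (d x0 w))"
  proof -
    have "(\<Sum>z\<in>sphere x0 n. \<Sum>w\<in>N z. u (d x0 w)) = (\<Sum>z\<in>sphere x0 n. T n)"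
      using sum_N_u[OF x0(1)] by (intro sum.cong) (auto simp: sphere_def)
    then show ?thesis using ks[OF x0(1)] by simp
  qed
  also have "\<dots> = (\<Sum>k\<le>Suc n. real (q n k) * s k)"
    unfolding sum_nbhd_swap[OF x0(1)] sum_spheres[OF x0(1)] sphere_u[OF x0(1)] ..
  finally have "real (ks n) * T n * \<phi> x0 = (\<Sum>k\<le>Suc n. real (q n k) * s k) * \<phi> x0" by simp
  also have "\<dots> = (\<Sum>k\<le>Suc n. real (q n k) * sum \<phi> (sphere x0 k))"
    unfolding s[OF \<phi> x0(1)] sum_distrib_right by (simp add: mult.assoc)
  also have "\<dots> = (\<Sum>z\<in>sphere x0 n. \<Sum>w\<in>N z. \<phi> w)"
    unfolding sum_nbhd_swap[OF x0(1)] sum_spheres[OF x0(1)] ..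
  also have "\<dots> = (\<Sum>z\<in>sphere x0 n. (real deg - L) * \<phi> z)"
    using eig_sum_N[OF \<phi>] by (intro sum.cong) (auto simp: sphere_def)
  also have "\<dots> = (real deg - L) * s n * \<phi> x0"
    using s[OF \<phi> x0(1)] by (simp add: sum_distrib_left[symmetric])
  also have "\<dots> = (real deg - L) * (real (ks n) * u n) * \<phi> x0" by (simp add: ks_u)
  finally have "real (ks n) * T n = real (ks n) * ((real deg - L) * u n)" using x0(2) by simp
  then show ?thesis using kn by (simp add: n_def)
qed

text \<open>By \<open>Q_sq\<close> a multiple of \<open>Q\<close> is idempotent: the row of
  \<open>x\<close> is its vector in the eigenspace, and \<open>Q x z\<close> is the cosine of the
  angle between two rows.\<close>

definition Q where "Q x z = u (d x z)"

lemma Q_self: "x \<in> V \<Longrightarrow> Q x x = 1" by (simp add: Q_def u_0)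

lemma Q_sym: "x \<in> V \<Longrightarrow> z \<in> V \<Longrightarrow> Q x z = Q z x" by (simp add: Q_def d_sym)

lemma Q_eig: "x \<in> V \<Longrightarrow> eig L (Q x)"
  unfolding eig_def lap_N Q_def using sum_N_u T_u card_N by (simp add: algebra_simps)

definition cQ where "cQ = (\<Sum>z\<in>V. Q x0 z ^ 2)"

lemma cQ_pos: "cQ > 0"
proof -
  have "Q x0 x0 ^ 2 \<le> cQ" unfolding cQ_def using fin x0 by (intro member_le_sum) auto
  then show ?thesis using Q_self[OF x0(1)] by simp
qed

text \<open>Grouping by the distance from \<open>x\<close> leaves sphere sums of the eigenfunction
  \<open>Q y\<close>, which are multiples of \<open>Q y x\<close>; the case of \<open>x0\<close>
  identifies the factor.\<close>

lemma Q_sq: assumes "x \<in> V" "y \<in> V" shows "(\<Sum>z\<in>V. Q x z * Q y z) = cQ * Q x y"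
proof -
  define M where "M = Max ((\<lambda>(x, z). d x z) ` (V \<times> V))"
  have M: "d x z \<le> M" if "x \<in> V" "z \<in> V" for x z
    unfolding M_def using fin that by (intro Max_ge) auto
  have gen: "(\<Sum>z\<in>V. Q x z * Q y z) = (\<Sum>k\<le>M. u k * s k) * Q y x" if "x \<in> V" "y \<in> V" for x y
  proof -
    have "(\<Sum>z\<in>V. Q x z * Q y z) = (\<Sum>k\<le>M. u k * (\<Sum>w\<in>{w \<in> V. d x w = k}. Q y w))"
      unfolding Q_def[of x] using M[OF that(1)] fin by (intro sum_by_value) auto
    also have "\<dots> = (\<Sum>k\<le>M. u k * (s k * Q y x))"
      using s[OF Q_eig[OF that(2)] that(1)] unfolding sphere_def by simp
    finally show ?thesis by (simp add: sum_distrib_right mult.assoc)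
  qed
  have "cQ = (\<Sum>k\<le>M. u k * s k)"
    using gen[OF x0(1) x0(1)] Q_self[OF x0(1)] by (simp add: cQ_def power2_eq_square)
  then show ?thesis using gen[OF assms] Q_sym[OF assms] by simp
qed

lemma Q_sum4:
  assumes V: "a \<in> V" "b \<in> V" "e \<in> V" "g \<in> V"
  shows "(\<Sum>t\<in>V. (Q a t + Q b t - Q e t - Q g t) ^ 2)
    = cQ * (4 + 2 * Q a b + 2 * Q e g - 2 * Q a e - 2 * Q a g - 2 * Q b e - 2 * Q b g)"
proof -
  have "(\<Sum>t\<in>V. (Q a t + Q b t - Q e t - Q g t) ^ 2) = (\<Sum>t\<in>V. Q a t * Q a t + Q b t * Q b t + Q e t * Q e t + Q g t * Q g t
      + 2 * (Q a t * Q b t) + 2 * (Q e t * Q g t) - 2 * (Q a t * Q e t) - 2 * (Q a t * Q g t) - 2 * (Q b t * Q e t) - 2 * (Q b t * Q g t))"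
    by (intro sum.cong refl) (simp add: power2_eq_square algebra_simps)
  also have "\<dots> = cQ * (4 + 2 * Q a b + 2 * Q e g - 2 * Q a e - 2 * Q a g - 2 * Q b e - 2 * Q b g)"
    unfolding sum.distrib sum_subtractf sum_distrib_left[symmetric]
    using V by (simp add: Q_sq Q_self algebra_simps)
  finally show ?thesis .
qed

text \<open>Up to the factor \<open>cQ\<close>, the hypothesis bounds the squared norm of a + b - e
  - g by 0. The linear relation that follows can be read at every vertex.\<close>

lemma Q_vector_zero:
  assumes V: "a \<in> V" "b \<in> V" "e \<in> V" "g \<in> V"
    and le: "4 + 2 * Q a b + 2 * Q e g - 2 * Q a e - 2 * Q a g - 2 * Q b e - 2 * Q b g \<le> 0" and t: "t \<in> V"
  shows "Q a t + Q b t = Q e t + Q g t"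
proof -
  have "(\<Sum>t\<in>V. (Q a t + Q b t - Q e t - Q g t) ^ 2) \<le> 0"
    unfolding Q_sum4[OF V] using le cQ_pos by (simp add: mult_nonneg_nonpos)
  then have "(\<Sum>t\<in>V. (Q a t + Q b t - Q e t - Q g t) ^ 2) = 0" by (intro antisym sum_nonneg) auto
  then have "(Q a t + Q b t - Q e t - Q g t) ^ 2 = 0"
    using fin t by (subst (asm) sum_nonneg_eq_0_iff) auto
  then show ?thesis by simp
qed

text \<open>Cauchy--Schwarz for two edge vectors. As all of them have the same length, |s t| \<le>
  (s^2 + t^2) / 2 suffices.\<close>

lemma Q_gradient:
  assumes V: "x \<in> V" "y \<in> N x" "z \<in> V" "w \<in> N z"
  shows "\<bar>(Q y z - Q x z) - (Q y w - Q x w)\<bar> \<le> 2 - 2 * u 1"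
proof -
  have yw: "y \<in> V" "w \<in> V" using V N_V by blast+
  have u1: "Q x y = u 1" "Q z w = u 1" using d_N V by (simp_all add: Q_def)
  have p: "(\<Sum>t\<in>V. (Q y t - Q x t) * (Q z t - Q w t)) = cQ * ((Q y z - Q x z) - (Q y w - Q x w))"
  proof -
    have "(\<Sum>t\<in>V. (Q y t - Q x t) * (Q z t - Q w t)) = (\<Sum>t\<in>V. Q y t * Q z t - Q x t * Q z t - Q y t * Q w t + Q x t * Q w t)"
      by (intro sum.cong refl) (simp add: algebra_simps)
    also have "\<dots> = cQ * ((Q y z - Q x z) - (Q y w - Q x w))"
      unfolding sum.distrib sum_subtractf Q_sq[OF yw(1) V(3)] Q_sq[OF V(1,3)] Q_sq[OF yw] Q_sq[OF V(1) yw(2)]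
      by (simp add: algebra_simps)
    finally show ?thesis .
  qed
  have sq: "(\<Sum>t\<in>V. (Q a t - Q b t) ^ 2) = cQ * (2 - 2 * Q a b)" if "a \<in> V" "b \<in> V" for a b
  proof -
    have "(\<Sum>t\<in>V. (Q a t - Q b t) ^ 2) = (\<Sum>t\<in>V. Q a t * Q a t + Q b t * Q b t - 2 * (Q a t * Q b t))"
      by (intro sum.cong refl) (simp add: power2_eq_square algebra_simps)
    also have "\<dots> = cQ * (2 - 2 * Q a b)"
      unfolding sum.distrib sum_subtractf sum_distrib_left[symmetric] using that by (simp add: Q_sq Q_self algebra_simps)
    finally show ?thesis .
  qed
  have "\<bar>\<Sum>t\<in>V. (Q y t - Q x t) * (Q z t - Q w t)\<bar> \<le> (\<Sum>t\<in>V. \<bar>(Q y t - Q x t) * (Q z t - Q w t)\<bar>)" by (rule sum_abs)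
  also have "\<dots> \<le> (\<Sum>t\<in>V. ((Q y t - Q x t) ^ 2 + (Q z t - Q w t) ^ 2) / 2)"
  proof (rule sum_mono)
    fix t
    have "0 \<le> (\<bar>Q y t - Q x t\<bar> - \<bar>Q z t - Q w t\<bar>) ^ 2" by simp
    then show "\<bar>(Q y t - Q x t) * (Q z t - Q w t)\<bar> \<le> ((Q y t - Q x t) ^ 2 + (Q z t - Q w t) ^ 2) / 2"
      by (simp add: power2_diff abs_mult)
  qed
  also have "\<dots> = ((\<Sum>t\<in>V. (Q y t - Q x t) ^ 2) + (\<Sum>t\<in>V. (Q z t - Q w t) ^ 2)) / 2"
    by (simp add: sum.distrib sum_divide_distrib[symmetric])
  also have "\<dots> = cQ * (2 - 2 * u 1)"
    unfolding sq[OF yw(1) V(1)] sq[OF V(3) yw(2)] Q_sym[OF yw(1) V(1)] u1 by simp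
  finally have "cQ * \<bar>(Q y z - Q x z) - (Q y w - Q x w)\<bar> \<le> cQ * (2 - 2 * u 1)"
    unfolding p using cQ_pos by (simp add: abs_mult)
  then show ?thesis using cQ_pos by simp
qed

end

section \<open>Sharpness makes the standard sequence linear\<close>

locale drg_sharp = drg_eigen +
  assumes Lpos: "L > 0" and Lcurv: "L = min_curv V E" and lc: "locally_connected V E"
begin

definition M where "M = 1 - u 1"

lemma deg_M: assumes "x \<in> V" "y \<in> N x" shows "real deg * M = L" "M > 0"
proof -
  have "real deg * u 1 = (\<Sum>w\<in>N x. u (d x w))" using d_N[OF assms(1)] card_N[OF assms(1)] by simp
  also have "\<dots> = real deg - L" using sum_N_u[OF assms(1,1)] T_u[OF assms(1,1)] u_0 by simp
  finally show 1: "real deg * M = L" by (simp add: M_def algebra_simps)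
  show "M > 0"
  proof (rule ccontr)
    assume "\<not> M > 0"
    then have "real deg * M \<le> 0" by (intro mult_nonneg_nonpos) auto
    then show False using 1 Lpos by simp
  qed
qed

lemma common_card: assumes "x \<in> V" "y \<in> N x" shows "card (N x \<inter> N y) = q 1 1"
proof -
  have y: "y \<in> V" using assms N_V by blast
  have "N y \<inter> sphere x 1 = N x \<inter> N y" using d_eq_1[OF assms(1)] N_V by (auto simp: sphere_def)
  then show ?thesis using q[OF assms(1) y, of 1] d_N[OF assms] by simp
qed

lemma outer_card: assumes "x \<in> V" "y \<in> N x" shows "card (outer x y) = q 2 1"
proof -
  have y: "y \<in> V" using assms N_V by blast
  have "outer x y = N x \<inter> sphere y 2"
    using outer_iff[OF assms] d_sym[OF y] N_V by (auto simp: sphere_def)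
  then show ?thesis using q[OF y assms(1), of 2] d_N'[OF assms] by simp
qed

text \<open>The deviation from linearity at distance 2: u 0 - u 1 is M, whereas u 1 - u 2 is (1 +
  \<epsilon>) * M.\<close>

definition \<epsilon> where "\<epsilon> = (u 1 - u 2) / M - 1"

text \<open>Inner product with the edge vector from \<open>x\<close> to \<open>y\<close>, scaled to
  rise by exactly 1 along this edge.\<close>

definition pot where "pot x y z = (Q y z - Q x z) / (2 * M)"

lemma pot_values:
  assumes "x \<in> V" "y \<in> N x"
  shows "pot x y x = - 1 / 2" "pot x y y = 1 / 2"
    "w \<in> outer x y \<Longrightarrow> pot x y w = - (1 + \<epsilon>) / 2"
    "w \<in> outer y x \<Longrightarrow> pot x y w = (1 + \<epsilon>) / 2"
    "lipschitz (pot x y)" "eig L (pot x y)"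
proof -
  have V: "y \<in> V" "x \<in> N y" using assms N_V N_sym by blast+
  note Mp = deg_M(2)[OF assms]
  have Q1: "Q x y = u 1" "Q y x = u 1" using d_N[OF assms] d_N'[OF assms] by (simp_all add: Q_def)
  show "pot x y x = - 1 / 2" "pot x y y = 1 / 2"
    using Q1 Q_self[OF assms(1)] Q_self[OF V(1)] Mp by (simp_all add: pot_def M_def field_simps)
  have e: "u 2 - u 1 = - (1 + \<epsilon>) * M" using Mp by (simp add: \<epsilon>_def field_simps)
  show "pot x y w = - (1 + \<epsilon>) / 2" if "w \<in> outer x y"
  proof -
    have "w \<in> N x" "d w y = 2" using that outer_iff[OF assms] by blast+
    then have "Q y w = u 2" "Q x w = u 1" using d_sym[OF V(1) N_V] d_N[OF assms(1)] by (auto simp: Q_def)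
    then show ?thesis unfolding pot_def using e Mp by (simp add: field_simps)
  qed
  show "pot x y w = (1 + \<epsilon>) / 2" if "w \<in> outer y x"
  proof -
    have "w \<in> N y" "d w x = 2" using that outer_iff[OF V] by blast+
    then have "Q x w = u 2" "Q y w = u 1" using d_sym[OF assms(1) N_V] d_N[OF V(1)] by (auto simp: Q_def)
    then show ?thesis unfolding pot_def using e Mp by (simp add: field_simps)
  qed
  show "lipschitz (pot x y)" unfolding lipschitz_def
  proof (intro ballI)
    fix z w assume "z \<in> V" "w \<in> N z"
    then have "\<bar>(Q y z - Q x z) - (Q y w - Q x w)\<bar> \<le> 2 * M" using Q_gradient[OF assms] by (simp add: M_def)
    moreover have "\<bar>pot x y z - pot x y w\<bar> = \<bar>(Q y z - Q x z) - (Q y w - Q x w)\<bar> / (2 * M)"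
      unfolding pot_def using Mp by (simp add: diff_divide_distrib[symmetric])
    ultimately show "\<bar>pot x y z - pot x y w\<bar> \<le> 1" using Mp by simp
  qed
  show "eig L (pot x y)" unfolding eig_def
  proof
    fix z assume z: "z \<in> V"
    have "pot x y = (\<lambda>t. (1 / (2 * M)) * (Q y t - Q x t))" by (rule ext) (simp add: pot_def)
    then have "lap (pot x y) z = (1 / (2 * M)) * lap (\<lambda>t. Q y t - Q x t) z"
      by (simp only: lap_scale)
    also have "lap (\<lambda>t. Q y t - Q x t) z = lap (Q y) z - lap (Q x) z"
      unfolding laplacian_def sum_subtractf[symmetric] by (intro sum.cong) auto
    also have "\<dots> = - L * (Q y z - Q x z)"
    proof -
      have "- lap (Q x) z = L * Q x z" "- lap (Q y) z = L * Q y z"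
        using Q_eig[OF assms(1)] Q_eig[OF V(1)] z unfolding eig_def by blast+
      then show ?thesis by (simp add: algebra_simps)
    qed
    finally have "lap (pot x y) z = (1 / (2 * M)) * (- L * (Q y z - Q x z))" .
    moreover have "pot x y z = (Q y z - Q x z) / (2 * M)" by (rule pot_def)
    ultimately show "- lap (pot x y) z = L * pot x y z" by simp
  qed
qed

text \<open>The potential is an eigenfunction that rises by 1 along the edge, so its Laplacian
  difference is \<open>L\<close>; each outer vertex on either side lowers this by \<epsilon> /
  2.\<close>

lemma curv_\<epsilon>:
  assumes "x \<in> V" "y \<in> N x"
  shows "L = real (q 1 1) + 2 - real (q 2 1) * \<epsilon>"
proof -
  note p = pot_values[OF assms]
  have y: "y \<in> V" "x \<in> N y" using assms N_V N_sym by blast+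
  have "- lap (pot x y) x = L * (- 1 / 2)" "- lap (pot x y) y = L * (1 / 2)"
    using p(6) assms(1) y(1) unfolding eig_def p(1,2)[symmetric] by blast+
  then have "L = lap (pot x y) x - lap (pot x y) y" by simp
  also have "\<dots> = (real (q 1 1) + 2) * (pot x y y - pot x y x)
    + (\<Sum>w\<in>outer x y. pot x y w - pot x y x) - (\<Sum>w\<in>outer y x. pot x y w - pot x y y)"
    unfolding lap_diff[OF assms] common_card[OF assms] ..
  also have "(\<Sum>w\<in>outer x y. pot x y w - pot x y x) = (\<Sum>w\<in>outer x y. - \<epsilon> / 2)"
    using p by (intro sum.cong) (auto simp: field_simps)
  also have "(\<Sum>w\<in>outer y x. pot x y w - pot x y y) = (\<Sum>w\<in>outer y x. \<epsilon> / 2)"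
    using p by (intro sum.cong) (auto simp: field_simps)
  finally show ?thesis using p(1,2) outer_card[OF assms] outer_card[OF y] by (simp add: algebra_simps)
qed

lemma \<epsilon>_nonneg: assumes "x \<in> V" "y \<in> N x" "q 2 1 > 0" shows "\<epsilon> \<ge> 0"
proof -
  have "L \<le> real (q 1 1) + 2"
    using curv_transport_bound[OF assms(1,2), of "{}"] common_card[OF assms(1,2)] Lcurv by simp
  then have "real (q 2 1) * \<epsilon> \<ge> 0" using curv_\<epsilon>[OF assms(1,2)] by linarith
  then show ?thesis using assms(3) by (simp add: zero_le_mult_iff)
qed

text \<open>Integer parts of translates of an optimal potential are again Lipschitz; a suitable translate shows that
  the curvature drops by a full unit per outer vertex as soon as it drops at all.\<close>
lemma \<epsilon>_dichotomy: assumes "x \<in> V" "y \<in> N x" "q 2 1 > 0" "\<epsilon> > 0" shows "\<epsilon> \<ge> 1"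
proof -
  note p = pot_values[OF assms(1,2)]
  have y: "y \<in> V" "x \<in> N y" using assms N_V N_sym by blast+
  \<comment> \<open>The potential is -1/2 and 1/2 at \<open>x\<close> and \<open>y\<close>, and -(1
    + \<epsilon>)/2 and (1 + \<epsilon>)/2 at the outer vertices. With t < 1/2, \<open>x\<close> and
    its outer neighbours stay below 0 and \<open>y\<close> below 1; with t \<ge> (1 - \<epsilon>)/2
    the outer neighbours of \<open>y\<close> reach 1.\<close>
  define t where "t = max 0 ((1 - \<epsilon>) / 2)"
  have t: "0 \<le> t" "t < 1 / 2" "(1 - \<epsilon>) / 2 \<le> t" using assms(4) unfolding t_def by (simp, simp add: max_def, simp)
  define g :: "'a \<Rightarrow> real" where "g z = of_int \<lfloor>pot x y z + t\<rfloor>" for z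
  have "lipschitz g" unfolding lipschitz_def
  proof (intro ballI)
    fix z w assume "z \<in> V" "w \<in> N z"
    then have "\<bar>pot x y z - pot x y w\<bar> \<le> 1" using p(5) unfolding lipschitz_def by blast
    then have "\<lfloor>pot x y z + t\<rfloor> \<le> \<lfloor>pot x y w + t\<rfloor> + 1" "\<lfloor>pot x y w + t\<rfloor> \<le> \<lfloor>pot x y z + t\<rfloor> + 1" by linarith+
    then show "\<bar>g z - g w\<bar> \<le> 1" unfolding g_def by linarith
  qed
  moreover have "\<lfloor>- 1 / 2 + t\<rfloor> = - 1" "\<lfloor>1 / 2 + t\<rfloor> = 0" using t by linarith+
  then have gx: "g x = - 1" "g y = 0" unfolding g_def p(1,2) by simp_all
  ultimately have "L \<le> lap g x - lap g y" unfolding Lcurv by (intro min_curv_le[OF assms(1,2)]) auto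
  also have "\<dots> = (real (q 1 1) + 2) * (g y - g x)
    + (\<Sum>w\<in>outer x y. g w - g x) - (\<Sum>w\<in>outer y x. g w - g y)"
    unfolding lap_diff[OF assms(1,2)] common_card[OF assms(1,2)] ..
  also have "\<dots> \<le> real (q 1 1) + 2 - real (q 2 1)"
  proof -
    have "(\<Sum>w\<in>outer x y. g w - g x) \<le> 0"
    proof (rule sum_nonpos)
      fix w assume "w \<in> outer x y"
      then have "pot x y w = - (1 + \<epsilon>) / 2" by (rule p(3))
      then have "pot x y w + t < 0" using t assms(4) by simp
      then have "\<lfloor>pot x y w + t\<rfloor> \<le> - 1" by linarith
      then show "g w - g x \<le> 0" unfolding gx by (simp add: g_def)
    qed
    moreover have "(\<Sum>w\<in>outer y x. 1) \<le> (\<Sum>w\<in>outer y x. g w - g y)"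
    proof (rule sum_mono)
      fix w assume "w \<in> outer y x"
      then have "pot x y w = (1 + \<epsilon>) / 2" by (rule p(4))
      then have "pot x y w + t \<ge> 1" using t by (simp add: field_simps)
      then have "\<lfloor>pot x y w + t\<rfloor> \<ge> 1" by linarith
      then show "1 \<le> g w - g y" unfolding gx by (simp add: g_def)
    qed
    ultimately show ?thesis using gx outer_card[OF y] by simp
  qed
  finally have "real (q 2 1) * 1 \<le> real (q 2 1) * \<epsilon>" using curv_\<epsilon>[OF assms(1,2)] by linarith
  then show ?thesis using assms(3) by simp
qed

text \<open>If the curvature dropped, the vectors of two vertices at distance 2 and of two adjacent common neighbours
  (which exist by local connectedness) would be linearly dependent, contradicting \<open>u 1 < 1\<close>.\<close>
lemma \<epsilon>_zero: assumes x: "x \<in> V" "a \<in> N x" "y \<in> N x" "d a y = 2" shows "\<epsilon> = 0"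
proof (rule ccontr)
  assume ne: "\<epsilon> \<noteq> 0"
  have V: "a \<in> V" "y \<in> V" using x N_V by blast+
  have "a \<in> outer x y" using outer_iff[OF x(1,3)] x by blast
  then have qpos: "q 2 1 > 0" using outer_card[OF x(1,3)] by (metis card_gt_0_iff empty_iff fin_outer)
  have e1: "\<epsilon> \<ge> 1" using \<epsilon>_dichotomy[OF x(1,3) qpos] \<epsilon>_nonneg[OF x(1,3) qpos] ne by linarith
  note Mp = deg_M(2)[OF x(1,3)]
  have u2: "u 2 \<le> u 1 - 2 * M" using e1 Mp by (simp add: \<epsilon>_def field_simps)
  have cx: "connected_graph (N x) E" using lc x unfolding locally_connected_def by blast
  interpret L: cgraph "N x" E using local_cgraph[OF x(1) cx] .
  have "L.d a y \<noteq> 0" "L.d a y \<noteq> 1"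
    using L.d_eq_1[OF x(2,3)] d_eq_1[OF V] x by (auto simp: nbhd_local)
  then obtain n where n: "L.d a y = Suc (Suc n)" by (metis One_nat_def not0_implies_Suc)
  \<comment> \<open>The first two steps of a geodesic from \<open>a\<close> to \<open>y\<close>
    inside \<open>N x\<close>: \<open>x\<close> is adjacent to \<open>a\<close>, \<open>p1\<close>
    and \<open>p2\<close>, and \<open>d a p2 = 2\<close>.\<close>
  obtain p1 where p1: "p1 \<in> L.N a" "L.d p1 y = Suc n" using L.step_left[OF x(2,3) n] .
  have p1x: "p1 \<in> N x" "p1 \<in> N a" using p1 by (auto simp: nbhd_local)
  obtain p2 where p2: "p2 \<in> L.N p1" "L.d p2 y = n" using L.step_left[OF p1x(1) x(3) p1(2)] .
  have p2x: "p2 \<in> N x" "p2 \<in> N p1" using p2 by (auto simp: nbhd_local)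
  have "p2 \<notin> N a"
  proof
    assume "p2 \<in> N a"
    then have "p2 \<in> L.N a" using p2x by (simp add: nbhd_local)
    then show False using L.d_N_le2[OF x(2) _ x(3), of p2] n p2(2) by simp
  qed
  moreover have "p2 \<noteq> a" using n p2(2) by auto
  ultimately have d2: "d a p2 = 2" using d_two[OF x(1,2) p2x(1)] by simp
  have PV: "p1 \<in> V" "p2 \<in> V" using p1x p2x N_V by blast+
  have Qs: "Q a p2 = u 2" "Q x p1 = u 1" "Q a x = u 1" "Q a p1 = u 1" "Q p2 x = u 1" "Q p2 p1 = u 1" "Q p1 x = u 1"
    using d2 d_N[OF x(1) p1x(1)] d_N'[OF x(1,2)] d_N[OF V(1) p1x(2)] d_N'[OF x(1) p2x(1)] d_N'[OF PV(1) p2x(2)]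
      d_N'[OF x(1) p1x(1)] by (simp_all add: Q_def)
  \<comment> \<open>The expression equals 4 + 2 * u 2 - 6 * u 1, which is at most 4 - 4 * u 1 - 4 *
    M = 0. The resulting relation, read at \<open>x\<close>, says 2 * u 1 = 1 + u 1, that is M =
    0.\<close>
  have "4 + 2 * Q a p2 + 2 * Q x p1 - 2 * Q a x - 2 * Q a p1 - 2 * Q p2 x - 2 * Q p2 p1 \<le> 0"
    unfolding Qs using u2 by (simp add: M_def)
  then have "Q a x + Q p2 x = Q x x + Q p1 x" using Q_vector_zero[OF V(1) PV(2) x(1) PV(1) _ x(1)] by blast
  then show False unfolding Qs Q_self[OF x(1)] using Mp by (simp add: M_def)
qed

text \<open>With \<epsilon> = 0 the curvature is \<open>q 1 1 + 2\<close>, so the transport bound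
  for the single outer vertex \<open>y\<close> of the edge from \<open>a\<close> to \<open>x\<close>
  yields \<open>b\<close>. Then u 2 = 2 * u 1 - 1 makes the norm of a + y - x - b vanish.\<close>

lemma quadrangle:
  assumes x: "x \<in> V" "a \<in> N x" "y \<in> N x" "d a y = 2"
  shows "\<exists>b\<in>V. b \<in> N a \<and> b \<in> N y \<and> (\<forall>z\<in>V. Q a z + Q y z = Q x z + Q b z)"
proof -
  have V: "a \<in> V" "y \<in> V" "x \<in> N a" using x N_V N_sym by blast+
  note e0 = \<epsilon>_zero[OF x]
  have yo: "y \<in> outer x a" using outer_iff[OF x(1,2)] x d_sym[OF V(1,2)] by simp
  have "L \<le> real (q 1 1) + 2 + real (card (N y \<inter> outer a x)) - 1"
    using curv_transport_bound[OF V(1,3), of "{y}"] yo common_card[OF V(1,3)] Lcurv by simp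
  then have "card (N y \<inter> outer a x) \<noteq> 0" using curv_\<epsilon>[OF x(1,2)] e0 by auto
  then have "N y \<inter> outer a x \<noteq> {}" by force
  then obtain b where b: "b \<in> N y" "b \<in> outer a x" by blast
  then have bN: "b \<in> N a" "d b x = 2" using outer_iff[OF V(1,3)] by blast+
  have bV: "b \<in> V" using b N_V by blast
  have u2: "u 2 = 2 * u 1 - 1"
    using e0 deg_M(2)[OF x(1,2)] by (simp add: \<epsilon>_def M_def field_simps)
  have Qs: "Q a y = u 2" "Q x b = u 2" "Q a x = u 1" "Q a b = u 1" "Q y x = u 1" "Q y b = u 1"
    using x(4) bN(2) d_sym[OF bV x(1)] d_N'[OF x(1,2)] d_N[OF V(1) bN(1)] d_N'[OF x(1,3)] d_N[OF V(2) b(1)]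
    by (simp_all add: Q_def)
  have "4 + 2 * Q a y + 2 * Q x b - 2 * Q a x - 2 * Q a b - 2 * Q y x - 2 * Q y b \<le> 0"
    unfolding Qs u2 by simp
  then show ?thesis using Q_vector_zero[OF V(1,2) x(1) bV] bV bN b by blast
qed

text \<open>Completing the first two steps of a geodesic from \<open>x\<close> to \<open>z\<close>
  gives a quadrangle with distances m + 2, m + 1, m + 1 and m to \<open>z\<close>, so the second
  differences of \<open>u\<close> vanish.\<close>

lemma u_linear: "x \<in> V \<Longrightarrow> z \<in> V \<Longrightarrow> d x z = n \<Longrightarrow> u n = 1 - real n * M"
proof (induction n arbitrary: x rule: less_induct)
  case (less n)
  consider "n = 0" | "n = 1" | m where "n = Suc (Suc m)" by (metis One_nat_def not0_implies_Suc)
  then show ?case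
  proof cases
    case 3
    have "d x z = Suc (Suc m)" using less(4) 3 by simp
    then obtain w1 where w1: "w1 \<in> N x" "d w1 z = Suc m" using step_left[OF less(2,3)] by blast
    have w1V: "w1 \<in> V" "x \<in> N w1" using w1 less N_V N_sym by blast+
    obtain w2 where w2: "w2 \<in> N w1" "d w2 z = m" using step_left[OF w1V(1) less(3) w1(2)] .
    have w2V: "w2 \<in> V" using w2 N_V by blast
    have "w2 \<notin> N x" using d_N_le2[OF less(2) _ less(3), of w2] less(4) 3 w2 by auto
    moreover have "x \<noteq> w2" using less(4) 3 w2 by auto
    ultimately have "d x w2 = 2" using d_two[OF w1V w2(1)] by simp
    then obtain b where b: "b \<in> V" "b \<in> N x" "b \<in> N w2" "\<forall>z\<in>V. Q x z + Q w2 z = Q w1 z + Q b z"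
      using quadrangle[OF w1V w2(1)] by blast
    have "d b z = Suc m"
      using d_N_le2[OF less(2) b(2) less(3)] d_N_le2[OF w2V b(3) less(3)] less(4) 3 w2(2) by linarith
    then have "u n + u m = u (Suc m) + u (Suc m)"
      using b(4)[rule_format, OF less(3)] w1(2) w2(2) less(4) by (simp add: Q_def)
    moreover have "u m = 1 - real m * M" using less(1)[OF _ w2V less(3) w2(2)] 3 by simp
    moreover have "u (Suc m) = 1 - real (Suc m) * M" using less(1)[OF _ w1V(1) less(3) w1(2)] 3 by simp
    ultimately show ?thesis unfolding 3 by (simp add: algebra_simps)
  qed (simp_all add: u_0 M_def)
qed

lemma drg_parallelogram: "parallelogram V E"
  unfolding parallelogram_def
proof (intro ballI impI)
  fix x a y assume x: "x \<in> V" "a \<in> N x" "y \<in> N x" "d a y = 2"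
  have V: "a \<in> V" "y \<in> V" using x N_V by blast+
  obtain b where b: "b \<in> V" "\<forall>z\<in>V. Q a z + Q y z = Q x z + Q b z" using quadrangle[OF x] by blast
  note Mp = deg_M(2)[OF x(1,2)]
  have Q: "Q v z = 1 - real (d v z) * M" if "v \<in> V" "z \<in> V" for v z
    unfolding Q_def by (rule u_linear[OF that refl])
  have "d a z + d y z = d x z + d b z" if z: "z \<in> V" for z
  proof -
    have "M * (real (d a z) + real (d y z)) = M * (real (d x z) + real (d b z))"
      using b(2)[rule_format, OF z] Q[OF V(1) z] Q[OF V(2) z] Q[OF x(1) z] Q[OF b(1) z] by (simp add: algebra_simps)
    then have "real (d a z) + real (d y z) = real (d x z) + real (d b z)" using Mp by simp
    then show ?thesis by linarith
  qed
  then show "\<exists>b\<in>V. \<forall>z\<in>V. d a z + d y z = d x z + d b z" using b(1) by blast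
qed

end

lemma (in cgraph) distance_regular_parallelogram:
  assumes lc: "locally_connected V E" and dr: "distance_regular V E" and ls: "lichnerowicz_sharp V E"
  shows "parallelogram V E"
proof -
  obtain b c where bc: "\<And>x z. x \<in> V \<Longrightarrow> z \<in> V \<Longrightarrow> card {w \<in> N z. d x w = d x z + 1} = b (d x z)"
    "\<And>x z. x \<in> V \<Longrightarrow> z \<in> V \<Longrightarrow> d x z \<ge> 1 \<Longrightarrow> card {w \<in> N z. d x w + 1 = d x z} = c (d x z)"
    using dr unfolding distance_regular_def by blast
  \<comment> \<open>The degree is \<open>b 0\<close>, so the diagonal entry is what the two
    sequences leave of it. Distance regularity does not prescribe \<open>c 0\<close>, hence the case
    \<open>k = 0\<close>.\<close>
  define q :: "nat \<Rightarrow> nat \<Rightarrow> nat" where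
    "q n k = (if n = k + 1 then b k else if n + 1 = k then c k else
      if n = k then b 0 - b k - (if k = 0 then 0 else c k) else 0)" for n k
  have q: "card (N w \<inter> sphere x n) = q n (d x w)" if xw: "x \<in> V" "w \<in> V" for x w n
  proof -
    let ?k = "d x w"
    let ?S = "\<lambda>n. {v \<in> N w. d x v = n}"
    have S: "N w \<inter> sphere x n = ?S n" for n using N_V by (auto simp: sphere_def)
    have le: "d x v \<le> ?k + 1" "?k \<le> d x v + 1" if "v \<in> N w" for v
      using d_N_le[OF xw(2) that xw(1)] d_N_le'[OF xw(2) that xw(1)] by auto
    have D: "card (N w) = b 0"
    proof -
      have "{v \<in> N w. d w v = d w w + 1} = N w" using d_N[OF xw(2)] by auto
      then show ?thesis using bc(1)[OF xw(2,2)] by simp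
    qed
    have up: "card (?S (?k + 1)) = b ?k" using bc(1)[OF xw] .
    have down: "card {v \<in> N w. d x v + 1 = ?k} = (if ?k = 0 then 0 else c ?k)" using bc(2)[OF xw] by auto
    have "N w = ?S (?k + 1) \<union> ({v \<in> N w. d x v + 1 = ?k} \<union> ?S ?k)" using le by force
    moreover have "card (?S (?k + 1) \<union> ({v \<in> N w. d x v + 1 = ?k} \<union> ?S ?k))
      = card (?S (?k + 1)) + (card {v \<in> N w. d x v + 1 = ?k} + card (?S ?k))"
      by (subst card_Un_disjoint, simp, simp, force, subst card_Un_disjoint) auto
    ultimately have mid: "card (?S ?k) = b 0 - b ?k - (if ?k = 0 then 0 else c ?k)" using D up down by simp
    consider "n = ?k + 1" | "n + 1 = ?k" | "n = ?k" | "n \<noteq> ?k + 1" "n + 1 \<noteq> ?k" "n \<noteq> ?k" by blast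
    then show ?thesis unfolding S
    proof cases
      case 1 then show "card (?S n) = q n ?k" using up by (simp add: q_def)
    next
      case 2
      then have "?S n = {v \<in> N w. d x v + 1 = ?k}" by auto
      then show "card (?S n) = q n ?k" using down 2 by (auto simp: q_def)
    next
      case 3 then show "card (?S n) = q n ?k" using mid by (simp add: q_def)
    next
      case 4
      then have "?S n = {}" using le by force
      then show "card (?S n) = q n ?k" using 4 by (simp add: q_def)
    qed
  qed
  interpret drg V E q by unfold_locales (rule q)
  obtain L where L: "neg_lap_eigenvalue V E L" "L > 0" "L = min_curv V E"
    using ls unfolding lichnerowicz_sharp_def by blast
  obtain f x0 where f: "x0 \<in> V" "f x0 \<noteq> 0" "eig L f"
    using L(1) unfolding neg_lap_eigenvalue_def eig_def by blast
  interpret drg_sharp V E q L f x0 by unfold_locales (use f L lc in auto)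
  show ?thesis by (rule drg_parallelogram)
qed

section \<open>The equivalences\<close>

lemma graph_iso_card:
  assumes "graph_iso V E W F" "w \<in> W" "w' \<in> W"
  shows "card V = card W"
    and "\<exists>v\<in>V. \<exists>v'\<in>V. (E v v' \<longleftrightarrow> F w w') \<and> card (nbhd V E v) = card (nbhd W F w)
      \<and> card (nbhd V E v \<inter> nbhd V E v') = card (nbhd W F w \<inter> nbhd W F w')"
proof -
  obtain f where f: "bij_betw f V W" "\<And>u v. u \<in> V \<Longrightarrow> v \<in> V \<Longrightarrow> E u v \<longleftrightarrow> F (f u) (f v)"
    using assms(1) unfolding graph_iso_def by blast
  show "card V = card W" using f(1) by (rule bij_betw_same_card)
  have im: "f ` V = W" "inj_on f V" using f(1) by (auto simp: bij_betw_def)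
  obtain v v' where v: "v \<in> V" "v' \<in> V" "w = f v" "w' = f v'" using assms im by blast
  have N: "f ` nbhd V E v = nbhd W F (f v)" if "v \<in> V" for v
    using f(2)[OF that] im(1) unfolding nbhd_def by auto
  have sub: "nbhd V E v \<subseteq> V" for v by (auto simp: nbhd_def)
  have card_im: "card (f ` S) = card S" if "S \<subseteq> V" for S
    using that im(2) by (meson card_image inj_on_subset)
  have "card (nbhd V E v) = card (nbhd W F w)"
    using card_im[OF sub[of v]] N[OF v(1)] v(3) by simp
  moreover have "f ` (nbhd V E v \<inter> nbhd V E v') = nbhd W F w \<inter> nbhd W F w'"
    using inj_on_image_Int[OF im(2) sub sub, of v v'] N[OF v(1)] N[OF v(2)] v by simp
  then have "card (nbhd V E v \<inter> nbhd V E v') = card (nbhd W F w \<inter> nbhd W F w')"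
    using card_im[of "nbhd V E v \<inter> nbhd V E v'"] sub by (metis inf.coboundedI1)
  ultimately show "\<exists>v\<in>V. \<exists>v'\<in>V. (E v v' \<longleftrightarrow> F w w') \<and> card (nbhd V E v) = card (nbhd W F w)
      \<and> card (nbhd V E v \<inter> nbhd V E v') = card (nbhd W F w \<inter> nbhd W F w')"
    using v f(2)[OF v(1,2)] by blast
qed

text \<open>Evaluating one pair of adjacent vertices of the model suffices for 16 and 10, which are
  constant. As the diameter is at most 2, \<open>diam2_card_common\<close> gives 2 * (10 + 2) - 16 =
  8.\<close>

lemma (in pgraph) schlafli_iso_srg:
  assumes lc: "locally_connected V E" and iso: "graph_iso V E schlafli_V gosset_E"
  shows "is_schlafli V E"
proof -
  let ?h = "(False, {2, 3}) :: bool \<times> nat set" and ?h' = "(False, {2, 4}) :: bool \<times> nat set"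
  have h: "?h \<in> schlafli_V" "?h' \<in> schlafli_V"
    by (simp_all add: schlafli_V_def nbhd_def gosset_V_def gosset_E_def)
  have nb: "nbhd schlafli_V gosset_E v = Set.filter (gosset_E v) schlafli_V" for v
    by (auto simp: nbhd_def)
  have c: "card schlafli_V = 27" "card (nbhd schlafli_V gosset_E ?h) = 16"
    "card (nbhd schlafli_V gosset_E ?h \<inter> nbhd schlafli_V gosset_E ?h') = 10" "gosset_E ?h ?h'"
    unfolding nb schlafli_V_list by code_simp+
  obtain a where a: "\<And>x y. x \<in> V \<Longrightarrow> y \<in> N x \<Longrightarrow> card (N x \<inter> N y) = a"
    using card_common_const[OF lc] by blast
  obtain v v' where v: "v \<in> V" "v' \<in> V" "E v v'" "card (N v) = 16" "card (N v \<inter> N v') = 10"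
    using graph_iso_card(2)[OF iso h] c by auto
  have a10: "a = 10" using a[of v v'] v by (simp add: N_iff)
  have D: "card (N u) = 16" if "u \<in> V" for u using card_N_const[OF that v(1)] v by simp
  have "\<not> has_far schlafli_V gosset_E"
    unfolding schlafli_V_def
    by (rule pgraph.local_not_far[OF gosset_pgraph gosset_base schlafli_connected[unfolded schlafli_V_def]])
  then have nf: "\<not> has_far V E" using has_far_iso[OF _ graph_iso_sym[OF iso]] by blast
  show ?thesis unfolding is_schlafli_def strongly_regular_def
  proof (intro conjI ballI impI)
    show "card V = 27" using graph_iso_card(1)[OF iso h] c by simp
    show "Deg V E u = 16" if "u \<in> V" for u using D[OF that] by (simp add: Deg_def)
    show "card (N u \<inter> N w) = 10" if "u \<in> V" "w \<in> V" "E u w" for u w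
      using a[of u w] that a10 by (simp add: N_iff)
    show "card (N u \<inter> N w) = 8" if uw: "u \<in> V" "w \<in> V" "u \<noteq> w \<and> \<not> E u w" for u w
    proof -
      obtain t where t: "t \<in> V" "E u t" "E t w" using nf uw unfolding has_far_def by blast
      then have "t \<in> N u" "w \<in> N t" by (simp_all add: N_iff uw)
      then have "d u w = 2" using d_eq_2[OF uw(1,2)] uw(3) by (auto simp: N_iff)
      then have "d w u = 2" using d_sym uw by simp
      then have "int (card (N u \<inter> N w)) = 2 * (int a + 2) - int (card (N w))"
        by (intro diam2_card_common[OF nf _ uw(2,1)]) (rule a)
      then show ?thesis using a10 D[OF uw(2)] by simp
    qed
  qed
qed

theorem theorem4p1:
  fixes V :: "'a set" and E :: "'a \<Rightarrow> 'a \<Rightarrow> bool"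
  assumes "simple_graph V E"
    and "connected_graph V E"
    and "locally_connected V E"
    and "\<exists>x y. E x y"
  shows "(eff_BM_sharp V E \<longleftrightarrow> reflective V E)
       \<and> (reflective V E \<longleftrightarrow> distance_regular V E \<and> lichnerowicz_sharp V E)
       \<and> (distance_regular V E \<and> lichnerowicz_sharp V E \<longleftrightarrow>
            (\<exists>k. k \<ge> 3 \<and> graph_iso V E (cocktail_V k) cocktail_E)
          \<or> (\<exists>n k. graph_iso V E (johnson_V n k) (johnson_E k))
          \<or> (\<exists>n. graph_iso V E (halved_cube_V n) halved_cube_E)
          \<or> is_schlafli V E
          \<or> graph_iso V E gosset_V gosset_E)"
proof -
  interpret cgraph V E
    using assms(1,2) unfolding simple_graph_def by unfold_locales blast+
  let ?list = "(\<exists>k. k \<ge> 3 \<and> graph_iso V E (cocktail_V k) cocktail_E)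
          \<or> (\<exists>n k. graph_iso V E (johnson_V n k) (johnson_E k))
          \<or> (\<exists>n. graph_iso V E (halved_cube_V n) halved_cube_E)
          \<or> is_schlafli V E
          \<or> graph_iso V E gosset_V gosset_E"
  obtain x y where "E x y" using assms(4) by blast
  \<comment> \<open>Without an edge the minimum curvature would be taken over the empty set.\<close>
  then have edge: "\<exists>x\<in>V. N x \<noteq> {}" using assms(1) unfolding simple_graph_def nbhd_def by blast
  have pg: "pgraph V E" if "parallelogram V E" using that by unfold_locales
  have fwd: "eff_BM_sharp V E \<and> reflective V E \<and> distance_regular V E \<and> lichnerowicz_sharp V E \<and> ?list"
    if P: "parallelogram V E"
  proof -
    interpret pgraph V E by (rule pg[OF P])
    have "V \<noteq> {}" using edge by blast
    then have "standard_graph V E" by (intro standard_classification pg[OF P] assms(3))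
    then consider "complete_on V E" | k where "k \<ge> 3" "graph_iso V E (cocktail_V k) cocktail_E"
      | n k where "graph_iso V E (johnson_V n k) sd_adj" | n where "graph_iso V E (even_V n) sd_adj"
      | "graph_iso V E schlafli_V gosset_E" | "graph_iso V E gosset_V gosset_E"
      unfolding standard_graph_def by blast
    then have ?list
    proof cases
      case 1
      then have "graph_iso V E (johnson_V (card V) 1) sd_adj" using complete_iso fin irr by blast
      then show ?thesis using graph_iso_trans[OF _ graph_iso_sym[OF johnson_iso]] by blast
    next
      case (3 n k)
      then show ?thesis using graph_iso_trans[OF 3 graph_iso_sym[OF johnson_iso]] by blast
    next
      case (4 n)
      then show ?thesis using graph_iso_trans[OF 4 halved_cube_iso] by blast
    next
      case 5
      then show ?thesis using schlafli_iso_srg[OF assms(3)] by blast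
    qed blast+
    then show ?thesis using sharp_pgraph[OF assms(3) edge] reflective_pgraph distance_regular_pgraph[OF assms(3)] by blast
  qed
  have "parallelogram V E" if ?list
  proof -
    from that consider k where "k \<ge> 3" "graph_iso V E (cocktail_V k) cocktail_E"
      | n k where "graph_iso V E (johnson_V n k) (johnson_E k)"
      | n where "graph_iso V E (halved_cube_V n) halved_cube_E"
      | "is_schlafli V E" | "graph_iso V E gosset_V gosset_E" by blast
    then have "pgraph V E"
    proof cases
      case (1 k)
      then show ?thesis using pgraph_iso[OF cocktail_pgraph 1(2)] by simp
    next
      case (2 n k)
      then show ?thesis using pgraph_iso[OF johnson_sd_pgraph(1) graph_iso_trans[OF 2 johnson_iso]] by simp
    next
      case (3 n)
      then show ?thesis
        using pgraph_iso[OF even_sd_pgraph(1) graph_iso_trans[OF 3 graph_iso_sym[OF halved_cube_iso]]] by simp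
    next
      case 4
      then show ?thesis by (rule schlafli_pgraph)
    next
      case 5
      then show ?thesis by (rule pgraph_iso[OF gosset_pgraph])
    qed
    then show ?thesis by (rule pgraph.par)
  qed
  then show ?thesis
    using fwd sharp_parallelogram reflective_parallelogram distance_regular_parallelogram[OF assms(3)] by blast
qed

end
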